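(* Let $p\in\{2,3,5,7,13\}$ and let $\ell\ne p$ be a prime with $\ell>3$. Let $s>0$ and $r<0$ be integers of opposite parity satisfying $$0\le r+sp<24\qquad\text{and}\qquad s+rp<0.$$ Define integers $c(n)$ by $$\sum_{n=0}^\infty c(n)q^n=\prod_{n=1}^\infty(1-q^n)^r\prod_{n=1}^\infty(1-q^{pn})^s,$$ with $c(x)=0$ whenever $x$ is not a nonnegative integer. Put $$\varepsilon=\tfrac12(r+s),\quad \theta=(-1)^{\frac12-\frac12(r+s)}\,2p^{s},\quad \Delta=(r+sp)\frac{\ell^2-1}{24},\quad k=\frac{24}{p-1}.$$ Then for every nonnegative integer $n$, $$\ell^{2-2\varepsilon}c(n\ell^2+\Delta)+\left(\frac{\theta}{\ell}\right)\ell^{\frac12-\varepsilon}\left(\frac{n-\Delta}{\ell}\right)c(n)+c\!\left(\frac{n-\Delta}{\ell^2}\right)\equiv \lambda_{r,s,p,\ell}\,c(n)\pmod{p^{k/2}},$$ where $$\lambda_{r,s,p,\ell}=\ell^{2-2\varepsilon}c(\Delta)+\left(\frac{\theta}{\ell}\right)\ell^{\frac12-\varepsilon}\left(\frac{-\Delta}{\ell}\right)+c\!\left(\frac{-\Delta}{\ell^2}\right).$$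
   Context: Since $r+s$ is odd, $2-2\varepsilon$ and $\frac12-\varepsilon$ are integers and $\theta$ is an integer; $\Delta$ is an integer since $\ell>3$. $\left(\frac{\cdot}{\ell}\right)$ is the Legendre symbol (zero if $\ell$ divides the top entry). Powers of $\ell$ may have negative exponent, so the quantities are rational numbers with denominators powers of $\ell$; the congruence modulo $p^{k/2}$ is understood in the ring of $p$-integral rational numbers. *)

theory Defs
  imports "HOL-Analysis.Infinite_Products" "HOL-Number_Theory.Number_Theory"
begin

text \<open>
  The infinite products are taken in the ring of formal power series over the rationals with its
  \<open>X\<close>-adic metric, the factor with index \<open>n\<close> (counted from 0) being the one for \<open>n + 1\<close>.
  Rational coefficients make integer powers \<open>powi\<close> with negative exponent available.
\<close>

definition eta_series :: "int \<Rightarrow> int \<Rightarrow> nat \<Rightarrow> rat fps" where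
  "eta_series r s p =
     (\<Prod>n. (1 - fps_X ^ Suc n) powi r) * (\<Prod>n. (1 - fps_X ^ (p * Suc n)) powi s)"

text \<open>
  The coefficients \<open>c(x)\<close> have rational arguments, so that \<open>c((n - \<Delta>) / l\<^sup>2)\<close> is meaningful
  whether or not the division is exact.
\<close>

definition eta_coeff :: "int \<Rightarrow> int \<Rightarrow> nat \<Rightarrow> rat \<Rightarrow> rat" where
  "eta_coeff r s p x = (if x \<in> \<nat> then fps_nth (eta_series r s p) (nat \<lfloor>x\<rfloor>) else 0)"

definition p_integral :: "nat \<Rightarrow> rat set" where
  "p_integral p = {x. \<not> int p dvd snd (quotient_of x)}"

definition p_integral_cong :: "nat \<Rightarrow> nat \<Rightarrow> rat \<Rightarrow> rat \<Rightarrow> bool" where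
  "p_integral_cong p m x y \<longleftrightarrow>
     x \<in> p_integral p \<and> y \<in> p_integral p \<and> (\<exists>z\<in>p_integral p. x - y = of_nat p ^ m * z)"

text \<open>The infinite products converge, and the coefficients are integers.\<close>

definition Z_fps :: "rat fps set" where "Z_fps = {F. \<forall>n. fps_nth F n \<in> \<int>}"

lemma Z_fps_mult: "F \<in> Z_fps \<Longrightarrow> G \<in> Z_fps \<Longrightarrow> F * G \<in> Z_fps"
  unfolding Z_fps_def by (auto simp: fps_mult_nth intro!: Ints_sum Ints_mult)

lemma Z_fps_add: "F \<in> Z_fps \<Longrightarrow> G \<in> Z_fps \<Longrightarrow> F + G \<in> Z_fps"
  unfolding Z_fps_def by auto

lemma Z_fps_one: "1 \<in> Z_fps"
  unfolding Z_fps_def by auto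

lemma Z_fps_X_power: "fps_X ^ j \<in> Z_fps"
  unfolding Z_fps_def by (auto simp: fps_X_power_nth)

lemma inverse_one_minus_X_power:
  assumes "j > 0"
  obtains A where "A \<in> Z_fps" "inverse (1 - fps_X ^ j :: rat fps) = 1 + fps_X ^ j * A"
proof -
  define A :: "rat fps" where "A = Abs_fps (\<lambda>n. if j dvd n then 1 else 0)"
  have A: "A = 1 + fps_X ^ j * A"
  proof (rule fps_ext)
    fix n
    show "fps_nth A n = fps_nth (1 + fps_X ^ j * A) n"
      using assms by (auto simp: A_def fps_X_power_mult_nth dvd_imp_le dvd_minus_self)
  qed
  have "A * (1 - fps_X ^ j) = A - fps_X ^ j * A"
    by (simp add: algebra_simps)
  also have "\<dots> = 1"
    using A by (metis add_diff_cancel_right')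
  finally have "inverse (1 - fps_X ^ j) = A"
    using fps_inverse_unique[of "1 - fps_X ^ j" A] by (simp add: mult.commute)
  moreover have "A \<in> Z_fps"
    by (auto simp: A_def Z_fps_def)
  ultimately show ?thesis
    using A that by metis
qed

lemma one_plus_X_power_power:
  assumes "A \<in> Z_fps"
  shows "\<exists>B\<in>Z_fps. (1 + fps_X ^ j * A :: rat fps) ^ e = 1 + fps_X ^ j * B"
proof (induction e)
  case 0
  show ?case by (intro bexI[of _ 0]) (auto simp: Z_fps_def)
next
  case (Suc e)
  then obtain B where B: "B \<in> Z_fps" "(1 + fps_X ^ j * A) ^ e = 1 + fps_X ^ j * B"
    by blast
  have distr: "(1 + Y * A) * (1 + Y * B) = 1 + Y * (A + B + Y * (A * B))" for Y :: "rat fps"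
    by (simp add: algebra_simps)
  have "(1 + fps_X ^ j * A) ^ Suc e = (1 + fps_X ^ j * A) * (1 + fps_X ^ j * B)"
    by (simp only: power_Suc B(2))
  also have "\<dots> = 1 + fps_X ^ j * (A + B + fps_X ^ j * (A * B))"
    by (rule distr)
  finally have "(1 + fps_X ^ j * A) ^ Suc e = 1 + fps_X ^ j * (A + B + fps_X ^ j * (A * B))" .
  moreover have "A + B + fps_X ^ j * (A * B) \<in> Z_fps"
    using assms B by (intro Z_fps_add Z_fps_mult Z_fps_X_power)
  ultimately show ?case by blast
qed

lemma one_minus_X_power_powi:
  assumes "j > 0"
  shows "\<exists>B\<in>Z_fps. (1 - fps_X ^ j :: rat fps) powi e = 1 + fps_X ^ j * B"
proof (cases "e \<ge> 0")
  case True
  have "(-1 :: rat fps) \<in> Z_fps"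
    by (auto simp: Z_fps_def)
  from one_plus_X_power_power[OF this, of j "nat e"] True show ?thesis
    by (simp add: power_int_def)
next
  case False
  obtain A where "A \<in> Z_fps" "inverse (1 - fps_X ^ j :: rat fps) = 1 + fps_X ^ j * A"
    using inverse_one_minus_X_power[OF assms] by blast
  with one_plus_X_power_power[of A j "nat (- e)"] False show ?thesis
    by (simp add: power_int_def)
qed

lemma eta_factor_has_prod:
  assumes "m > 0"
  shows "\<exists>P\<in>Z_fps. (\<lambda>n. (1 - fps_X ^ (m * Suc n) :: rat fps) powi e) has_prod P"
proof -
  define f :: "nat \<Rightarrow> rat fps" where "f = (\<lambda>n. (1 - fps_X ^ (m * Suc n)) powi e)"
  have f: "\<exists>B\<in>Z_fps. f n = 1 + fps_X ^ (m * Suc n) * B" for n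
    unfolding f_def using assms by (intro one_minus_X_power_powi) auto
  have Z: "f n \<in> Z_fps" for n
    using f[of n] by (auto intro!: Z_fps_add Z_fps_mult Z_fps_one Z_fps_X_power)
  define Q where "Q = (\<lambda>N. \<Prod>n\<le>N. f n)"
  have QZ: "Q N \<in> Z_fps" for N
    unfolding Q_def by (induction N) (auto intro!: Z Z_fps_mult)
  have step: "fps_nth (Q (Suc N)) i = fps_nth (Q N) i" if "i \<le> N" for i N
  proof -
    obtain B where B: "f (Suc N) = 1 + fps_X ^ (m * Suc (Suc N)) * B"
      using f by blast
    have "Q (Suc N) = Q N * f (Suc N)"
      unfolding Q_def by (rule prod.atMost_Suc)
    also have "\<dots> = Q N + fps_X ^ (m * Suc (Suc N)) * (B * Q N)"
      by (simp only: B distrib_left mult_1_left mult_1_right mult_ac)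
    finally have "Q (Suc N) = Q N + fps_X ^ (m * Suc (Suc N)) * (B * Q N)" .
    moreover have "i < m * Suc (Suc N)"
    proof -
      have "i < 1 * Suc (Suc N)"
        using that by simp
      also have "\<dots> \<le> m * Suc (Suc N)"
        using assms by (intro mult_le_mono1) auto
      finally show ?thesis .
    qed
    ultimately show ?thesis
      by (simp only: fps_add_nth fps_X_power_mult_nth if_True add_0_right)
  qed
  have const: "fps_nth (Q N) i = fps_nth (Q i) i" if "i \<le> N" for i N
    using that by (induction N rule: dec_induct) (simp_all add: step)
  define P where "P = Abs_fps (\<lambda>i. fps_nth (Q i) i)"
  have lim: "Q \<longlonglongrightarrow> P"
  proof (rule tendsto_fpsI)
    fix i
    show "eventually (\<lambda>N. fps_nth (Q N) i = fps_nth P i) sequentially"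
      using eventually_ge_at_top[of i] unfolding P_def fps_nth_Abs_fps
      by eventually_elim (rule const)
  qed
  have "fps_nth P 0 = 1"
  proof -
    obtain B where "f 0 = 1 + fps_X ^ (m * Suc 0) * B"
      using f by blast
    with assms show ?thesis
      by (simp add: P_def Q_def fps_X_power_mult_nth)
  qed
  hence "P \<noteq> 0" by auto
  with lim have "f has_prod P"
    by (simp add: has_prod_def raw_has_prod_def Q_def)
  moreover have "P \<in> Z_fps"
    using QZ by (auto simp: P_def Z_fps_def)
  ultimately show ?thesis
    unfolding f_def by blast
qed

lemma eta_coeff_Ints:
  assumes "p > 0"
  shows "eta_coeff r s p x \<in> \<int>"
proof -
  obtain P where P: "P \<in> Z_fps" "(\<lambda>n. (1 - fps_X ^ Suc n :: rat fps) powi r) has_prod P"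
    using eta_factor_has_prod[of 1 r, OF zero_less_one] unfolding mult_1 by blast
  obtain Q where Q: "Q \<in> Z_fps" "(\<lambda>n. (1 - fps_X ^ (p * Suc n) :: rat fps) powi s) has_prod Q"
    using eta_factor_has_prod[OF assms, of s] by blast
  have "eta_series r s p = P * Q"
    unfolding eta_series_def has_prod_unique[OF P(2)] has_prod_unique[OF Q(2)] ..
  hence "eta_series r s p \<in> Z_fps"
    using P(1) Q(1) by (simp add: Z_fps_mult)
  thus ?thesis
    by (auto simp: eta_coeff_def Z_fps_def)
qed

text \<open>
  The next two facts show that the division by 24 in \<open>\<Delta>\<close> is exact and that, for \<open>r\<close> and \<open>s\<close> of
  opposite parity, taking the floor leaves the exponents \<open>2 - 2\<epsilon>\<close> and \<open>1/2 - \<epsilon>\<close> unchanged.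
  The latter may be negative; as an exponent of \<open>-1\<close> it is replaced by its absolute value.
\<close>

lemma dvd_24_square_minus_one:
  assumes "prime (l :: nat)" "l > 3"
  shows "(24 :: int) dvd (int l)\<^sup>2 - 1"
proof -
  have "odd l" and l3: "\<not> 3 dvd l"
    using assms primes_dvd_imp_eq[of 2 l] primes_dvd_imp_eq[of 3 l] by auto
  then obtain t where t: "l = 2 * t + 1"
    by (elim oddE)
  have "(int l)\<^sup>2 - 1 = 4 * (int t * (int t + 1))"
    by (simp add: t power2_eq_square algebra_simps)
  moreover have "2 dvd int t * (int t + 1)"
    by auto
  ultimately have d8: "8 dvd (int l)\<^sup>2 - 1"
    using mult_dvd_mono[of 4 4 2 "int t * (int t + 1)"] by simp
  have d3: "3 dvd (int l)\<^sup>2 - 1"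
  proof -
    have "3 dvd int l - 1 \<or> 3 dvd int l + 1"
      using l3 by presburger
    moreover have "(int l)\<^sup>2 - 1 = (int l - 1) * (int l + 1)"
      by (simp add: power2_eq_square algebra_simps)
    ultimately show ?thesis by auto
  qed
  have "24 dvd x" if "8 dvd x" "3 dvd x" for x :: int
    using that by presburger
  with d8 d3 show ?thesis
    by blast
qed

lemma exponents_exact:
  assumes "odd (r + s)" and "\<epsilon> = (of_int (r + s) / 2 :: rat)"
  shows "of_int \<lfloor>2 - 2 * \<epsilon>\<rfloor> = 2 - 2 * \<epsilon>" "of_int \<lfloor>1/2 - \<epsilon>\<rfloor> = 1/2 - \<epsilon>"
proof -
  obtain t where t: "r + s = 2 * t + 1"
    using assms(1) by (elim oddE)
  have "2 - 2 * \<epsilon> = of_int (1 - 2 * t)" "1/2 - \<epsilon> = of_int (- t)"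
    unfolding assms(2) t by (simp_all add: field_simps)
  thus "of_int \<lfloor>2 - 2 * \<epsilon>\<rfloor> = 2 - 2 * \<epsilon>" "of_int \<lfloor>1/2 - \<epsilon>\<rfloor> = 1/2 - \<epsilon>"
    by (metis floor_of_int)+
qed

end

theory Submission
  imports Defs "HOL-Complex_Analysis.Complex_Analysis" "HOL-Probability.Characteristic_Functions"
begin

text \<open>
  Write \<open>f(z) = \<eta>(z)\<^sup>r \<eta>(pz)\<^sup>s\<close>, whose expansion is \<open>\<Sum> c(n) q\<^bsup>n + (r + ps)/24\<^esup>\<close>, and let \<open>T\<close> be the Hecke
  operator of index \<open>l\<^sup>2\<close>. The quotient \<open>G = (T f)/f\<close> is a sum over the projective line over \<open>\<int>/l\<^sup>2\<close> of
  translates of \<open>\<eta>(l\<^sup>2z)/\<eta>(z)\<close>, so it is a \<open>\<Gamma>\<^sub>0(p)\<close>-invariant function on the upper half-plane; it is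
  finite at \<open>\<infinity>\<close> because \<open>0 \<le> r + ps < 24\<close>. The Fricke involution \<open>z \<mapsto> - 1/(pz)\<close> turns \<open>G\<close> into
  the same quotient for \<open>(s, r)\<close>, whose coefficients are again \<open>p\<close>-integral. Since \<open>\<Gamma>\<^sub>0(p)\<close> has genus
  \<open>0\<close>, \<open>G\<close> is a polynomial in the Hauptmodul \<open>\<phi> = (\<eta>(pz)/\<eta>(z))\<^sup>k\<close>, which the involution maps to
  \<open>p\<^bsup>-k/2\<^esup> \<phi>\<^sup>-\<^sup>1\<close>. Comparing principal parts at the cusp \<open>0\<close> shows that the coefficient of \<open>\<phi>\<^sup>j\<close> is
  \<open>p\<^bsup>jk/2\<^esup>\<close> times a \<open>p\<close>-integral number, so \<open>T f\<close> is congruent to a constant multiple of \<open>f\<close>.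
\<close>

subsection \<open>Poisson summation for Gaussians\<close>

text \<open>The multiplier system of \<eta> on the whole modular group is never computed. Each
  translate of \<open>\<eta>(l^2 z) / \<eta>(z)\<close> has weight zero, so automorphy factors and
  roots of unity cancel up to signs and a Gauss sum, which end up in the middle term of the Hecke
  operator. Invariance of \<open>G\<close> is then a permutation of points. So is the Fricke
  involution, because \<open>p\<close> is a unit modulo \<open>l\<close>; it costs no power of
  \<open>p\<close>, and the whole modulus \<open>p^(k/2)\<close> comes from the Hauptmodul, each of
  whose \<open>k\<close> factors contributes a square root of \<open>p\<close>. The exponent
  \<open>k\<close> is chosen so that \<open>k (p - 1) / 24 = 1\<close>, that is, \<phi> has a simple
  zero at infinity; principal parts are therefore matched by a unitriangular system, without
  division by \<open>p\<close>. That a function finite at infinity and zero at the other cusp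
  vanishes is shown by multiplying it with its conjugates to a function of level one, to which the
  maximum principle applies. The constant in the congruence is exactly \<lambda>, since \<phi>
  vanishes at infinity and \<open>c(0) = 1\<close>.\<close>

lemma even_periodic_eq_0:
  fixes D :: "real \<Rightarrow> real"
  assumes cont: "continuous_on UNIV D"
    and per: "\<And>x. D (x + 1) = D x" and even: "\<And>x. D (- x) = D x"
    and coeff: "\<And>k::int. integral {0..1} (\<lambda>x. D x * cos (2 * pi * k * x)) = 0"
  shows "D x = 0"
proof -
  have cD [continuous_intros]: "continuous_on S D" for S
    using cont continuous_on_subset by blast
  have int: "f integrable_on {0..1}" if "continuous_on UNIV f" for f :: "real \<Rightarrow> real"
    using that continuous_on_subset by (intro integrable_continuous_real) blast
  \<comment> \<open>By the product formula for cosines, a power of \<open>cos (2 * pi * x)\<close>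
    times a cosine is a combination of cosines of integer frequency; so \<open>D\<close> is
    orthogonal to every polynomial in \<open>cos (2 * pi * x)\<close>.\<close>
  have mono: "integral {0..1} (\<lambda>x. D x * (cos (2 * pi * x) ^ i * cos (2 * pi * k * x))) = 0"
    for i and k :: int
  proof (induction i arbitrary: k)
    case 0
    then show ?case using coeff[of k] by simp
  next
    case (Suc i)
    have eq: "cos (2 * pi * x) * cos (2 * pi * k * x) =
        (cos (2 * pi * real_of_int (k + 1) * x) + cos (2 * pi * real_of_int (k - 1) * x)) / 2" for x
      using cos_times_cos[of "2 * pi * k * x" "2 * pi * x"]
      by (simp add: algebra_simps)
    have eq2: "D x * (cos (2 * pi * x) ^ Suc i * cos (2 * pi * k * x)) =
       (D x * (cos (2 * pi * x) ^ i * cos (2 * pi * real_of_int (k + 1) * x))) / 2 +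
       (D x * (cos (2 * pi * x) ^ i * cos (2 * pi * real_of_int (k - 1) * x))) / 2" for x
    proof -
      have "D x * (cos (2 * pi * x) ^ Suc i * cos (2 * pi * k * x)) =
         D x * (cos (2 * pi * x) ^ i * (cos (2 * pi * x) * cos (2 * pi * k * x)))"
        by simp
      also note eq
      finally show ?thesis by (simp add: field_simps)
    qed
    have I: "(\<lambda>x. D x * (cos (2 * pi * x) ^ i * cos (2 * pi * real_of_int m * x)) / 2) integrable_on {0..1}" for m
      by (intro int continuous_intros) auto
    show ?case
      unfolding eq2
      by (subst Henstock_Kurzweil_Integration.integral_add[OF I I])
         (simp add: Suc.IH del: of_int_add of_int_diff)
  qed
  have poly0: "integral {0..1} (\<lambda>x. D x * P (cos (2 * pi * x))) = 0"
    if "real_polynomial_function P" for P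
  proof -
    from that obtain a n where P: "P = (\<lambda>x. \<Sum>i\<le>n. a i * x ^ i)"
      unfolding real_polynomial_function_iff_sum by blast
    have "integral {0..1} (\<lambda>x. D x * P (cos (2 * pi * x))) =
        integral {0..1} (\<lambda>x. \<Sum>i\<le>n. a i * (D x * cos (2 * pi * x) ^ i))"
      unfolding P by (simp add: sum_distrib_left algebra_simps)
    also have "\<dots> = (\<Sum>i\<le>n. integral {0..1} (\<lambda>x. a i * (D x * cos (2 * pi * x) ^ i)))"
      by (intro integral_sum int continuous_intros) auto
    also have "\<dots> = 0"
      using mono[of _ 0] by simp
    finally show ?thesis .
  qed
  \<comment> \<open>On a period, an even function of period 1 is a continuous function
    \<open>d\<close> of \<open>u = cos (2 * pi * x)\<close>. This reduces the density of
    trigonometric polynomials to Weierstrass approximation on [-1, 1].\<close>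
  define d where "d = (\<lambda>u. D (arccos u / (2 * pi)))"
  have dcont: "continuous_on {-1..1} d"
    unfolding d_def
    by (rule continuous_on_compose2[OF cont]) (auto intro!: continuous_intros)
  have half: "D x = d (cos (2 * pi * x))" if "0 \<le> x" "x \<le> 1/2" for x
  proof -
    have "2 * pi * x \<le> pi" using that by (simp add: field_simps)
    then show ?thesis using that by (simp add: d_def arccos_cos)
  qed
  have dD: "D x = d (cos (2 * pi * x))" if "x \<in> {0..1}" for x
  proof (cases "x \<le> 1/2")
    case False
    have "D x = D (1 - x)"
      using per[of "-x"] even[of x] by (simp add: add.commute)
    also have "\<dots> = d (cos (2 * pi * (1 - x)))"
      using that False by (intro half) auto
    also have "cos (2 * pi * (1 - x)) = cos (2 * pi * x)"
      using cos_periodic[of "- 2 * pi * x"] by (simp add: algebra_simps)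
    finally show ?thesis .
  qed (use half that in auto)
  \<comment> \<open>With \<open>P\<close> within \<open>e\<close> of \<open>d\<close>, orthogonality
    lets one factor \<open>D\<close> of the square be replaced by \<open>D - P\<close>, which is
    smaller than \<open>e\<close>.\<close>
  have sq: "integral {0..1} (\<lambda>x. D x * D x) \<le> e * integral {0..1} (\<lambda>x. \<bar>D x\<bar>)" if "e > 0" for e
  proof -
    obtain P where P: "real_polynomial_function P" "\<And>u. u \<in> {-1..1} \<Longrightarrow> \<bar>d u - P u\<bar> < e"
      using Stone_Weierstrass_real_polynomial_function[OF _ dcont \<open>e > 0\<close>] by auto
    have cP: "continuous_on UNIV (\<lambda>x. P (cos (2 * pi * x)))"
      by (rule continuous_on_compose2[OF continuous_on_polymonial_function])
         (use P(1) in \<open>auto intro!: continuous_intros simp: real_polynomial_function_eq\<close>)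
    have "integral {0..1} (\<lambda>x. D x * D x) =
        integral {0..1} (\<lambda>x. D x * D x) - integral {0..1} (\<lambda>x. D x * P (cos (2 * pi * x)))"
      using poly0[OF P(1)] by simp
    also have "\<dots> = integral {0..1} (\<lambda>x. D x * D x - D x * P (cos (2 * pi * x)))"
      by (intro Henstock_Kurzweil_Integration.integral_diff[symmetric] int continuous_intros cP) 
    also have "\<dots> \<le> integral {0..1} (\<lambda>x. e * \<bar>D x\<bar>)"
    proof (intro integral_le int continuous_intros cP)
      fix x :: real assume x: "x \<in> {0..1}"
      have "D x * D x - D x * P (cos (2 * pi * x)) = D x * (d (cos (2 * pi * x)) - P (cos (2 * pi * x)))"
        using dD[OF x] by (simp add: algebra_simps)
      also have "\<dots> \<le> \<bar>D x\<bar> * \<bar>d (cos (2 * pi * x)) - P (cos (2 * pi * x))\<bar>"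
        by (metis abs_ge_self abs_mult)
      also have "\<dots> \<le> \<bar>D x\<bar> * e"
        using P(2)[of "cos (2 * pi * x)"] by (intro mult_left_mono) auto
      finally show "D x * D x - D x * P (cos (2 * pi * x)) \<le> e * \<bar>D x\<bar>"
        by (simp add: mult.commute)
    qed
    finally show ?thesis by simp
  qed
  have "integral {0..1} (\<lambda>x. D x * D x) \<le> 0"
  proof (rule field_le_epsilon)
    fix e :: real assume e: "e > 0"
    define J where "J = integral {0..1} (\<lambda>x. \<bar>D x\<bar>)"
    have "J \<ge> 0" unfolding J_def
      by (intro integral_nonneg int continuous_intros) auto
    have "integral {0..1} (\<lambda>x. D x * D x) \<le> e / (J + 1) * J"
      using sq[of "e / (J + 1)"] e \<open>J \<ge> 0\<close> by (simp add: J_def)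
    also have "\<dots> \<le> e" using e \<open>J \<ge> 0\<close> by (simp add: field_simps)
    finally show "integral {0..1} (\<lambda>x. D x * D x) \<le> 0 + e" by simp
  qed
  moreover have "integral {0..1} (\<lambda>x. D x * D x) \<ge> 0"
    by (intro integral_nonneg int continuous_intros) auto
  ultimately have "integral {0..1} (\<lambda>x. D x * D x) = 0" by simp
  moreover have "continuous_on {0..1} (\<lambda>x. D x * D x)"
    by (intro continuous_intros)
  ultimately have "\<forall>x\<in>{0..1}. D x * D x = 0"
    by (subst (asm) integral_eq_0_iff) auto
  then have D0: "D x = 0" if "x \<in> {0..1}" for x
    using that by simp
  have pn: "D (y + real n) = D y" for y n
  proof (induction n)
    case (Suc n)
    then show ?case using per[of "y + real n"] by (simp add: add_ac)
  qed simp
  have pz: "D (y + of_int m) = D y" for y and m :: int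
  proof (cases "m \<ge> 0")
    case True
    then show ?thesis using pn[of y "nat m"] by simp
  next
    case False
    then show ?thesis using pn[of "y + of_int m" "nat (- m)"] by simp
  qed
  have "D (frac x) = D x"
    using pz[of "frac x" "\<lfloor>x\<rfloor>"] by (simp add: frac_def)
  moreover have "frac x \<in> {0..1}"
    using frac_lt_1[of x] by (simp add: less_imp_le)
  ultimately show ?thesis using D0 by metis
qed

text \<open>The Fourier transform of the Gaussian is read off from the characteristic function of
  the standard normal distribution, after rescaling the variable by
  \<open>c = sqrt (2 * pi * t)\<close>.\<close>

lemma integral_gauss_cos:
  fixes t k :: real
  assumes "t > 0"
  shows "integrable lborel (\<lambda>x. exp (- pi * t * x\<^sup>2) * cos (2 * pi * k * x))"
    and "(LINT x|lborel. exp (- pi * t * x\<^sup>2) * cos (2 * pi * k * x)) = exp (- pi * k\<^sup>2 / t) / sqrt t"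
proof -
  have int1: "integrable lborel (\<lambda>x. std_normal_density x * cos (u * x))" for u
    by (rule Bochner_Integration.integrable_bound[OF integrable_normal_density[of 1 0]])
       (auto simp: abs_mult mult_le_cancel_left2 normal_density_nonneg not_less[THEN iffD2])
  have val1: "(LINT x|lborel. std_normal_density x * cos (u * x)) = exp (- (u\<^sup>2) / 2)" for u
  proof -
    have "Re (char std_normal_distribution u) = exp (- (u\<^sup>2) / 2)"
      by (simp add: char_std_normal_distribution)
    also have "char std_normal_distribution u = (CLINT x|lborel. std_normal_density x *\<^sub>R cis (u * x))"
      unfolding char_def by (subst integral_density) (auto simp: normal_density_nonneg cis_conv_exp mult.commute)
    also have "Re \<dots> = (LINT x|lborel. Re (std_normal_density x *\<^sub>R cis (u * x)))"
    proof (rule integral_Re[symmetric])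
      show "complex_integrable lborel (\<lambda>x. std_normal_density x *\<^sub>R cis (u * x))"
        by (rule Bochner_Integration.integrable_bound[OF integrable_normal_density[of 1 0]])
           (auto simp: measurable_If cis_conv_exp)
    qed
    finally show ?thesis by simp
  qed
  define c where "c = sqrt (2 * pi * t)"
  have c: "c > 0" "c\<^sup>2 = 2 * pi * t" using assms by (simp_all add: c_def)
  have c2: "c = sqrt (2 * pi) * sqrt t" by (simp add: c_def real_sqrt_mult)
  have eq: "exp (- pi * t * x\<^sup>2) * cos (2 * pi * k * x) =
     sqrt (2 * pi) * (std_normal_density (0 + c * x) * cos ((2 * pi * k / c) * (0 + c * x)))" for x
  proof -
    have "(c * x)\<^sup>2 / 2 = pi * t * x\<^sup>2"
      by (simp add: power_mult_distrib c(2))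
    then show ?thesis
      using c by (simp add: std_normal_density_def real_sqrt_mult mult.assoc)
  qed
  show "integrable lborel (\<lambda>x. exp (- pi * t * x\<^sup>2) * cos (2 * pi * k * x))"
    unfolding eq using c by (intro integrable_mult_right lborel_integrable_real_affine int1) auto
  have "(LINT x|lborel. std_normal_density x * cos ((2 * pi * k / c) * x)) =
      c * (LINT x|lborel. std_normal_density (0 + c * x) * cos ((2 * pi * k / c) * (0 + c * x)))"
    by (subst lborel_integral_real_affine[of c _ 0]) (use c in auto)
  then have "(LINT x|lborel. std_normal_density (0 + c * x) * cos ((2 * pi * k / c) * (0 + c * x)))
       = exp (- ((2 * pi * k / c)\<^sup>2) / 2) / c"
    using c unfolding val1 by (simp add: field_simps)
  then have "(LINT x|lborel. exp (- pi * t * x\<^sup>2) * cos (2 * pi * k * x)) =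
      sqrt (2 * pi) * (exp (- ((2 * pi * k / c)\<^sup>2) / 2) / c)"
    unfolding eq by simp
  also have "(2 * pi * k / c)\<^sup>2 / 2 = pi * k\<^sup>2 / t"
    using assms unfolding power_divide c(2) by (simp add: power2_eq_square)
  then have "- ((2 * pi * k / c)\<^sup>2) / 2 = - pi * k\<^sup>2 / t" by simp
  finally show "(LINT x|lborel. exp (- pi * t * x\<^sup>2) * cos (2 * pi * k * x)) = exp (- pi * k\<^sup>2 / t) / sqrt t"
    by (simp add: c2)
qed

lemma summable_on_int_power:
  fixes r :: real
  assumes "0 \<le> r" "r < 1"
  shows "(\<lambda>n::int. r ^ nat \<bar>n\<bar>) summable_on UNIV"
proof -
  have s: "(\<lambda>n::nat. r ^ n) summable_on UNIV"
    using assms by (intro norm_summable_imp_summable_on) (simp add: norm_power)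
  have 1: "(\<lambda>n::int. r ^ nat \<bar>n\<bar>) summable_on {0..}"
    using s by (subst summable_on_reindex_bij_witness[of _ int nat UNIV "\<lambda>n. r ^ n"]) auto
  have 2: "(\<lambda>n::int. r ^ nat \<bar>n\<bar>) summable_on {..<0}"
    using summable_on_subset_banach[OF s, of "{1..}"]
    by (subst summable_on_reindex_bij_witness[of _ "\<lambda>n. - int n" "\<lambda>n. nat (- n)" "{1..}" "\<lambda>n. r ^ n"]) auto
  have "{0..} \<union> {..<0::int} = UNIV" "{0..} \<inter> {..<0::int} = {}" by auto
  with summable_on_Un_disjoint[OF 1 2] show ?thesis by simp
qed

lemma summable_on_int_gauss:
  fixes c :: real
  assumes "c > 0"
  shows "(\<lambda>n::int. exp (- c * (real_of_int n)\<^sup>2)) summable_on UNIV"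
proof (rule summable_on_comparison_test[OF summable_on_int_power[of "exp (- c)"]])
  fix n :: int
  have "exp (- c * (real_of_int n)\<^sup>2) \<le> exp (- c * \<bar>real_of_int n\<bar>)"
  proof -
    have "\<bar>n\<bar> \<le> n\<^sup>2"
    proof (cases "n = 0")
      case False
      then have "\<bar>n\<bar> * 1 \<le> \<bar>n\<bar> * \<bar>n\<bar>" by (intro mult_left_mono) auto
      then show ?thesis by (simp add: power2_eq_square)
    qed auto
    then have "\<bar>real_of_int n\<bar> \<le> (real_of_int n)\<^sup>2"
      by (metis of_int_abs of_int_le_iff of_int_power)
    then show ?thesis using assms by simp
  qed
  also have "\<dots> = exp (- c) ^ nat \<bar>n\<bar>"
    by (simp add: exp_of_nat_mult[symmetric] mult.commute)
  finally show "exp (- c * (real_of_int n)\<^sup>2) \<le> exp (- c) ^ nat \<bar>n\<bar>" .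
qed (use assms in auto)

text \<open>Expanding \<open>(n + 2 * x)^2 \<ge> 0\<close> gives
  \<open>(n + x)^2 + x^2 \<ge> n^2 / 2\<close>. This yields a summable majorant for shifted
  Gaussians that is uniform for bounded shifts.\<close>

lemma gauss_shift_le:
  fixes c x B :: real
  assumes "c > 0" "\<bar>x\<bar> \<le> B"
  shows "exp (- c * (of_int n + x)\<^sup>2) \<le> exp (c * B\<^sup>2) * exp (- (c / 2) * (of_int n)\<^sup>2)"
proof -
  have "x\<^sup>2 \<le> B\<^sup>2" using assms(2) by (metis abs_ge_zero abs_of_nonneg order.trans power2_abs power_mono)
  moreover have "(of_int n)\<^sup>2 / 2 \<le> (of_int n + x)\<^sup>2 + x\<^sup>2"
  proof -
    have "0 \<le> (of_int n + 2 * x)\<^sup>2" by simp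
    then show ?thesis by (simp add: power2_eq_square algebra_simps)
  qed
  ultimately have "(of_int n)\<^sup>2 / 2 - B\<^sup>2 \<le> (of_int n + x)\<^sup>2" by linarith
  then have "c * ((of_int n)\<^sup>2 / 2 - B\<^sup>2) \<le> c * (of_int n + x)\<^sup>2"
    using assms(1) by simp
  then have "- c * (of_int n + x)\<^sup>2 \<le> c * B\<^sup>2 + (- (c / 2) * (of_int n)\<^sup>2)"
    by (simp add: algebra_simps)
  then show ?thesis by (simp flip: exp_add)
qed

text \<open>The majorant may depend on the bound \<open>B\<close> of the argument: the one for
  shifted Gaussians grows with the shift, and continuity is local.\<close>

lemma continuous_on_infsum_bounded:
  fixes f :: "'i \<Rightarrow> real \<Rightarrow> real"
  assumes "\<And>B. (M B) summable_on UNIV"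
    and "\<And>B n x. \<bar>x\<bar> \<le> B \<Longrightarrow> \<bar>f n x\<bar> \<le> M B n"
    and "\<And>n. continuous_on UNIV (f n)"
  shows "continuous_on UNIV (\<lambda>x. \<Sum>\<^sub>\<infinity>n. f n x)"
proof -
  have *: "continuous_on {-B<..<B} (\<lambda>x. \<Sum>\<^sub>\<infinity>n. f n x)" for B
  proof (rule uniform_limit_theorem)
    show "uniform_limit {-B<..<B} (\<lambda>X y. \<Sum>x\<in>X. f x y) (\<lambda>x. \<Sum>\<^sub>\<infinity>n. f n x) (finite_subsets_at_top UNIV)"
      by (rule Weierstrass_m_test_general[of _ _ _ "M B"]) (use assms in auto)
    show "\<forall>\<^sub>F X in finite_subsets_at_top UNIV. continuous_on {-B<..<B} (\<lambda>y. \<Sum>x\<in>X. f x y)"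
      by (intro always_eventually allI continuous_on_sum continuous_on_subset[OF assms(3)]) auto
  qed (auto)
  have "continuous (at x) (\<lambda>x. \<Sum>\<^sub>\<infinity>n. f n x)" for x
    using *[of "\<bar>x\<bar> + 1"] by (subst (asm) continuous_on_eq_continuous_at) (auto dest!: bspec[of _ _ x])
  then show ?thesis by (simp add: continuous_at_imp_continuous_on)
qed

lemma has_sum_integral_Icc:
  fixes f :: "'i \<Rightarrow> real \<Rightarrow> real"
  assumes "M summable_on UNIV"
    and "\<And>n x. x \<in> {a..b} \<Longrightarrow> \<bar>f n x\<bar> \<le> M n"
    and cont: "\<And>n. continuous_on {a..b} (f n)"
  shows "((\<lambda>n. integral {a..b} (f n)) has_sum integral {a..b} (\<lambda>x. \<Sum>\<^sub>\<infinity>n. f n x)) UNIV"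
proof -
  have "uniform_limit {a..b} (\<lambda>X y. \<Sum>n\<in>X. f n y) (\<lambda>x. \<Sum>\<^sub>\<infinity>n. f n x) (finite_subsets_at_top UNIV)"
    by (rule Weierstrass_m_test_general[of _ _ _ M]) (use assms in auto)
  then obtain I J where I: "\<And>X. ((\<lambda>y. \<Sum>n\<in>X. f n y) has_integral I X) {a..b}"
    and J: "((\<lambda>x. \<Sum>\<^sub>\<infinity>n. f n x) has_integral J) {a..b}"
    and lim: "(I \<longlongrightarrow> J) (finite_subsets_at_top UNIV)"
    by (rule uniform_limit_integral) (auto intro!: continuous_intros cont)
  have "\<forall>\<^sub>F X in finite_subsets_at_top UNIV. I X = (\<Sum>n\<in>X. integral {a..b} (f n))"
  proof (rule eventually_finite_subsets_at_top_weakI)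
    fix X :: "'i set" assume "finite X"
    then have "((\<lambda>y. \<Sum>n\<in>X. f n y) has_integral (\<Sum>n\<in>X. integral {a..b} (f n))) {a..b}"
      by (intro has_integral_sum) (auto intro!: integrable_integral integrable_continuous_real cont)
    then show "I X = (\<Sum>n\<in>X. integral {a..b} (f n))"
      using I has_integral_unique by blast
  qed
  then show ?thesis
    using lim J unfolding has_sum_def by (auto intro: Lim_transform_eventually simp: integral_unique)
qed

lemma integral_cos_2pi_int: "integral {0..1} (\<lambda>x. cos (2 * pi * of_int j * x)) = (if j = 0 then 1 else 0)"
proof (cases "j = 0")
  case False
  have "((\<lambda>x. cos (2 * pi * of_int j * x)) has_integral
      (sin (2 * pi * of_int j * 1) / (2 * pi * of_int j) - sin (2 * pi * of_int j * 0) / (2 * pi * of_int j))) {0..1}"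
    by (rule fundamental_theorem_of_calculus)
       (use False in \<open>auto intro!: derivative_eq_intros simp flip: has_real_derivative_iff_has_vector_derivative\<close>)
  then show ?thesis using False sin_int_2pin[of j] by (auto dest!: integral_unique)
qed auto

lemma integral_cos_cos_2pi:
  "integral {0..1} (\<lambda>x. cos (2 * pi * of_int m * x) * cos (2 * pi * of_int k * x)) =
    ((if m = k then 1 else 0) + (if m = - k then 1 else 0)) / 2"
proof -
  have eq: "cos (2 * pi * of_int m * x) * cos (2 * pi * of_int k * x) =
     cos (2 * pi * real_of_int (m - k) * x) / 2 + cos (2 * pi * real_of_int (m + k) * x) / 2" for x
    using cos_times_cos[of "2 * pi * m * x" "2 * pi * k * x"] by (simp add: algebra_simps add_divide_distrib)
  have I: "(\<lambda>x. cos (2 * pi * real_of_int j * x) / 2) integrable_on {0..1}" for j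
    by (intro integrable_continuous_real continuous_intros) auto
  show ?thesis
    unfolding eq
    by (subst Henstock_Kurzweil_Integration.integral_add[OF I I])
       (auto simp: integral_cos_2pi_int simp del: of_int_add of_int_diff)
qed

lemma has_sum_int_imp_LIMSEQ:
  fixes f :: "int \<Rightarrow> 'a :: {comm_monoid_add, topological_space}"
  assumes "(f has_sum S) UNIV"
  shows "(\<lambda>M. \<Sum>n\<in>{- int M..<int M}. f n) \<longlonglongrightarrow> S"
proof -
  have "filterlim (\<lambda>M. {- int M..<int M}) (finite_subsets_at_top UNIV) sequentially"
  proof (subst filterlim_finite_subsets_at_top, intro allI impI)
    fix X :: "int set" assume X: "finite X \<and> X \<subseteq> UNIV"
    define B where "B = (\<Sum>x\<in>X. \<bar>x\<bar>)"
    have B: "\<forall>x\<in>X. \<bar>x\<bar> \<le> B"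
      using X by (auto simp: B_def intro: member_le_sum)
    show "\<forall>\<^sub>F y in sequentially. finite {- int y..<int y} \<and> X \<subseteq> {- int y..<int y} \<and> {- int y..<int y} \<subseteq> UNIV"
      using eventually_gt_at_top[of "nat B"]
      by eventually_elim (use B in fastforce)
  qed
  then show ?thesis
    using assms unfolding has_sum_def by (rule filterlim_compose[rotated])
qed

lemma integral_gauss_cos_Icc_LIMSEQ:
  fixes t k :: real
  assumes "t > 0"
  defines "g \<equiv> \<lambda>x. exp (- pi * t * x\<^sup>2) * cos (2 * pi * k * x)"
  shows "(\<lambda>M. integral {- real M..real M} g) \<longlonglongrightarrow> exp (- pi * k\<^sup>2 / t) / sqrt t"
proof -
  define I where "I = exp (- pi * k\<^sup>2 / t) / sqrt t"
  have "(g has_integral I) UNIV"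
    using has_integral_integral_lborel[of g] integral_gauss_cos[OF assms(1), of k]
    by (simp add: g_def I_def)
  then have *: "\<exists>B>0. \<forall>a b. ball 0 B \<subseteq> cbox a b \<longrightarrow> norm (integral (cbox a b) g - I) < e" if "e > 0" for e
    unfolding has_integral_alt'[of g I UNIV] using that by simp
  show ?thesis
    unfolding I_def[symmetric]
  proof (rule LIMSEQ_I)
    fix e :: real assume "e > 0"
    then obtain B where B: "\<forall>a b. ball 0 B \<subseteq> cbox a b \<longrightarrow> norm (integral (cbox a b) g - I) < e"
      using * by blast
    have "norm (integral {- real M..real M} g - I) < e" if "M \<ge> nat \<lceil>B\<rceil>" for M
    proof -
      have "B \<le> real M" using that by linarith
      then have "ball 0 B \<subseteq> cbox (- real M) (real M)" by (auto simp: dist_real_def)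
      then show ?thesis using B by (metis cbox_interval)
    qed
    then show "\<exists>N. \<forall>M\<ge>N. norm (integral {- real M..real M} g - I) < e" by blast
  qed
qed

text \<open>As functions of \<open>x\<close> both sides are continuous, even and of period 1, so it
  is enough to compare their cosine coefficients. On the left, the integral over a period unfolds to
  an integral over the whole line, which is the Fourier transform of the Gaussian.\<close>

theorem poisson_gauss:
  fixes t x :: real
  assumes t: "t > 0"
  shows "(\<Sum>\<^sub>\<infinity>n::int. exp (- pi * t * (of_int n + x)\<^sup>2)) =
     (\<Sum>\<^sub>\<infinity>m::int. exp (- pi * (of_int m)\<^sup>2 / t) * cos (2 * pi * of_int m * x)) / sqrt t"
proof -
  define f where "f = (\<lambda>(n::int) x. exp (- pi * t * (of_int n + x)\<^sup>2))"
  define h where "h = (\<lambda>(m::int) x. exp (- pi * (of_int m)\<^sup>2 / t) * cos (2 * pi * of_int m * x))"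
  define M where "M = (\<lambda>B (n::int). exp (pi * t * B\<^sup>2) * exp (- (pi * t / 2) * (of_int n)\<^sup>2))"
  define Mh where "Mh = (\<lambda>(m::int). exp (- pi * (of_int m)\<^sup>2 / t))"
  have Msum: "M B summable_on UNIV" for B
    unfolding M_def using t by (intro summable_on_cmult_right summable_on_int_gauss) auto
  have Mhsum: "Mh summable_on UNIV"
    using summable_on_int_gauss[of "pi / t"] t by (simp add: Mh_def)
  have fM: "\<bar>f n x\<bar> \<le> M B n" if "\<bar>x\<bar> \<le> B" for n x B
    using gauss_shift_le[of "pi * t" x B n] t that by (simp add: f_def M_def)
  have hM: "\<bar>h n x\<bar> \<le> Mh n" for n x
    by (simp add: h_def Mh_def abs_mult mult_le_cancel_left2)
  have cf: "continuous_on S (f n)" and ch: "continuous_on S (h n)" for S n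
    unfolding f_def h_def using t by (intro continuous_intros; simp)+
  define E where "E = (\<lambda>x. \<Sum>\<^sub>\<infinity>n. f n x)"
  define R where "R = (\<lambda>x. \<Sum>\<^sub>\<infinity>n. h n x)"
  have cE: "continuous_on UNIV E" unfolding E_def
    by (rule continuous_on_infsum_bounded[OF Msum fM cf])
  have cR: "continuous_on UNIV R" unfolding R_def
    by (rule continuous_on_infsum_bounded[of "\<lambda>_. Mh", OF Mhsum hM ch])
  have perE: "E (y + 1) = E y" for y
    unfolding E_def
    by (rule infsum_reindex_bij_witness[of _ "\<lambda>n. n - 1" "\<lambda>n. n + 1"]) (auto simp: f_def algebra_simps)
  have evenE: "E (- y) = E y" for y
    unfolding E_def
    by (rule infsum_reindex_bij_witness[of _ "\<lambda>n. - n" "\<lambda>n. - n"]) 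
       (auto simp: f_def power2_eq_square algebra_simps)
  have perR: "R (y + 1) = R y" for y
  proof -
    have "cos (2 * pi * of_int m * (y + 1)) = cos (2 * pi * of_int m * y)" for m :: int
      using sin_int_2pin[of m] cos_int_2pin[of m] by (simp add: ring_distribs cos_add mult.assoc)
    then show ?thesis by (simp add: R_def h_def)
  qed
  have evenR: "R (- y) = R y" for y
    by (simp add: R_def h_def)
  have coeffE: "integral {0..1} (\<lambda>x. E x * cos (2 * pi * of_int k * x)) = exp (- pi * (of_int k)\<^sup>2 / t) / sqrt t" for k :: int
  proof -
    define g where "g = (\<lambda>x. exp (- pi * t * x\<^sup>2) * cos (2 * pi * of_int k * x))"
    have cg: "continuous_on S g" for S unfolding g_def by (intro continuous_intros)
    have "((\<lambda>n. integral {0..1} (\<lambda>x. f n x * cos (2 * pi * of_int k * x))) has_sum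
       integral {0..1} (\<lambda>x. \<Sum>\<^sub>\<infinity>n. f n x * cos (2 * pi * of_int k * x))) UNIV"
    proof (rule has_sum_integral_Icc[OF Msum[of 1]])
      fix n x assume x: "x \<in> {0..1::real}"
      have "\<bar>f n x * cos (2 * pi * of_int k * x)\<bar> \<le> \<bar>f n x\<bar>"
        by (simp add: abs_mult mult_le_cancel_left2)
      also have "\<dots> \<le> M 1 n" using x by (intro fM) auto
      finally show "\<bar>f n x * cos (2 * pi * of_int k * x)\<bar> \<le> M 1 n" .
    qed (intro continuous_intros cf)
    also have "(\<lambda>x. \<Sum>\<^sub>\<infinity>n. f n x * cos (2 * pi * of_int k * x)) = (\<lambda>x. E x * cos (2 * pi * of_int k * x))"
    proof
      fix x
      have "(\<lambda>n. f n x) summable_on UNIV"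
        by (rule abs_summable_summable, rule summable_on_comparison_test[OF Msum[of "\<bar>x\<bar>"]]) (use fM in auto)
      then show "(\<Sum>\<^sub>\<infinity>n. f n x * cos (2 * pi * of_int k * x)) = E x * cos (2 * pi * of_int k * x)"
        unfolding E_def by (intro infsum_cmult_left)
    qed
    also have "(\<lambda>n. integral {0..1} (\<lambda>x. f n x * cos (2 * pi * of_int k * x))) = (\<lambda>n. integral {of_int n..of_int n + 1} g)"
    proof
      fix n :: int
      have "cos (2 * pi * of_int k * (of_int n + x)) = cos (2 * pi * of_int k * x)" for x
        using sin_int_2pin[of "k * n"] cos_int_2pin[of "k * n"]
        by (simp add: ring_distribs cos_add mult.assoc)
      then have "(\<lambda>x. f n x * cos (2 * pi * of_int k * x)) = g \<circ> ((+) (of_int n))"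
        by (auto simp: f_def g_def)
      then show "integral {0..1} (\<lambda>x. f n x * cos (2 * pi * of_int k * x)) = integral {of_int n..of_int n + 1} g"
        by (simp add: integral_shift_Icc_real add.commute)
    qed
    finally have "(\<lambda>N. \<Sum>n\<in>{- int N..<int N}. integral {of_int n..of_int n + 1} g)
        \<longlonglongrightarrow> integral {0..1} (\<lambda>x. E x * cos (2 * pi * of_int k * x))"
      by (rule has_sum_int_imp_LIMSEQ)
    \<comment> \<open>The half-open range of \<open>n\<close> makes the unit intervals tile
      \<open>{- real N..real N}\<close> exactly.\<close>
    moreover have "(\<Sum>n\<in>{- int N..<int N}. integral {of_int n..of_int n + 1} g) = integral {- real N..real N} g" for N
    proof (induction N)
      case (Suc N)
      have "{- int (Suc N)..<int (Suc N)} = insert (- int N - 1) (insert (int N) {- int N..<int N})"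
        by auto
      then have "(\<Sum>n\<in>{- int (Suc N)..<int (Suc N)}. integral {of_int n..of_int n + 1} g) =
         integral {- real N - 1..- real N} g + (integral {real N..real N + 1} g + integral {- real N..real N} g)"
        using Suc by simp
      also have "- real N - 1 = - 1 - real N" by simp
      also have "integral {- 1 - real N..- real N} g + (integral {real N..real N + 1} g + integral {- real N..real N} g) 
          = integral {- real (Suc N)..real (Suc N)} g"
        using Henstock_Kurzweil_Integration.integral_combine[where f = g and a = "- real N" and c = "real N" and b = "real N + 1"]
          Henstock_Kurzweil_Integration.integral_combine[where f = g and a = "- 1 - real N" and c = "- real N" and b = "real N + 1"]
        by (simp add: integrable_continuous_real cg algebra_simps)
      finally show ?case .
    qed auto
    ultimately have "(\<lambda>N. integral {- real N..real N} g) \<longlonglongrightarrow> integral {0..1} (\<lambda>x. E x * cos (2 * pi * of_int k * x))"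
      by simp
    then show ?thesis
      using integral_gauss_cos_Icc_LIMSEQ[OF t, of "of_int k", folded g_def] by (rule LIMSEQ_unique)
  qed
  have coeffR: "integral {0..1} (\<lambda>x. R x * cos (2 * pi * of_int k * x)) = exp (- pi * (of_int k)\<^sup>2 / t)" for k :: int
  proof -
    have "((\<lambda>n. integral {0..1} (\<lambda>x. h n x * cos (2 * pi * of_int k * x))) has_sum
       integral {0..1} (\<lambda>x. \<Sum>\<^sub>\<infinity>n. h n x * cos (2 * pi * of_int k * x))) UNIV"
    proof (rule has_sum_integral_Icc[OF Mhsum])
      fix n x
      have "\<bar>h n x * cos (2 * pi * of_int k * x)\<bar> \<le> \<bar>h n x\<bar>"
        by (simp add: abs_mult mult_le_cancel_left2)
      also have "\<dots> \<le> Mh n" by (rule hM)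
      finally show "\<bar>h n x * cos (2 * pi * of_int k * x)\<bar> \<le> Mh n" .
    qed (intro continuous_intros ch)
    also have "(\<lambda>x. \<Sum>\<^sub>\<infinity>n. h n x * cos (2 * pi * of_int k * x)) = (\<lambda>x. R x * cos (2 * pi * of_int k * x))"
    proof
      fix x
      have "(\<lambda>n. h n x) summable_on UNIV"
        by (rule abs_summable_summable, rule summable_on_comparison_test[OF Mhsum]) (use hM in auto)
      then show "(\<Sum>\<^sub>\<infinity>n. h n x * cos (2 * pi * of_int k * x)) = R x * cos (2 * pi * of_int k * x)"
        unfolding R_def by (intro infsum_cmult_left)
    qed
    also have "(\<lambda>n. integral {0..1} (\<lambda>x. h n x * cos (2 * pi * of_int k * x))) =
        (\<lambda>n. Mh n * (((if n = k then 1 else 0) + (if n = - k then 1 else 0)) / 2))"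
      unfolding h_def Mh_def by (simp only: mult.assoc integral_mult_right integral_cos_cos_2pi[unfolded mult.assoc])
    finally have 1: "((\<lambda>n. Mh n * (((if n = k then 1 else 0) + (if n = - k then 1 else 0)) / 2)) has_sum
        integral {0..1} (\<lambda>x. R x * cos (2 * pi * of_int k * x))) UNIV" .
    have "((\<lambda>n. Mh n * (((if n = k then 1 else 0) + (if n = - k then 1 else 0)) / 2)) has_sum Mh k) UNIV"
      by (rule has_sum_finite_neutralI[of "{k, -k}"]) (cases "k = 0"; auto simp: Mh_def)+
    with 1 have "integral {0..1} (\<lambda>x. R x * cos (2 * pi * of_int k * x)) = Mh k"
      using has_sum_unique by blast
    then show ?thesis by (simp add: Mh_def)
  qed
  have "E x - R x / sqrt t = 0"
  proof (rule even_periodic_eq_0[of "\<lambda>x. E x - R x / sqrt t"])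
    fix k :: int
    have "integral {0..1} (\<lambda>x. (E x - R x / sqrt t) * cos (2 * pi * of_int k * x)) =
      integral {0..1} (\<lambda>x. E x * cos (2 * pi * of_int k * x) - R x * cos (2 * pi * of_int k * x) / sqrt t)"
      by (simp add: algebra_simps)
    also have "\<dots> = integral {0..1} (\<lambda>x. E x * cos (2 * pi * of_int k * x)) -
        integral {0..1} (\<lambda>x. R x * cos (2 * pi * of_int k * x) / sqrt t)"
      using t by (intro Henstock_Kurzweil_Integration.integral_diff integrable_continuous_real continuous_intros
        continuous_on_subset[OF cE] continuous_on_subset[OF cR]) auto
    also have "\<dots> = 0" by (simp add: coeffE coeffR)
    finally show "integral {0..1} (\<lambda>x. (E x - R x / sqrt t) * cos (2 * pi * of_int k * x)) = 0" .
  qed (use t in \<open>auto intro!: continuous_intros cE cR simp: perE perR evenE evenR\<close>)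
  then show ?thesis by (simp add: E_def R_def f_def h_def)
qed

subsection \<open>Theta functions\<close>

abbreviation uhp :: "complex set" where "uhp \<equiv> {z. Im z > 0}"

definition ec :: "complex \<Rightarrow> complex" where "ec x = exp (2 * pi * \<i> * x)"

lemma ec_add: "ec (x + y) = ec x * ec y"
  by (simp add: ec_def ring_distribs exp_add)

lemma ec_0 [simp]: "ec 0 = 1"
  by (simp add: ec_def)

lemma ec_minus: "ec (- x) = inverse (ec x)"
  by (simp add: ec_def exp_minus)

lemma ec_diff: "ec (x - y) = ec x / ec y"
  using ec_add[of x "- y"] by (simp add: ec_minus field_simps)

lemma ec_nonzero [simp]: "ec x \<noteq> 0"
  by (simp add: ec_def)

lemma ec_int [simp]: "ec (of_int n) = 1"
  using exp_integer_2pi[of "of_int n"] by (simp add: ec_def mult_ac)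

lemma ec_power: "ec x ^ n = ec (of_nat n * x)"
  by (simp add: ec_def exp_of_nat_mult[symmetric] mult_ac)

lemma ec_powi: "ec x powi n = ec (of_int n * x)"
  by (simp add: ec_def exp_power_int mult_ac)

lemma norm_ec: "norm (ec x) = exp (- 2 * pi * Im x)"
  by (simp add: ec_def norm_exp_eq_Re)

lemma ec_cong_int:
  assumes "x - y = of_int n"
  shows "ec x = ec y"
  using ec_diff[of x y] assms by (simp add: field_simps)

lemma open_uhp: "open uhp"
  by (rule open_halfspace_Im_gt)

lemma connected_uhp: "connected uhp"
  by (intro convex_connected convex_halfspace_Im_gt)

lemma uhp_inverse: "z \<in> uhp \<Longrightarrow> - 1 / z \<in> uhp"
  by (auto simp: Im_divide divide_simps complex_eq_iff zero_less_mult_iff sum_power2_gt_zero_iff)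

lemma holomorphic_infsum:
  fixes f :: "'i \<Rightarrow> complex \<Rightarrow> complex"
  assumes hol: "\<And>n. f n holomorphic_on S"
    and loc: "\<And>z. z \<in> S \<Longrightarrow> \<exists>U M. open U \<and> z \<in> U \<and> U \<subseteq> S \<and> M summable_on UNIV \<and> (\<forall>n. \<forall>w\<in>U. norm (f n w) \<le> M n)"
  shows "(\<lambda>z. \<Sum>\<^sub>\<infinity>n. f n z) holomorphic_on S"
proof (rule analytic_imp_holomorphic, unfold analytic_on_def, intro ballI)
  fix z assume "z \<in> S"
  then obtain U M where U: "open U" "z \<in> U" "U \<subseteq> S" and M: "M summable_on UNIV"
    and b: "\<And>n w. w \<in> U \<Longrightarrow> norm (f n w) \<le> M n"
    using loc by metis
  obtain e where e: "e > 0" "cball z e \<subseteq> U"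
    using U open_contains_cball by blast
  have "uniform_limit (cball z e) (\<lambda>X y. \<Sum>x\<in>X. f x y) (\<lambda>y. \<Sum>\<^sub>\<infinity>n. f n y) (finite_subsets_at_top UNIV)"
    by (rule Weierstrass_m_test_general[OF _ M]) (use b e in auto)
  moreover have "continuous_on (cball z e) (\<lambda>y. \<Sum>x\<in>X. f x y) \<and> (\<lambda>y. \<Sum>x\<in>X. f x y) holomorphic_on ball z e" for X
  proof -
    have "(\<lambda>y. \<Sum>x\<in>X. f x y) holomorphic_on cball z e"
      using e U by (intro holomorphic_intros holomorphic_on_subset[OF hol]) auto
    then show ?thesis
      by (meson ball_subset_cball holomorphic_on_imp_continuous_on holomorphic_on_subset)
  qed
  ultimately have "(\<lambda>y. \<Sum>\<^sub>\<infinity>n. f n y) holomorphic_on ball z e"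
    using holomorphic_uniform_limit[where f = "\<lambda>X y. \<Sum>x\<in>X. f x y" and z = z and r = e and F = "finite_subsets_at_top UNIV"]
    by simp
  with e(1) show "\<exists>\<epsilon>>0. (\<lambda>z. \<Sum>\<^sub>\<infinity>n. f n z) holomorphic_on ball z \<epsilon>"
    by blast
qed

lemma norm_exp_gauss:
  "norm (exp (pi * \<i> * (of_real y)\<^sup>2 * z)) = exp (- pi * Im z * y\<^sup>2)"
  by (simp add: norm_exp_eq_Re mult_ac flip: of_real_power)

lemma gauss_bound_uhp:
  assumes "d > 0" "Im z \<ge> d"
  shows "norm (exp (pi * \<i> * (of_int n + of_real x)\<^sup>2 * z)) \<le>
     exp (pi * d * x\<^sup>2) * exp (- (pi * d / 2) * (of_int n)\<^sup>2)"
proof -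
  have "norm (exp (pi * \<i> * (of_int n + of_real x)\<^sup>2 * z)) = exp (- pi * Im z * (of_int n + x)\<^sup>2)"
    using norm_exp_gauss[of "of_int n + x" z] by simp
  also have "\<dots> \<le> exp (- (pi * d) * (of_int n + x)\<^sup>2)"
    using assms by (simp add: mult_right_mono)
  also have "\<dots> \<le> exp (pi * d * \<bar>x\<bar>\<^sup>2) * exp (- (pi * d / 2) * (of_int n)\<^sup>2)"
    using assms by (intro gauss_shift_le) auto
  finally show ?thesis by simp
qed

lemma gauss_bound_summable: "d > 0 \<Longrightarrow> (\<lambda>n::int. c * exp (- (pi * d / 2) * (of_int n)\<^sup>2)) summable_on UNIV"
  by (intro summable_on_cmult_right summable_on_int_gauss) auto

lemma holomorphic_gauss_sum:
  fixes x :: real and u :: "int \<Rightarrow> complex"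
  assumes u: "\<And>n. norm (u n) \<le> B"
  shows "(\<lambda>z. \<Sum>\<^sub>\<infinity>n::int. u n * exp (pi * \<i> * (of_int n + of_real x)\<^sup>2 * z)) holomorphic_on uhp"
proof (rule holomorphic_infsum)
  fix z assume z: "z \<in> uhp"
  have B: "B \<ge> 0" using u[of 0] norm_ge_zero order.trans by blast
  define d where "d = Im z / 2"
  have d: "d > 0" "d < Im z" using z by (auto simp: d_def)
  define M where "M = (\<lambda>n::int. B * exp (pi * d * x\<^sup>2) * exp (- (pi * d / 2) * (of_int n)\<^sup>2))"
  have "norm (u n * exp (pi * \<i> * (of_int n + of_real x)\<^sup>2 * w)) \<le> M n" if "Im w > d" for n w
    unfolding M_def norm_mult mult.assoc[of B]
    using d that B by (intro mult_mono gauss_bound_uhp u) auto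
  moreover have "M summable_on UNIV"
    unfolding M_def by (rule gauss_bound_summable[OF d(1)])
  moreover have "open {w. Im w > d}" by (rule open_halfspace_Im_gt)
  ultimately show "\<exists>U M. open U \<and> z \<in> U \<and> U \<subseteq> uhp \<and> M summable_on UNIV \<and>
      (\<forall>n. \<forall>w\<in>U. norm (u n * exp (pi * \<i> * (of_int n + of_real x)\<^sup>2 * w)) \<le> M n)"
    using d by (intro exI[of _ "{w. Im w > d}"] exI[of _ M]) auto
qed (intro holomorphic_intros)

lemma gauss_sum_summable:
  fixes x :: real and u :: "int \<Rightarrow> complex"
  assumes u: "\<And>n. norm (u n) \<le> B" and z: "Im z > 0"
  shows "(\<lambda>n::int. u n * exp (pi * \<i> * (of_int n + of_real x)\<^sup>2 * z)) summable_on UNIV"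
proof (rule abs_summable_summable, rule Infinite_Sum.abs_summable_on_comparison_test')
  have B: "B \<ge> 0" using u[of 0] norm_ge_zero order.trans by blast
  show "norm (u n * exp (pi * \<i> * (of_int n + of_real x)\<^sup>2 * z)) \<le>
     (B * exp (pi * Im z * x\<^sup>2)) * exp (- (pi * Im z / 2) * (of_int n)\<^sup>2)" for n
    unfolding norm_mult mult.assoc[of B]
    using z B by (intro mult_mono gauss_bound_uhp u) auto
qed (rule gauss_bound_summable[OF z])

text \<open>Both sides are holomorphic in the upper half-plane, where \<open>- \<i> * z\<close> has
  positive real part and so avoids the branch cut of \<open>csqrt\<close>. On the imaginary axis the
  identity is Poisson summation for Gaussians, and the identity theorem extends it.\<close>

lemma theta_char_inversion:
  fixes x :: real
  assumes "z \<in> uhp"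
  shows "(\<Sum>\<^sub>\<infinity>n::int. exp (pi * \<i> * (of_int n + of_real x)\<^sup>2 * (- 1 / z))) =
     csqrt (- \<i> * z) * (\<Sum>\<^sub>\<infinity>n::int. ec (of_int n * of_real x) * exp (pi * \<i> * (of_int n)\<^sup>2 * z))"
proof -
  define P where "P = (\<lambda>z. \<Sum>\<^sub>\<infinity>n::int. exp (pi * \<i> * (of_int n + of_real x)\<^sup>2 * z))"
  define Q where "Q = (\<lambda>z. \<Sum>\<^sub>\<infinity>n::int. ec (of_int n * of_real x) * exp (pi * \<i> * (of_int n)\<^sup>2 * z))"
  have hP: "P holomorphic_on uhp"
    unfolding P_def using holomorphic_gauss_sum[of "\<lambda>_. 1" 1 x] by simp
  have nec: "norm (ec (of_int n * of_real y)) \<le> 1" for n :: int and y :: real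
    by (simp add: norm_ec)
  have hQ: "Q holomorphic_on uhp"
    unfolding Q_def using holomorphic_gauss_sum[of "\<lambda>n. ec (of_int n * of_real x)" 1 0] nec by simp
  have hD: "(\<lambda>z. P (- 1 / z) - csqrt (- \<i> * z) * Q z) holomorphic_on uhp"
  proof (intro holomorphic_intros hQ)
    show "(\<lambda>z. P (- 1 / z)) holomorphic_on uhp"
      by (rule holomorphic_on_compose_gen[OF _ hP, unfolded o_def])
         (use uhp_inverse in \<open>auto intro!: holomorphic_intros\<close>)
  qed (auto simp: complex_nonpos_Reals_iff)
  have imag: "P (- 1 / (\<i> * of_real s)) - csqrt (- \<i> * (\<i> * of_real s)) * Q (\<i> * of_real s) = 0" if s: "s > 0" for s
  proof -
    have "P (- 1 / (\<i> * of_real s)) = (\<Sum>\<^sub>\<infinity>n::int. of_real (exp (- pi * (1 / s) * (of_int n + x)\<^sup>2)))"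
      unfolding P_def
      by (intro infsum_cong) (simp add: field_simps exp_of_real[symmetric])
    also have "\<dots> = of_real (\<Sum>\<^sub>\<infinity>n::int. exp (- pi * (1 / s) * (of_int n + x)\<^sup>2))"
    proof (rule infsumI, rule has_sum_of_real, rule has_sum_infsum)
      show "(\<lambda>n::int. exp (- pi * (1 / s) * (of_int n + x)\<^sup>2)) summable_on UNIV"
      proof (rule summable_on_comparison_test)
        show "(\<lambda>n::int. exp (pi * (1 / s) * \<bar>x\<bar>\<^sup>2) * exp (- (pi * (1 / s) / 2) * (of_int n)\<^sup>2)) summable_on UNIV"
          using s by (intro summable_on_cmult_right summable_on_int_gauss) auto
        show "exp (- pi * (1 / s) * (of_int n + x)\<^sup>2) \<le> exp (pi * (1 / s) * \<bar>x\<bar>\<^sup>2) * exp (- (pi * (1 / s) / 2) * (of_int n)\<^sup>2)" for n :: int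
          using gauss_shift_le[of "pi * (1 / s)" x "\<bar>x\<bar>" n] s by simp
      qed auto
    qed
    also have "\<dots> = of_real (sqrt s * (\<Sum>\<^sub>\<infinity>m::int. exp (- pi * s * (of_int m)\<^sup>2) * cos (2 * pi * of_int m * x)))"
      by (subst poisson_gauss) (use s in \<open>simp_all add: real_sqrt_divide field_simps\<close>)
    finally have Pv: "P (- 1 / (\<i> * of_real s)) = \<dots>" .
    define g where "g = (\<lambda>y (n::int). ec (of_int n * of_real y) * exp (pi * \<i> * (of_int n)\<^sup>2 * (\<i> * of_real s)))"
    have gs: "g y summable_on UNIV" for y
      using gauss_sum_summable[of "\<lambda>n. ec (of_int n * of_real y)" 1 "\<i> * of_real s" 0] nec s
      unfolding g_def by simp
    \<comment> \<open>Averaging the terms at \<open>n\<close> and \<open>- n\<close> turns the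
      exponentials into the cosines of \<open>poisson_gauss\<close>.\<close>
    have "infsum (g x) UNIV = infsum (g (- x)) UNIV"
      by (rule infsum_reindex_bij_witness[of _ "\<lambda>n. - n" "\<lambda>n. - n"]) (auto simp: g_def)
    then have "2 * infsum (g x) UNIV = infsum (\<lambda>n. g x n + g (- x) n) UNIV"
      by (simp add: infsum_add[OF gs gs])
    also have "\<dots> = (\<Sum>\<^sub>\<infinity>m::int. of_real (2 * (exp (- pi * s * (of_int m)\<^sup>2) * cos (2 * pi * of_int m * x))))"
    proof (rule infsum_cong)
      fix n :: int
      have e: "exp (pi * \<i> * (of_int n)\<^sup>2 * (\<i> * of_real s)) = complex_of_real (exp (- pi * s * (of_int n)\<^sup>2))"
        by (simp add: exp_of_real[symmetric] field_simps)
      have "ec (of_int n * of_real x) + ec (of_int n * of_real (- x)) = 2 * cos (of_real (2 * pi * of_int n * x))"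
        by (simp add: ec_def cos_exp_eq mult_ac)
      then show "g x n + g (- x) n = of_real (2 * (exp (- pi * s * (of_int n)\<^sup>2) * cos (2 * pi * of_int n * x)))"
        unfolding g_def e distrib_right[symmetric] by (simp flip: cos_of_real)
    qed
    also have "\<dots> = of_real (\<Sum>\<^sub>\<infinity>m::int. 2 * (exp (- pi * s * (of_int m)\<^sup>2) * cos (2 * pi * of_int m * x)))"
    proof (rule infsumI, rule has_sum_of_real, rule has_sum_infsum, rule summable_on_cmult_right, rule abs_summable_summable)
      show "(\<lambda>m::int. norm (exp (- pi * s * (of_int m)\<^sup>2) * cos (2 * pi * of_int m * x))) summable_on UNIV"
        by (rule summable_on_comparison_test[OF summable_on_int_gauss[of "pi * s"]])
           (use s in \<open>auto simp: abs_mult mult_le_cancel_left2\<close>)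
    qed
    also have "\<dots> = 2 * of_real (\<Sum>\<^sub>\<infinity>m::int. exp (- pi * s * (of_int m)\<^sup>2) * cos (2 * pi * of_int m * x))"
      by (subst infsum_cmult_right') simp
    finally have "Q (\<i> * of_real s) = of_real (\<Sum>\<^sub>\<infinity>m::int. exp (- pi * s * (of_int m)\<^sup>2) * cos (2 * pi * of_int m * x))"
      by (simp add: Q_def g_def)
    moreover have "csqrt (- \<i> * (\<i> * of_real s)) = of_real (sqrt s)"
      using s by (simp add: csqrt_of_real_nonneg flip: mult.assoc)
    ultimately show ?thesis unfolding Pv by simp
  qed
  have "P (- 1 / z) - csqrt (- \<i> * z) * Q z = 0"
  proof (rule analytic_continuation[OF hD open_uhp connected_uhp, of "(\<lambda>s. \<i> * of_real s) ` {0<..}" \<i>])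
    have "\<i> * of_real 1 islimpt (\<lambda>s. \<i> * of_real s) ` {0<..}"
    proof (rule islimpt_isCont_image)
      show "(1::real) islimpt {0<..}"
        by (rule islimpt_greaterThanLessThan1[of 1 2, THEN islimpt_subset]) auto
      show "\<forall>\<^sub>F y in at 1. \<i> * complex_of_real y \<noteq> \<i> * complex_of_real 1"
        by (auto simp: eventually_at intro!: exI[of _ 1])
    qed (auto intro!: continuous_intros)
    then show "\<i> islimpt (\<lambda>s. \<i> * of_real s) ` {0<..}" by simp
  qed (use assms imag in auto)
  then show ?thesis by (simp add: P_def Q_def)
qed

text \<open>The device behind the changes of variable in sums over residue classes: \<open>N\<close>
  values that are distinct modulo \<open>N\<close> meet each class exactly once.\<close>

lemma sum_complete_residues:
  fixes f :: "int \<Rightarrow> 'a :: comm_monoid_add" and N :: nat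
  assumes A: "finite A" "card A = N" and inj: "inj_on (\<lambda>x. g x mod int N) A"
    and per: "\<And>n. f (n mod int N) = f n"
  shows "(\<Sum>x\<in>A. f (g x)) = (\<Sum>n\<in>{0..<int N}. f n)"
proof (cases "N = 0")
  case False
  have "(\<lambda>x. g x mod int N) ` A = {0..<int N}"
  proof (rule card_subset_eq)
    show "card ((\<lambda>x. g x mod int N) ` A) = card {0..<int N}"
      using A by (simp add: card_image[OF inj])
  qed (use False in auto)
  then have "(\<Sum>n\<in>{0..<int N}. f n) = (\<Sum>x\<in>A. f (g x mod int N))"
    using sum.reindex[OF inj, of f] by simp
  then show ?thesis by (simp add: per)
qed (use A in auto)

lemma has_sum_int_residues:
  fixes f :: "int \<Rightarrow> complex"
  assumes "N > 0" and "\<And>a. a \<in> {0..<int N} \<Longrightarrow> ((\<lambda>m. f (a + int N * m)) has_sum S a) UNIV"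
  shows "(f has_sum (\<Sum>a\<in>{0..<int N}. S a)) UNIV"
proof -
  have "(f has_sum S a) {n. n mod int N = a}" if "a \<in> {0..<int N}" for a
  proof -
    have inj: "inj (\<lambda>m. a + int N * m)" using assms(1) by (auto intro: injI)
    have "range (\<lambda>m. a + int N * m) = {n. n mod int N = a}"
    proof (intro equalityI subsetI)
      fix n assume "n \<in> {n. n mod int N = a}"
      then have "n = a + int N * (n div int N)" by (auto simp: mod_mult_div_eq)
      then show "n \<in> range (\<lambda>m. a + int N * m)" by blast
    qed (use that in auto)
    then show ?thesis
      using has_sum_reindex[OF inj, of f] assms(2)[OF that] by (simp add: o_def)
  qed
  then have "(f has_sum (\<Sum>a\<in>{0..<int N}. S a)) (\<Union>a\<in>{0..<int N}. {n. n mod int N = a})"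
    by (intro sum_has_sum) auto
  also have "(\<Union>a\<in>{0..<int N}. {n. n mod int N = a}) = UNIV"
    using assms(1) by auto
  finally show ?thesis .
qed

lemma has_sum_sum:
  fixes f :: "'i \<Rightarrow> 'a \<Rightarrow> 'b :: topological_comm_monoid_add"
  assumes "\<And>i. i \<in> I \<Longrightarrow> (f i has_sum s i) A"
  shows "((\<lambda>x. \<Sum>i\<in>I. f i x) has_sum (\<Sum>i\<in>I. s i)) A"
  using assms by (induction I rule: infinite_finite_induct) (auto intro: has_sum_add)

definition theta :: "nat \<Rightarrow> (int \<Rightarrow> complex) \<Rightarrow> complex \<Rightarrow> complex" where
  "theta N h z = (\<Sum>\<^sub>\<infinity>n. h n * exp (pi * \<i> * (of_int n)\<^sup>2 * (z / of_nat N)))"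

text \<open>The unitary normalisation keeps powers of \<open>N\<close> out of
  \<open>theta_inversion\<close>.\<close>

definition dft :: "nat \<Rightarrow> (int \<Rightarrow> complex) \<Rightarrow> int \<Rightarrow> complex" where
  "dft N h m = (\<Sum>a\<in>{0..<int N}. h a * ec (of_int (a * m) / of_nat N)) / of_real (sqrt (real N))"

lemma csqrt_divide_of_nat:
  assumes "N > 0" "z \<in> uhp"
  shows "csqrt (- \<i> * (z / of_nat N)) = csqrt (- \<i> * z) / of_real (sqrt (real N))"
proof (rule csqrt_unique)
  have "complex_of_real (sqrt (real N)) ^ 2 = of_nat N"
    by (metis of_real_of_nat_eq of_real_power real_sqrt_pow2 of_nat_0_le_iff)
  then show "(csqrt (- \<i> * z) / of_real (sqrt (real N)))\<^sup>2 = - \<i> * (z / of_nat N)"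
    by (simp add: power_divide)
  have "Re (csqrt (- \<i> * z)) \<noteq> 0"
  proof
    assume "Re (csqrt (- \<i> * z)) = 0"
    then have "Re ((csqrt (- \<i> * z))\<^sup>2) \<le> 0" by (simp add: power2_eq_square)
    then show False using assms by simp
  qed
  then have "Re (csqrt (- \<i> * z)) > 0"
    using csqrt_principal[of "- \<i> * z"] by auto
  then show "Re (csqrt (- \<i> * z) / of_real (sqrt (real N))) > 0 \<or>
      Re (csqrt (- \<i> * z) / of_real (sqrt (real N))) = 0 \<and> 0 \<le> Im (csqrt (- \<i> * z) / of_real (sqrt (real N)))"
    using assms by simp
qed

lemma theta_summable:
  assumes "\<And>n. norm (h n) \<le> B" "z \<in> uhp" "N > 0"
  shows "(\<lambda>n. h n * exp (pi * \<i> * (of_int n)\<^sup>2 * (z / of_nat N))) summable_on UNIV"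
  using gauss_sum_summable[of h B "z / of_nat N" 0] assms by (simp add: Im_divide_of_nat)

text \<open>The residue class of \<open>a\<close> modulo \<open>N\<close> contributes a Gaussian sum
  shifted by \<open>a / N\<close>. Inverting each shifted sum moves the shift into an exponential,
  and summing over \<open>a\<close> assembles the finite Fourier transform of
  \<open>h\<close>.\<close>

theorem theta_inversion:
  assumes N: "N > 0" and per: "\<And>n. h (n mod int N) = h n" and z: "z \<in> uhp"
  shows "theta N h (- 1 / z) = csqrt (- \<i> * z) * theta N (dft N h) z"
proof -
  define w where "w = z / of_nat N"
  have w: "w \<in> uhp" using z N by (simp add: w_def Im_divide_of_nat)
  have wi: "- 1 / w \<in> uhp" by (rule uhp_inverse[OF w])
  define S where "S = (\<lambda>x. \<Sum>\<^sub>\<infinity>n::int. exp (pi * \<i> * (of_int n + of_real x)\<^sup>2 * (- 1 / w)))"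
  define T where "T = (\<lambda>(a::int) (n::int). ec (of_int (a * n) / of_nat N) * exp (pi * \<i> * (of_int n)\<^sup>2 * w))"
  have S: "S (of_int a / of_nat N) = csqrt (- \<i> * w) * infsum (T a) UNIV" for a :: int
  proof -
    have "S (of_int a / of_nat N) = csqrt (- \<i> * w) * 
        (\<Sum>\<^sub>\<infinity>n::int. ec (of_int n * of_real (of_int a / of_nat N)) * exp (pi * \<i> * (of_int n)\<^sup>2 * w))"
      unfolding S_def by (rule theta_char_inversion[OF w])
    also have "(\<lambda>n. ec (of_int n * of_real (of_int a / of_nat N)) * exp (pi * \<i> * (of_int n)\<^sup>2 * w)) = T a"
      by (auto simp: T_def fun_eq_iff mult_ac)
    finally show ?thesis .
  qed
  have Tsum: "T a summable_on UNIV" for a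
    unfolding T_def w_def using z N by (intro theta_summable[where B = 1]) (auto simp: norm_ec)
  have "((\<lambda>n. h n * exp (pi * \<i> * (of_int n)\<^sup>2 * (- 1 / z / of_nat N))) has_sum
      (\<Sum>a\<in>{0..<int N}. h a * S (of_int a / of_nat N))) UNIV"
  proof (rule has_sum_int_residues[OF N])
    fix a :: int assume "a \<in> {0..<int N}"
    have e: "exp (pi * \<i> * (of_int (a + int N * m))\<^sup>2 * (- 1 / z / of_nat N)) =
       exp (pi * \<i> * (of_int m + of_real (of_int a / of_nat N))\<^sup>2 * (- 1 / w))" for m
    proof -
      have "(complex_of_int (a + int N * m))\<^sup>2 * (- 1 / z / of_nat N) =
        (of_int m + of_real (of_int a / of_nat N))\<^sup>2 * (- 1 / w)"
        using N z by (cases "z = 0") (auto simp: w_def field_simps power2_eq_square)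
      then show ?thesis by (simp only: mult.assoc)
    qed
    have h: "h (a + int N * m) = h a" for m
      by (metis per mod_mult_self2)
    have "(\<lambda>m. exp (pi * \<i> * (of_int m + of_real (of_int a / of_nat N))\<^sup>2 * (- 1 / w))) summable_on UNIV"
      using gauss_sum_summable[of "\<lambda>_. 1" 1 "- 1 / w" "of_int a / of_nat N"] wi by simp
    then show "((\<lambda>m. h (a + int N * m) * exp (pi * \<i> * (of_int (a + int N * m))\<^sup>2 * (- 1 / z / of_nat N))) has_sum
        h a * S (of_int a / of_nat N)) UNIV"
      unfolding e h S_def by (intro has_sum_cmult_right has_sum_infsum)
  qed
  then have "theta N h (- 1 / z) = (\<Sum>a\<in>{0..<int N}. h a * S (of_int a / of_nat N))"
    unfolding theta_def by (rule infsumI)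
  also have "\<dots> = csqrt (- \<i> * z) * ((\<Sum>a\<in>{0..<int N}. h a * infsum (T a) UNIV) / of_real (sqrt (real N)))"
    unfolding S using csqrt_divide_of_nat[OF N z] by (simp add: w_def sum_distrib_left sum_divide_distrib mult_ac)
  also have "(\<Sum>a\<in>{0..<int N}. h a * infsum (T a) UNIV) / of_real (sqrt (real N)) = theta N (dft N h) z"
  proof -
    have "((\<lambda>n. (\<Sum>a\<in>{0..<int N}. h a * T a n)) has_sum (\<Sum>a\<in>{0..<int N}. h a * infsum (T a) UNIV)) UNIV"
      by (intro has_sum_sum has_sum_cmult_right has_sum_infsum Tsum)
    from has_sum_cmult_left[OF this, of "inverse (of_real (sqrt (real N)))"]
    have "(\<Sum>\<^sub>\<infinity>n. (\<Sum>a\<in>{0..<int N}. h a * T a n) * inverse (of_real (sqrt (real N)))) =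
        (\<Sum>a\<in>{0..<int N}. h a * infsum (T a) UNIV) / of_real (sqrt (real N))"
      by (simp add: infsumI divide_inverse)
    moreover have "theta N (dft N h) z = (\<Sum>\<^sub>\<infinity>n. (\<Sum>a\<in>{0..<int N}. h a * T a n) * inverse (of_real (sqrt (real N))))"
      unfolding theta_def dft_def T_def w_def
      by (intro infsum_cong) (simp add: sum_distrib_right sum_distrib_left divide_inverse mult_ac)
    ultimately show ?thesis by simp
  qed
  finally show ?thesis .
qed

text \<open>The character with \<open>\<eta>(z) = \<Sum> \<chi>(n) q\<^bsup>n\<^sup>2/24\<^esup>\<close>, the sum being over \<open>n > 0\<close>.\<close>

definition chi12 :: "int \<Rightarrow> int" where
  "chi12 n = (if n mod 12 \<in> {1, 11} then 1 else if n mod 12 \<in> {5, 7} then - 1 else 0)"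

lemma chi12_mod [simp]: "chi12 (n mod 12) = chi12 n"
  by (simp add: chi12_def)

lemma chi12_mod_mult: "chi12 (n mod (12 * M)) = chi12 n"
  by (simp add: chi12_def mod_mod_cancel)

lemma int_mod_12_cases: "(n::int) mod 12 \<in> {0,1,2,3,4,5,6,7,8,9,10,11}"
  unfolding insert_iff empty_iff by presburger

lemma chi12_mult: "chi12 (m * n) = chi12 m * chi12 n"
proof -
  have "chi12 ((m mod 12) * (n mod 12)) = chi12 (m mod 12) * chi12 (n mod 12)"
    using int_mod_12_cases[of m] int_mod_12_cases[of n]
    by (elim insertE emptyE) (simp_all add: chi12_def)
  moreover have "chi12 ((m mod 12) * (n mod 12)) = chi12 (m * n)"
    unfolding chi12_def by (simp add: mod_mult_eq)
  ultimately show ?thesis by simp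
qed

lemma chi12_square: "coprime n 12 \<Longrightarrow> chi12 n * chi12 n = 1"
proof -
  assume "coprime n 12"
  then have "\<not> 2 dvd n" "\<not> 3 dvd n"
    using coprime_common_divisor[of n 12 2] coprime_common_divisor[of n 12 3] by auto
  then have "n mod 12 \<in> {1, 5, 7, 11}"
    using int_mod_12_cases[of n] by simp presburger
  then show ?thesis by (auto simp: chi12_def)
qed

text \<open>Up to the factor \<open>sqrt 12\<close>, \<open>chi12\<close> is its own finite Fourier
  transform. This self-duality is why inversion maps \<eta> to a multiple of itself.\<close>

lemma gauss_sum_chi12:
  "(\<Sum>a\<in>{0..<12::int}. of_int (chi12 a) * ec (of_int (a * m) / 12)) = of_real (sqrt 12) * of_int (chi12 m)"
proof -
  have "(\<Sum>a\<in>{0..<12::int}. of_int (chi12 a) * ec (of_int (a * m) / 12)) =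
    ec (of_int m / 12) + ec (of_int (11 * m) / 12) - (ec (of_int (5 * m) / 12) + ec (of_int (7 * m) / 12))"
  proof -
    have "{0..<12::int} = {0,1,2,3,4,5,6,7,8,9,10,11}" by (auto, presburger)
    then show ?thesis by (simp add: chi12_def)
  qed
  also have "ec (of_int (11 * m) / 12) = ec (- of_int m / 12)"
    by (rule ec_cong_int[where n = m]) simp
  also have "ec (of_int (7 * m) / 12) = ec (- of_int (5 * m) / 12)"
    by (rule ec_cong_int[where n = m]) simp
  also have "ec (of_int m / 12) + ec (- of_int m / 12) = of_real (2 * cos (pi * m / 6))"
    by (simp add: ec_def cos_exp_eq cos_of_real[symmetric] mult_ac)
  also have "ec (of_int (5 * m) / 12) + ec (- of_int (5 * m) / 12) = of_real (2 * cos (pi * (5 * m) / 6))"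
    by (simp add: ec_def cos_exp_eq cos_of_real[symmetric] mult_ac)
  also have "cos (pi * (5 * m) / 6) = (if even m then cos (pi * m / 6) else - cos (pi * m / 6))"
  proof -
    have "pi * (5 * m) / 6 = pi * m - pi * m / 6" by (simp add: field_simps)
    then have "cos (pi * (5 * m) / 6) = cos (pi * m - pi * m / 6)" by (simp only:)
    also have "\<dots> = cos (pi * m) * cos (pi * m / 6)"
      unfolding cos_diff using sin_npi_int[of m] by simp
    finally show ?thesis using cos_npi_int[of m] by simp
  qed
  finally have *: "(\<Sum>a\<in>{0..<12::int}. of_int (chi12 a) * ec (of_int (a * m) / 12)) =
    of_real (if even m then 0 else 4 * cos (pi * m / 6))" by simp
  have "(if even m then 0 else 4 * cos (pi * m / 6)) = sqrt 12 * chi12 m"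
  proof -
    have "pi * m / 6 = pi * (m mod 12) / 6 + 2 * pi * (m div 12)"
    proof -
      have "real_of_int m = 12 * real_of_int (m div 12) + real_of_int (m mod 12)"
        by (metis mult_div_mod_eq of_int_add of_int_mult of_int_numeral)
      then have "pi * m / 6 = pi * (12 * real_of_int (m div 12) + real_of_int (m mod 12)) / 6"
        by (simp only:)
      then show ?thesis by (simp add: field_simps)
    qed
    then have "cos (pi * m / 6) = cos (pi * (m mod 12) / 6 + 2 * pi * (m div 12))"
      by (simp only:)
    also have "\<dots> = cos (pi * (m mod 12) / 6)"
      unfolding cos_add sin_int_2pin cos_int_2pin by simp
    finally have c: "cos (pi * m / 6) = cos (pi * (m mod 12) / 6)" .
    have e: "even m = even (m mod 12)" by presburger
    have s12: "sqrt 12 = 2 * sqrt 3"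
      using real_sqrt_mult[of 4 3] by simp
    have c5: "cos (pi * 5 / 6) = - sqrt 3 / 2" 
      using cos_pi_minus[of "pi / 6"] by (simp add: cos_30 field_simps)
    have c7: "cos (pi * 7 / 6) = - sqrt 3 / 2" 
      using cos_periodic_pi[of "pi / 6"] by (simp add: cos_30 field_simps)
    have c11: "cos (pi * 11 / 6) = sqrt 3 / 2"
      using cos_periodic[of "- pi / 6"] by (simp add: cos_30 field_simps)
    have c3: "cos (pi * 3 / 6) = 0" "cos (pi * 9 / 6) = 0"
      using cos_periodic_pi[of "pi / 2"] by (simp_all add: field_simps)
    have c9: "cos (3 * pi / 2) = 0"
    proof -
      have "3 * pi / 2 = pi / 2 + pi" by simp
      then show ?thesis by (simp only: cos_periodic_pi cos_pi_half minus_zero)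
    qed
    show ?thesis unfolding c e s12 chi12_def
      using int_mod_12_cases[of m]
      by (elim insertE emptyE) (simp_all add: cos_30 c5 c7 c11 c3 c9)
  qed
  then show ?thesis unfolding * by simp
qed

subsection \<open>Gauss sums\<close>

definition eN :: "nat \<Rightarrow> int \<Rightarrow> complex" where
  "eN N a = ec (of_int a / of_nat N)"

lemma eN_0 [simp]: "eN N 0 = 1"
  by (simp add: eN_def)

lemma eN_add: "eN N (a + b) = eN N a * eN N b"
  by (simp add: eN_def add_divide_distrib ec_add)

lemma eN_minus: "eN N (- a) = inverse (eN N a)"
  by (simp add: eN_def ec_minus)

lemma eN_nonzero [simp]: "eN N a \<noteq> 0"
  by (simp add: eN_def)

lemma eN_cong:
  assumes "[a = b] (mod int N)"
  shows "eN N a = eN N b"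
proof (cases "N = 0")
  case False
  from assms obtain k where "a = b + int N * k"
    by (metis cong_iff_lin cong_sym)
  then show ?thesis
    unfolding eN_def using False by (intro ec_cong_int[where n = k]) (simp add: field_simps)
qed (simp add: eN_def)

lemma cong_mod_self: "[n mod N = n] (mod (N::int))"
  by (simp add: Cong.cong_def)

lemma eN_eq_1_iff: "N > 0 \<Longrightarrow> eN N a = 1 \<longleftrightarrow> int N dvd a"
proof
  assume N: "N > 0" and "eN N a = 1"
  then obtain n :: int where "2 * pi * (of_int a / of_nat N) = of_int (2 * n) * pi"
    unfolding eN_def ec_def exp_eq_1 by auto
  then have "real_of_int a = real_of_int (n * int N)" using N by (simp add: field_simps)
  then have "a = n * int N" by (subst (asm) of_int_eq_iff)
  then show "int N dvd a" by simp
next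
  assume "int N dvd a"
  then show "eN N a = 1" using eN_cong[of a 0 N] by (simp add: cong_0_iff)
qed

lemma eN_mult_cancel: "K > 0 \<Longrightarrow> eN (K * N) (int K * a) = eN N a"
  by (simp add: eN_def)

lemma sum_eN:
  assumes N: "N > 0"
  shows "(\<Sum>a\<in>{0..<int N}. eN N (a * m)) = (if int N dvd m then of_nat N else 0)"
proof (cases "int N dvd m")
  case True
  then have "eN N (a * m) = 1" for a by (simp add: eN_eq_1_iff[OF N])
  with True show ?thesis by simp
next
  case False
  have "(\<Sum>a\<in>{0..<int N}. eN N ((a + 1) * m)) = (\<Sum>a\<in>{0..<int N}. eN N (a * m))"
  proof (rule sum_complete_residues[where f = "\<lambda>a. eN N (a * m)"])
    show "inj_on (\<lambda>x. (x + 1) mod int N) {0..<int N}"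
      by (rule inj_onI) (metis add_diff_cancel_right' atLeastLessThan_iff mod_diff_left_eq mod_pos_pos_trivial)
  qed (auto intro!: eN_cong cong_mult cong_mod_self)
  then have "eN N m * (\<Sum>a\<in>{0..<int N}. eN N (a * m)) = (\<Sum>a\<in>{0..<int N}. eN N (a * m))"
    by (simp add: ring_distribs eN_add sum_distrib_left mult.commute)
  then show ?thesis using False eN_eq_1_iff[OF N] by auto
qed

text \<open>Completing the square. Taking \<open>c\<close> as a solution of
  \<open>2 * a * c = b\<close> modulo \<open>N\<close> avoids any division, and the shift by
  \<open>c\<close> permutes the residues.\<close>

lemma sum_eN_quadratic:
  assumes N: "N > 0" and c: "int N dvd 2 * a * c - b"
  shows "(\<Sum>x\<in>{0..<int N}. eN N (a * x\<^sup>2 + b * x)) = eN N (- a * c\<^sup>2) * (\<Sum>x\<in>{0..<int N}. eN N (a * x\<^sup>2))"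
proof -
  have "(\<Sum>x\<in>{0..<int N}. eN N (a * x\<^sup>2)) = (\<Sum>x\<in>{0..<int N}. eN N (a * (x + c)\<^sup>2))"
  proof (rule sum_complete_residues[where f = "\<lambda>x. eN N (a * x\<^sup>2)", symmetric])
    show "inj_on (\<lambda>x. (x + c) mod int N) {0..<int N}"
      by (rule inj_onI) (metis add_diff_cancel_right' atLeastLessThan_iff mod_diff_left_eq mod_pos_pos_trivial)
  qed (auto intro!: eN_cong cong_mult cong_pow cong_mod_self)
  also have "\<dots> = (\<Sum>x\<in>{0..<int N}. eN N (a * c\<^sup>2) * eN N (a * x\<^sup>2 + b * x))"
  proof (rule sum.cong)
    fix x
    have "a * (x + c)\<^sup>2 - (a * c\<^sup>2 + (a * x\<^sup>2 + b * x)) = (2 * a * c - b) * x"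
      by (simp add: power2_eq_square algebra_simps)
    then have "[a * (x + c)\<^sup>2 = a * c\<^sup>2 + (a * x\<^sup>2 + b * x)] (mod int N)"
      using c by (simp add: cong_iff_dvd_diff)
    then show "eN N (a * (x + c)\<^sup>2) = eN N (a * c\<^sup>2) * eN N (a * x\<^sup>2 + b * x)"
      by (metis eN_cong eN_add)
  qed simp
  finally show ?thesis
    by (simp add: sum_distrib_left[symmetric] eN_minus mult.assoc[symmetric])
qed

text \<open>Write the residue as \<open>x + l * y\<close>. The sum over \<open>y\<close> is a full
  character sum, which vanishes unless \<open>l\<close> divides \<open>2 * u * x\<close>, so only
  \<open>x = 0\<close> survives. The value does not depend on \<open>u\<close>: no Legendre symbol
  occurs at level \<open>l^2\<close>.\<close>

lemma sum_eN_quadratic_prime_square: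
  assumes l: "prime l" "l > 2" and u: "\<not> int l dvd u"
  shows "(\<Sum>x\<in>{0..<int (l\<^sup>2)}. eN (l\<^sup>2) (u * x\<^sup>2)) = of_nat l"
proof -
  have l0: "l > 0" using l by simp
  have "(\<Sum>x\<in>{0..<int (l\<^sup>2)}. eN (l\<^sup>2) (u * x\<^sup>2)) =
     (\<Sum>p\<in>{0..<int l} \<times> {0..<int l}. eN (l\<^sup>2) (u * (fst p + int l * snd p)\<^sup>2))"
  proof (rule sum_complete_residues[where f = "\<lambda>x. eN (l\<^sup>2) (u * x\<^sup>2)", symmetric])
    show "inj_on (\<lambda>x. (fst x + int l * snd x) mod int (l\<^sup>2)) ({0..<int l} \<times> {0..<int l})"
    proof (rule inj_onI, clarsimp)
      fix a b a' b' assume ab: "0 \<le> a" "a < int l" "0 \<le> b" "b < int l" "0 \<le> a'" "a' < int l" "0 \<le> b'" "b' < int l"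
        and eq: "(a + int l * b) mod (int l)\<^sup>2 = (a' + int l * b') mod (int l)\<^sup>2"
      have less: "x + int l * y < (int l)\<^sup>2" if "x < int l" "y < int l" for x y
      proof -
        have "int l * (y + 1) \<le> int l * int l" using that by (intro mult_left_mono) auto
        then show ?thesis using that by (simp add: power2_eq_square algebra_simps)
      qed
      have "a + int l * b = a' + int l * b'"
        using eq ab less by simp
      then have "(a + int l * b) mod int l = (a' + int l * b') mod int l" 
        "(a + int l * b) div int l = (a' + int l * b') div int l" by simp_all
      then show "a = a' \<and> b = b'" using ab by simp
    qed
    show "eN (l\<^sup>2) (u * (n mod int (l\<^sup>2))\<^sup>2) = eN (l\<^sup>2) (u * n\<^sup>2)" for n
      by (intro eN_cong cong_mult cong_pow cong_mod_self cong_refl)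
  qed (auto simp: power2_eq_square card_cartesian_product)
  also have "\<dots> = (\<Sum>x\<in>{0..<int l}. \<Sum>y\<in>{0..<int l}. eN (l\<^sup>2) (u * (x + int l * y)\<^sup>2))"
    by (simp add: sum.cartesian_product case_prod_beta)
  also have "\<dots> = (\<Sum>x\<in>{0..<int l}. eN (l\<^sup>2) (u * x\<^sup>2) * (\<Sum>y\<in>{0..<int l}. eN l (y * (2 * u * x))))"
  proof (intro sum.cong refl, unfold sum_distrib_left, intro sum.cong refl)
    fix x y
    have "u * (x + int l * y)\<^sup>2 = u * x\<^sup>2 + int l * (y * (2 * u * x)) + int (l\<^sup>2) * (u * y\<^sup>2)"
      by (simp add: power2_eq_square algebra_simps)
    then have "[u * (x + int l * y)\<^sup>2 = u * x\<^sup>2 + int l * (y * (2 * u * x))] (mod int (l\<^sup>2))"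
      by (simp add: cong_iff_dvd_diff)
    then have "eN (l\<^sup>2) (u * (x + int l * y)\<^sup>2) = eN (l\<^sup>2) (u * x\<^sup>2) * eN (l\<^sup>2) (int l * (y * (2 * u * x)))"
      by (metis eN_cong eN_add)
    then show "eN (l\<^sup>2) (u * (x + int l * y)\<^sup>2) = eN (l\<^sup>2) (u * x\<^sup>2) * eN l (y * (2 * u * x))"
      using eN_mult_cancel[OF l0, of l] by (simp add: power2_eq_square)
  qed
  also have "\<dots> = (\<Sum>x\<in>{0..<int l}. if x = 0 then of_nat l else 0)"
  proof (intro sum.cong refl)
    fix x assume x: "x \<in> {0..<int l}"
    have "int l dvd 2 * u * x \<longleftrightarrow> x = 0"
    proof
      assume "int l dvd 2 * u * x"
      moreover have "prime (int l)" using l by simp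
      moreover have "\<not> int l dvd 2" using l by (auto dest: zdvd_imp_le)
      ultimately have "int l dvd x" using u by (auto simp: prime_dvd_mult_iff)
      then show "x = 0" using x by (auto dest: zdvd_imp_le)
    qed auto
    then show "eN (l\<^sup>2) (u * x\<^sup>2) * (\<Sum>y\<in>{0..<int l}. eN l (y * (2 * u * x))) = (if x = 0 then of_nat l else 0)"
      by (simp add: sum_eN[OF l0])
  qed
  also have "\<dots> = of_nat l" using l0 by simp
  finally show ?thesis .
qed

lemma Legendre_cong: "[a = b] (mod p) \<Longrightarrow> Legendre a p = Legendre b p"
proof -
  assume ab: "[a = b] (mod p)"
  then have "[a = 0] (mod p) \<longleftrightarrow> [b = 0] (mod p)" "QuadRes p a \<longleftrightarrow> QuadRes p b"
    unfolding QuadRes_def by (meson cong_sym cong_trans)+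
  then show ?thesis by (simp add: Legendre_def)
qed

text \<open>Euler's criterion gives the congruence modulo \<open>l\<close>; both sides lie between
  -1 and 1, and \<open>l > 2\<close>, so they are equal.\<close>

lemma Legendre_mult:
  assumes "prime l" "l > 2"
  shows "Legendre (a * b) (int l) = Legendre a (int l) * Legendre b (int l)"
proof -
  have ec: "[Legendre x (int l) = x ^ ((l - 1) div 2)] (mod int l)" for x
    using euler_criterion[of l x] assms by simp
  have "[Legendre (a * b) (int l) = Legendre a (int l) * Legendre b (int l)] (mod int l)"
    using ec[of "a * b"] cong_mult[OF ec[of a] ec[of b]] by (metis cong_sym cong_trans power_mult_distrib)
  then have "int l dvd Legendre (a * b) (int l) - Legendre a (int l) * Legendre b (int l)"
    by (simp add: cong_iff_dvd_diff)
  moreover have "\<bar>Legendre (a * b) (int l) - Legendre a (int l) * Legendre b (int l)\<bar> < int l"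
    using assms(2) by (auto simp: Legendre_def)
  ultimately show ?thesis
    using dvd_imp_le_int[of "Legendre (a * b) (int l) - Legendre a (int l) * Legendre b (int l)" "int l"]
    by linarith
qed

lemma Legendre_unit_square:
  "\<not> int l dvd a \<Longrightarrow> Legendre a (int l) * Legendre a (int l) = 1"
  by (auto simp: Legendre_def cong_0_iff)

lemma card_square_roots_mod:
  assumes l: "prime l" "l > 2"
  shows "int (card {x\<in>{0..<int l}. [x\<^sup>2 = t] (mod int l)}) = 1 + Legendre t (int l)"
proof -
  have pl: "prime (int l)" using l by simp
  consider "[t = 0] (mod int l)" | "\<not> [t = 0] (mod int l)" "QuadRes (int l) t" | "\<not> QuadRes (int l) t" "\<not> [t = 0] (mod int l)"
    by blast
  then show ?thesis
  proof cases
    case 1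
    have "{x\<in>{0..<int l}. [x\<^sup>2 = t] (mod int l)} = {0}"
    proof (intro equalityI subsetI)
      fix x assume x: "x \<in> {x\<in>{0..<int l}. [x\<^sup>2 = t] (mod int l)}"
      then have "[x\<^sup>2 = 0] (mod int l)" using 1 cong_trans by blast
      then have "int l dvd x" using pl by (simp add: cong_0_iff prime_dvd_power_iff)
      then show "x \<in> {0}" using x by (auto dest: zdvd_imp_le)
    qed (use 1 l in \<open>auto intro: cong_sym\<close>)
    then show ?thesis using 1 by (simp add: Legendre_def)
  next
    case 2
    then obtain y where y: "[y\<^sup>2 = t] (mod int l)" by (auto simp: QuadRes_def)
    have ny: "\<not> int l dvd y"
      using 2(1) y by (metis cong_0_iff cong_sym cong_trans dvd_power pos2 dvd_trans)
    have "{x\<in>{0..<int l}. [x\<^sup>2 = t] (mod int l)} = {y mod int l, (- y) mod int l}"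
    proof (intro equalityI subsetI)
      fix x assume x: "x \<in> {x\<in>{0..<int l}. [x\<^sup>2 = t] (mod int l)}"
      then have "[x\<^sup>2 = y\<^sup>2] (mod int l)" using y by (auto intro: cong_trans cong_sym)
      then have "int l dvd (x - y) * (x - (- y))"
        by (simp add: cong_iff_dvd_diff power2_eq_square algebra_simps)
      then have "int l dvd x - y \<or> int l dvd x - (- y)" by (rule prime_dvd_multD[OF pl])
      then have "x mod int l = y mod int l \<or> x mod int l = (- y) mod int l"
        by (simp add: mod_eq_dvd_iff)
      then show "x \<in> {y mod int l, (- y) mod int l}" using x by auto
    next
      fix x assume "x \<in> {y mod int l, (- y) mod int l}"
      then have "[x = y] (mod int l) \<or> [x = - y] (mod int l)" and x: "x \<in> {0..<int l}" 
        using l by (auto simp: Cong.cong_def)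
      then have "[x\<^sup>2 = y\<^sup>2] (mod int l)" using cong_pow[of x _ "int l" 2] by fastforce
      then show "x \<in> {x\<in>{0..<int l}. [x\<^sup>2 = t] (mod int l)}" using x y cong_trans by blast
    qed
    moreover have "y mod int l \<noteq> (- y) mod int l"
    proof
      assume "y mod int l = (- y) mod int l"
      then have "int l dvd 2 * y" by (simp add: mod_eq_dvd_iff)
      moreover have "\<not> int l dvd 2" using l by (auto dest: zdvd_imp_le)
      ultimately show False using ny pl by (auto simp: prime_dvd_mult_iff)
    qed
    ultimately show ?thesis using 2 by (simp add: Legendre_def)
  next
    case 3
    then have e: "{x\<in>{0..<int l}. [x\<^sup>2 = t] (mod int l)} = {}" by (auto simp: QuadRes_def)
    show ?thesis unfolding e using 3 by (simp add: Legendre_def)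
  qed
qed

definition gauss_sum :: "nat \<Rightarrow> complex" where
  "gauss_sum l = (\<Sum>t\<in>{0..<int l}. of_int (Legendre t (int l)) * eN l t)"

text \<open>Group the residues by their square: the class \<open>t\<close> has
  \<open>1 + Legendre t l\<close> square roots, also when it is 0.\<close>

lemma sum_squares_mod_prime:
  fixes F :: "int \<Rightarrow> complex"
  assumes l: "prime l" "l > 2" and per: "\<And>n. F (n mod int l) = F n"
  shows "(\<Sum>x\<in>{0..<int l}. F (x\<^sup>2)) = (\<Sum>t\<in>{0..<int l}. (1 + of_int (Legendre t (int l))) * F t)"
proof -
  have "(\<Sum>x\<in>{0..<int l}. F (x\<^sup>2)) = (\<Sum>x\<in>{0..<int l}. F (x\<^sup>2 mod int l))"
    by (simp add: per)
  also have "\<dots> = (\<Sum>t\<in>{0..<int l}. \<Sum>x\<in>{x\<in>{0..<int l}. x\<^sup>2 mod int l = t}. F (x\<^sup>2 mod int l))"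
    by (rule sum.group[symmetric]) (use l in auto)
  also have "\<dots> = (\<Sum>t\<in>{0..<int l}. (1 + of_int (Legendre t (int l))) * F t)"
  proof (rule sum.cong)
    fix t assume t: "t \<in> {0..<int l}"
    then have tm: "t mod int l = t" by simp
    have eq: "{x\<in>{0..<int l}. x\<^sup>2 mod int l = t} = {x\<in>{0..<int l}. [x\<^sup>2 = t] (mod int l)}"
    proof -
      have "x\<^sup>2 mod int l = t \<longleftrightarrow> [x\<^sup>2 = t] (mod int l)" for x
        using tm by (simp add: Cong.cong_def)
      then show ?thesis by simp
    qed
    have "(\<Sum>x\<in>{x\<in>{0..<int l}. x\<^sup>2 mod int l = t}. F (x\<^sup>2 mod int l)) =
        (\<Sum>x\<in>{x\<in>{0..<int l}. x\<^sup>2 mod int l = t}. F t)"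
      by (rule sum.cong) auto
    also have "\<dots> = of_int (int (card {x\<in>{0..<int l}. x\<^sup>2 mod int l = t})) * F t" by simp
    also have "\<dots> = (1 + of_int (Legendre t (int l))) * F t"
      unfolding eq card_square_roots_mod[OF l] by simp
    finally show "(\<Sum>x\<in>{x\<in>{0..<int l}. x\<^sup>2 mod int l = t}. F (x\<^sup>2 mod int l)) = \<dots>" .
  qed simp
  finally show ?thesis .
qed

text \<open>For \<open>a\<close> prime to \<open>l\<close>, replacing \<open>t\<close> by
  \<open>t * a\<close> pulls out the symbol of \<open>a\<close>. If \<open>l\<close> divides
  \<open>a\<close>, the exponentials are all 1 and the symbols sum to 0, in agreement with the
  symbol of \<open>a\<close>.\<close>

lemma sum_Legendre_eN:
  assumes l: "prime l" "l > 2"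
  shows "(\<Sum>t\<in>{0..<int l}. of_int (Legendre t (int l)) * eN l (t * a)) = of_int (Legendre a (int l)) * gauss_sum l"
proof (cases "int l dvd a")
  case True
  have "(\<Sum>t\<in>{0..<int l}. complex_of_int (Legendre t (int l))) = 0"
    using sum_squares_mod_prime[OF l, of "\<lambda>_. 1"] by (simp add: sum.distrib)
  moreover have "eN l (t * a) = 1" for t using True eN_eq_1_iff[of l] l by simp
  moreover have "Legendre a (int l) = 0" using True by (simp add: Legendre_def cong_0_iff)
  ultimately show ?thesis by simp
next
  case False
  have pl: "prime (int l)" using l by simp
  have "(\<Sum>t\<in>{0..<int l}. of_int (Legendre (t * a) (int l)) * eN l (t * a)) = gauss_sum l"
    unfolding gauss_sum_def
  proof (rule sum_complete_residues[where f = "\<lambda>t. of_int (Legendre t (int l)) * eN l t"])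
    show "inj_on (\<lambda>x. x * a mod int l) {0..<int l}"
    proof (rule inj_onI)
      fix x y assume xy: "x \<in> {0..<int l}" "y \<in> {0..<int l}" and "x * a mod int l = y * a mod int l"
      then have "int l dvd (x - y) * a" by (simp add: mod_eq_dvd_iff algebra_simps)
      then have "int l dvd x - y" using False pl by (auto simp: prime_dvd_mult_iff)
      then have "x mod int l = y mod int l" by (simp add: mod_eq_dvd_iff)
      then show "x = y" using xy by simp
    qed
    show "of_int (Legendre (n mod int l) (int l)) * eN l (n mod int l) = of_int (Legendre n (int l)) * eN l n" for n
      using eN_cong[of "n mod int l" n l] Legendre_cong[of "n mod int l" n "int l"] by (simp add: Cong.cong_def)
  qed auto
  then have "gauss_sum l = of_int (Legendre a (int l)) * (\<Sum>t\<in>{0..<int l}. of_int (Legendre t (int l)) * eN l (t * a))"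
    by (simp add: Legendre_mult[OF l] sum_distrib_left mult_ac)
  then have "of_int (Legendre a (int l)) * gauss_sum l =
      of_int (Legendre a (int l) * Legendre a (int l)) * (\<Sum>t\<in>{0..<int l}. of_int (Legendre t (int l)) * eN l (t * a))"
    by (simp add: mult.assoc)
  then show ?thesis using Legendre_unit_square[OF False] by simp
qed

lemma sum_eN_square:
  assumes l: "prime l" "l > 2" and a: "\<not> int l dvd a"
  shows "(\<Sum>x\<in>{0..<int l}. eN l (a * x\<^sup>2)) = of_int (Legendre a (int l)) * gauss_sum l"
proof -
  have "(\<Sum>x\<in>{0..<int l}. eN l (a * x\<^sup>2)) = (\<Sum>t\<in>{0..<int l}. (1 + of_int (Legendre t (int l))) * eN l (a * t))"
    by (rule sum_squares_mod_prime[OF l, of "\<lambda>t. eN l (a * t)"])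
       (auto intro!: eN_cong cong_mult cong_mod_self)
  also have "\<dots> = (\<Sum>t\<in>{0..<int l}. eN l (t * a)) + (\<Sum>t\<in>{0..<int l}. of_int (Legendre t (int l)) * eN l (t * a))"
    by (simp add: ring_distribs sum.distrib mult.commute)
  also have "\<dots> = of_int (Legendre a (int l)) * gauss_sum l"
    using l a by (simp add: sum_eN sum_Legendre_eN)
  finally show ?thesis .
qed

subsection \<open>The Dedekind eta function\<close>

text \<open>The sum over all integers counts every term twice, hence the division by 2. Starting
  from the theta series gives direct access to inversion; \<open>eta_eq_euler\<close> supplies the
  link with Euler's product.\<close>

definition eta :: "complex \<Rightarrow> complex" where
  "eta z = theta 12 (\<lambda>n. of_int (chi12 n)) z / 2"

text \<open>The factor 24 cancels the denominator in \<open>n^2 / 24\<close>, so the shift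
  multiplies the coefficients by a function of \<open>n\<close> modulo \<open>M\<close>, and the
  result is again a theta series with periodic coefficients, now modulo
  \<open>12 * M\<close>.\<close>

lemma eta_shift_theta:
  assumes M: "M > 0"
  shows "eta ((z + 24 * of_int j) / of_nat M) =
    theta (12 * M) (\<lambda>n. of_int (chi12 n) * eN M (j * n\<^sup>2)) z / 2"
proof -
  have "exp (pi * \<i> * (of_int n)\<^sup>2 * ((z + 24 * of_int j) / of_nat M / of_nat 12)) =
      eN M (j * n\<^sup>2) * exp (pi * \<i> * (of_int n)\<^sup>2 * (z / of_nat (12 * M)))" for n
    using M by (simp add: eN_def ec_def exp_add[symmetric] field_simps)
  then show ?thesis
    unfolding eta_def theta_def by (simp add: mult.assoc)
qed

lemma eta_holomorphic: "eta holomorphic_on uhp"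
proof -
  have 1: "(\<lambda>z. \<Sum>\<^sub>\<infinity>n::int. of_int (chi12 n) * exp (pi * \<i> * (of_int n + of_real 0)\<^sup>2 * z)) holomorphic_on uhp"
    by (rule holomorphic_gauss_sum[where B = 1]) (auto simp: chi12_def)
  have "(\<lambda>z. (\<Sum>\<^sub>\<infinity>n::int. of_int (chi12 n) * exp (pi * \<i> * (of_int n + of_real 0)\<^sup>2 * (z / 12))) / 2) holomorphic_on uhp"
    by (intro holomorphic_intros holomorphic_on_compose_gen[OF _ 1, unfolded o_def]) auto
  then show ?thesis unfolding eta_def theta_def by simp
qed

text \<open>By the Chinese remainder theorem the residues can be written as
  \<open>M * y + 12 * x\<close>, which splits the transform into the Gauss sum of
  \<open>chi12\<close> and a sum modulo \<open>M\<close> alone.\<close>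

lemma dft_chi12_mult:
  assumes M: "M > 0" "coprime (int M) 12" and per: "\<And>n. v (n mod int M) = v n"
  shows "dft (12 * M) (\<lambda>n. of_int (chi12 n) * v n) m =
    of_int (chi12 (int M) * chi12 m) * (\<Sum>x\<in>{0..<int M}. v (12 * x) * eN M (x * m)) / of_real (sqrt (real M))"
proof -
  define F where "F = (\<lambda>a. of_int (chi12 a) * v a * eN (12 * M) (a * m))"
  have "(\<Sum>a\<in>{0..<int (12 * M)}. F a) = (\<Sum>p\<in>{0..<12::int} \<times> {0..<int M}. F (int M * fst p + 12 * snd p))"
  proof (rule sum_complete_residues[symmetric])
    show "inj_on (\<lambda>x. (int M * fst x + 12 * snd x) mod int (12 * M)) ({0..<12} \<times> {0..<int M})"
    proof (rule inj_onI, clarsimp)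
      fix a b a' b' :: int assume ab: "0 \<le> a" "a < 12" "0 \<le> b" "b < int M" "0 \<le> a'" "a' < 12" "0 \<le> b'" "b' < int M"
        and eq: "(int M * a + 12 * b) mod (12 * int M) = (int M * a' + 12 * b') mod (12 * int M)"
      then have d: "12 * int M dvd int M * (a - a') + 12 * (b - b')"
        by (simp add: mod_eq_dvd_iff algebra_simps)
      then have "12 dvd int M * (a - a') + 12 * (b - b')"
        using dvd_mult_left by blast
      then have "12 dvd int M * (a - a')" by (simp add: dvd_add_left_iff)
      then have "12 dvd a - a'" using M(2) by (simp add: coprime_commute coprime_dvd_mult_right_iff)
      then have "a mod 12 = a' mod 12" by (simp add: mod_eq_dvd_iff)
      then have a: "a = a'" using ab by simp
      then have "12 * int M dvd 12 * (b - b')" using d by (simp only: diff_self mult_zero_right add_0_left)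
      then have "int M dvd b - b'" by (subst (asm) dvd_mult_cancel_left) simp
      then have "b mod int M = b' mod int M" by (simp add: mod_eq_dvd_iff)
      then show "a = a' \<and> b = b'" using ab a by simp
    qed
    show "F (n mod int (12 * M)) = F n" for n
    proof -
      have "v (n mod int (12 * M)) = v n"
        by (metis per mod_mult_right_eq mod_mod_cancel dvd_triv_right of_nat_mult)
      moreover have "eN (12 * M) (n mod int (12 * M) * m) = eN (12 * M) (n * m)"
        by (intro eN_cong cong_mult cong_mod_self cong_refl)
      ultimately show ?thesis by (simp add: F_def chi12_mod_mult)
    qed
  qed (auto simp: card_cartesian_product)
  also have "\<dots> = (\<Sum>p\<in>{0..<12::int} \<times> {0..<int M}. 
     of_int (chi12 (int M)) * (of_int (chi12 (fst p)) * ec (of_int (fst p * m) / 12)) * (v (12 * snd p) * eN M (snd p * m)))"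
  proof (intro sum.cong refl)
    fix p :: "int \<times> int"
    obtain y x where p: "p = (y, x)" by force
    have "chi12 (int M * y + 12 * x) = chi12 (int M * y)"
      by (simp add: chi12_def)
    moreover have "v (int M * y + 12 * x) = v (12 * x)"
      using per[of "int M * y + 12 * x"] per[of "12 * x"] by simp
    moreover have "eN (12 * M) ((int M * y + 12 * x) * m) = ec (of_int (y * m) / 12) * eN M (x * m)"
      using M(1) unfolding eN_def ec_add[symmetric] by (simp add: field_simps)
    ultimately show "F (int M * fst p + 12 * snd p) = of_int (chi12 (int M)) *
        (of_int (chi12 (fst p)) * ec (of_int (fst p * m) / 12)) * (v (12 * snd p) * eN M (snd p * m))"
      by (simp add: F_def p chi12_mult)
  qed
  also have "\<dots> = (\<Sum>y\<in>{0..<12::int}. of_int (chi12 (int M)) * (of_int (chi12 y) * ec (of_int (y * m) / 12))) *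
      (\<Sum>x\<in>{0..<int M}. v (12 * x) * eN M (x * m))"
    by (simp only: sum_product sum.cartesian_product case_prod_unfold)
  also have "\<dots> = of_int (chi12 (int M)) * (\<Sum>y\<in>{0..<12::int}. of_int (chi12 y) * ec (of_int (y * m) / 12)) *
      (\<Sum>x\<in>{0..<int M}. v (12 * x) * eN M (x * m))"
    by (simp only: sum_distrib_left)
  also have "\<dots> = of_real (sqrt 12) * (of_int (chi12 (int M) * chi12 m) * (\<Sum>x\<in>{0..<int M}. v (12 * x) * eN M (x * m)))"
    unfolding gauss_sum_chi12 by simp
  finally show ?thesis
    unfolding dft_def F_def eN_def[of "12 * M"] by (simp add: real_sqrt_mult)
qed

lemma theta_cmult: "theta N (\<lambda>n. c * h n) z = c * theta N h z"
  by (simp add: theta_def mult.assoc infsum_cmult_right')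

text \<open>Inversion at level \<open>M\<close> is reduced to the evaluation \<open>K\<close> of a
  quadratic Gauss sum. The coefficient \<open>144 * j\<close> is that of \<open>j * n^2\<close> at
  \<open>n = 12 * x\<close>, the part of the residue that is seen modulo \<open>M\<close>.\<close>

lemma eta_inversion_general:
  assumes M: "M > 0" "coprime (int M) 12" and z: "z \<in> uhp"
    and K: "\<And>m. (\<Sum>x\<in>{0..<int M}. eN M (144 * j * x\<^sup>2 + m * x)) = K * eN M (j' * m\<^sup>2)"
  shows "eta ((- 1 / z + 24 * of_int j) / of_nat M) =
     csqrt (- \<i> * z) * (of_int (chi12 (int M)) * K / of_real (sqrt (real M))) * eta ((z + 24 * of_int j') / of_nat M)"
proof -
  define h where "h = (\<lambda>n. of_int (chi12 n) * eN M (j * n\<^sup>2))"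
  have per: "eN M (j * (n mod int M)\<^sup>2) = eN M (j * n\<^sup>2)" for n
    by (intro eN_cong cong_mult cong_pow cong_mod_self cong_refl)
  have per': "h (n mod int (12 * M)) = h n" for n
  proof -
    have "[n mod int (12 * M) = n] (mod int M)"
      by (metis cong_mod_self cong_modulus_mult mult.commute of_nat_mult)
    then have "eN M (j * (n mod int (12 * M))\<^sup>2) = eN M (j * n\<^sup>2)"
      by (intro eN_cong cong_mult cong_pow cong_refl)
    then show ?thesis by (simp add: h_def chi12_mod_mult)
  qed
  have dft: "dft (12 * M) h m = of_int (chi12 (int M)) * K / of_real (sqrt (real M)) * (of_int (chi12 m) * eN M (j' * m\<^sup>2))" for m
  proof -
    have "(\<Sum>x\<in>{0..<int M}. eN M (j * (12 * x)\<^sup>2) * eN M (x * m)) = K * eN M (j' * m\<^sup>2)"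
      unfolding K[symmetric] eN_add[symmetric] by (simp add: power_mult_distrib mult_ac)
    then show ?thesis
      unfolding h_def by (subst dft_chi12_mult[where v = "\<lambda>n. eN M (j * n\<^sup>2)", OF M per]) (simp add: mult_ac)
  qed
  have "eta ((- 1 / z + 24 * of_int j) / of_nat M) = theta (12 * M) h (- 1 / z) / 2"
    unfolding h_def by (rule eta_shift_theta[OF M(1)])
  also have "theta (12 * M) h (- 1 / z) = csqrt (- \<i> * z) * theta (12 * M) (dft (12 * M) h) z"
    using M(1) by (intro theta_inversion per' z) auto
  also have "theta (12 * M) (dft (12 * M) h) z = of_int (chi12 (int M)) * K / of_real (sqrt (real M)) *
      theta (12 * M) (\<lambda>m. of_int (chi12 m) * eN M (j' * m\<^sup>2)) z"
    unfolding theta_cmult[symmetric] using dft by presburger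
  also have "csqrt (- \<i> * z) * \<dots> / 2 = csqrt (- \<i> * z) * (of_int (chi12 (int M)) * K / of_real (sqrt (real M))) * 
      (theta (12 * M) (\<lambda>m. of_int (chi12 m) * eN M (j' * m\<^sup>2)) z / 2)"
    by simp
  also have "theta (12 * M) (\<lambda>m. of_int (chi12 m) * eN M (j' * m\<^sup>2)) z / 2 = eta ((z + 24 * of_int j') / of_nat M)"
    by (rule eta_shift_theta[OF M(1), symmetric])
  finally show ?thesis .
qed

theorem eta_inversion:
  assumes "z \<in> uhp"
  shows "eta (- 1 / z) = csqrt (- \<i> * z) * eta z"
proof -
  have "{0..<1::int} = {0}" by auto
  then show ?thesis
    using eta_inversion_general[of 1 z 0 1 0] assms by (simp add: eN_eq_1_iff chi12_def)
qed

lemma sum_eN_complete_square: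
  assumes M: "M > 0" and j: "int M dvd 576 * j * j' + 1"
  shows "(\<Sum>x\<in>{0..<int M}. eN M (144 * j * x\<^sup>2 + m * x)) =
    (\<Sum>x\<in>{0..<int M}. eN M (144 * j * x\<^sup>2)) * eN M (j' * m\<^sup>2)"
proof -
  \<comment> \<open>The shift \<open>c = - 2 * j' * m\<close> solves
    \<open>2 * (144 * j) * c = m\<close> modulo \<open>M\<close>, because
    \<open>576 * j * j' = - 1\<close> there.\<close>
  have "2 * (144 * j) * (- 2 * j' * m) - m = - ((576 * j * j' + 1) * m)" by (simp add: algebra_simps)
  then have "int M dvd 2 * (144 * j) * (- 2 * j' * m) - m"
    using j by simp
  then have "(\<Sum>x\<in>{0..<int M}. eN M (144 * j * x\<^sup>2 + m * x)) =
     eN M (- (144 * j) * (- 2 * j' * m)\<^sup>2) * (\<Sum>x\<in>{0..<int M}. eN M (144 * j * x\<^sup>2))"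
    using sum_eN_quadratic[OF M] by blast
  also have "eN M (- (144 * j) * (- 2 * j' * m)\<^sup>2) = eN M (j' * m\<^sup>2)"
  proof (rule eN_cong)
    have "- (144 * j) * (- 2 * j' * m)\<^sup>2 - j' * m\<^sup>2 = - ((576 * j * j' + 1) * (j' * m\<^sup>2))"
      by (simp add: power2_eq_square algebra_simps)
    then show "[- (144 * j) * (- 2 * j' * m)\<^sup>2 = j' * m\<^sup>2] (mod int M)"
      unfolding cong_iff_dvd_diff using j by simp
  qed
  finally show ?thesis by simp
qed

lemma coprime_12_if_prime:
  assumes "prime l" "l > 3"
  shows "coprime (int l) 12"
proof -
  have "coprime l 2" "coprime l 3"
    using assms primes_coprime[of l 2] primes_coprime[of l 3] by auto
  then have "coprime l (2 * 2 * 3)" by (simp only: coprime_mult_right_iff simp_thms)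
  then have "coprime (int l) (int 12)" unfolding coprime_int_iff by simp
  then show ?thesis by simp
qed

lemma not_dvd_if_inverse:
  assumes "prime l" "int l dvd a * j * j' + 1"
  shows "\<not> int l dvd j" "\<not> int l dvd j'"
proof -
  have *: "\<not> int l dvd 1" using assms(1) by (auto simp: prime_gt_1_nat dest: zdvd_imp_le)
  show "\<not> int l dvd j" "\<not> int l dvd j'"
    using assms(2) * by (metis dvd_add_right_iff dvd_mult dvd_mult2)+
qed

text \<open>At level \<open>l^2\<close> the Gauss sum equals \<open>l\<close>, which cancels the
  square root of the level, and \<open>chi12\<close> takes the value 1 at \<open>l^2\<close>. No
  constant survives.\<close>

theorem eta_inversion_prime_square:
  assumes l: "prime l" "l > 3" and j: "int (l\<^sup>2) dvd 576 * j * j' + 1" and z: "z \<in> uhp"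
  shows "eta ((- 1 / z + 24 * of_int j) / of_nat (l\<^sup>2)) = csqrt (- \<i> * z) * eta ((z + 24 * of_int j') / of_nat (l\<^sup>2))"
proof -
  have cop: "coprime (int (l\<^sup>2)) 12" using coprime_12_if_prime[OF l] by simp
  have l0: "l\<^sup>2 > 0" using l by simp
  have "int l dvd 576 * j * j' + 1"
    using j by (metis dvd_trans dvd_triv_left of_nat_mult power2_eq_square)
  then have nj: "\<not> int l dvd j" using not_dvd_if_inverse l by blast
  have "\<not> int l dvd 144"
  proof
    assume "int l dvd 144"
    moreover have "coprime (int l) (12 * 12)" 
      using coprime_12_if_prime[OF l] by (simp only: coprime_mult_right_iff simp_thms)
    ultimately have "is_unit (int l)" using coprime_common_divisor[of "int l" 144 "int l"] by simp
    then show False using l by simp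
  qed
  then have n144: "\<not> int l dvd 144 * j"
    using nj l by (auto simp: prime_dvd_mult_iff)
  have "csqrt (- \<i> * z) * (of_int (chi12 (int (l\<^sup>2))) * of_nat l / of_real (sqrt (real (l\<^sup>2)))) * eta ((z + 24 * of_int j') / of_nat (l\<^sup>2)) =
     csqrt (- \<i> * z) * eta ((z + 24 * of_int j') / of_nat (l\<^sup>2))"
    using l chi12_square[OF coprime_12_if_prime[OF l]] by (simp add: power2_eq_square chi12_mult)
  moreover have "(\<Sum>x\<in>{0..<int (l\<^sup>2)}. eN (l\<^sup>2) (144 * j * x\<^sup>2 + m * x)) = of_nat l * eN (l\<^sup>2) (j' * m\<^sup>2)" for m
    using sum_eN_complete_square[OF l0 j, of m] sum_eN_quadratic_prime_square[OF l(1) _ n144] l by simp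
  ultimately show ?thesis
    using eta_inversion_general[OF l0 cop z, of j "of_nat l" j'] by simp
qed

theorem eta_inversion_prime:
  assumes l: "prime l" "l > 3" and j: "int l dvd 576 * j * j' + 1" and z: "z \<in> uhp"
  shows "eta ((- 1 / z + 24 * of_int j) / of_nat l) =
    csqrt (- \<i> * z) * (of_int (chi12 (int l) * Legendre j (int l)) * gauss_sum l / of_real (sqrt (real l))) *
    eta ((z + 24 * of_int j') / of_nat l)"
proof -
  have l0: "l > 0" using l by simp
  have nj: "\<not> int l dvd 12 * (12 * j)"
    using not_dvd_if_inverse[OF l(1) j] coprime_12_if_prime[OF l] l
    by (metis coprime_dvd_mult_right_iff)
  have l12: "\<not> int l dvd 12"
    using nj by (metis dvd_mult2)
  \<comment> \<open>144 is a square, so only the symbol of \<open>j\<close> remains.\<close>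
  have "Legendre (144 * j) (int l) = Legendre 12 (int l) * Legendre 12 (int l) * Legendre j (int l)"
    using l Legendre_mult[of l "12 * 12" j] Legendre_mult[of l 12 12] by simp
  then have "Legendre (144 * j) (int l) = Legendre j (int l)"
    using Legendre_unit_square[OF l12] by simp
  then have "(\<Sum>x\<in>{0..<int l}. eN l (144 * j * x\<^sup>2)) = of_int (Legendre j (int l)) * gauss_sum l"
    using sum_eN_square[OF l(1), of "144 * j"] nj l by simp
  then show ?thesis
    using eta_inversion_general[OF l0 coprime_12_if_prime[OF l] z, of j _ j'] sum_eN_complete_square[OF l0 j] 
    by simp
qed

section \<open>Pentagonal numbers and Euler's product\<close>

definition pent :: "int \<Rightarrow> nat" where "pent s = nat (s * (3 * s + 1) div 2)"

lemma two_pent: "2 * int (pent s) = s * (3 * s + 1)"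
proof -
  have "even (s * (3 * s + 1))" by simp
  moreover have "s * (3 * s + 1) \<ge> 0"
    by (cases "s \<ge> 0") (auto intro: mult_nonneg_nonneg mult_nonpos_nonpos)
  ultimately show ?thesis by (simp add: pent_def)
qed

lemma inj_pent: "inj pent"
proof (rule injI)
  fix s t assume "pent s = pent t"
  then have "s * (3 * s + 1) = t * (3 * t + 1)" by (metis two_pent)
  then have "(s - t) * (3 * (s + t) + 1) = 0" by (simp add: algebra_simps)
  moreover have "3 * (s + t) + 1 \<noteq> 0" by presburger
  ultimately show "s = t" by simp
qed

lemma abs_le_pent: "\<bar>s\<bar> \<le> int (pent s)"
proof -
  have "2 * \<bar>s\<bar> \<le> s * (3 * s + 1)"
  proof (cases "s \<ge> 1 \<or> s = 0")
    case True
    then show ?thesis using mult_left_mono[of 2 "3 * s + 1" s] by auto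
  next
    case False
    then have "(- s) * 2 \<le> (- s) * (- 3 * s - 1)" by (intro mult_left_mono) auto
    then show ?thesis using False by (simp add: algebra_simps)
  qed
  then show ?thesis using two_pent[of s] by linarith
qed

lemma pent_int: "pent (int n) = n * n + n * Suc n div 2"
proof -
  define d where "d = n * Suc n div 2"
  have "d * 2 = n * Suc n" unfolding d_def by (rule dvd_div_mult_self) simp
  then have d: "int (d * 2) = int (n * Suc n)" by (simp only:)
  then have "2 * int (pent (int n)) = 2 * int (n * n + d)"
    unfolding two_pent using d by (simp add: algebra_simps)
  then have "int (pent (int n)) = int (n * n + d)" by (metis mult_cancel_left zero_neq_numeral)
  then show ?thesis unfolding d_def by (simp only: of_nat_eq_iff)
qed

lemma pent_minus_Suc: "pent (- int (Suc n)) = Suc n * Suc n + n * Suc n div 2"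
proof -
  define d where "d = n * Suc n div 2"
  have "d * 2 = n * Suc n" unfolding d_def by (rule dvd_div_mult_self) simp
  then have d: "int (d * 2) = int (n * Suc n)" by (simp only:)
  then have "2 * int (pent (- int (Suc n))) = 2 * int (Suc n * Suc n + d)"
    unfolding two_pent using d by (simp add: algebra_simps)
  then have "int (pent (- int (Suc n))) = int (Suc n * Suc n + d)" by (metis mult_cancel_left zero_neq_numeral)
  then show ?thesis unfolding d_def by (simp only: of_nat_eq_iff)
qed

text \<open>Shanks' finite form of Euler's pentagonal number theorem, valid in every commutative ring; it is
  used below both for complex numbers and for formal power series.\<close>

lemma shanks_identity:
  fixes x :: "'a :: comm_ring_1"
  shows "(\<Sum>s\<le>n. (- 1) ^ s * (\<Prod>i\<in>{s<..n}. 1 - x ^ i) * x ^ (s * n + s * Suc s div 2)) =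
    (\<Sum>s\<in>{- int n..int n}. (- 1) ^ nat \<bar>s\<bar> * x ^ pent s)"
proof (induction n)
  case 0
  show ?case by (simp add: pent_def)
next
  case (Suc n)
  define F where "F = (\<lambda>n s. \<Prod>i\<in>{s<..n}. 1 - x ^ i)"
  define t where "t = (\<lambda>s::nat. s * Suc s div 2)"
  have t_Suc: "t (Suc s) = t s + Suc s" for s by (simp add: t_def)
  have F_Suc: "F (Suc n) s = F n s * (1 - x ^ Suc n)" if "s \<le> n" for s
  proof -
    have "{s<..Suc n} = insert (Suc n) {s<..n}" using that by auto
    then show ?thesis by (simp add: F_def mult.commute)
  qed
  have F_front: "F n s * (1 - x ^ s) = F n (s - 1)" if "1 \<le> s" "s \<le> n" for s
  proof -
    have "{s - 1<..n} = insert s {s<..n}" using that by auto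
    then show ?thesis by (simp add: F_def mult.commute)
  qed
  have F_self: "F m m = 1" for m by (simp add: F_def)
  \<comment> \<open>The increment of the sum from \<open>n\<close> to \<open>n + 1\<close>
    telescopes along \<open>a\<close>, the factor \<open>1 - x ^ s\<close> being absorbed by the
    product, whose range is thereby extended downwards. Only \<open>- a n\<close> and the term
    \<open>s = n + 1\<close> remain, and these are the two new pentagonal terms.\<close>
  define a where "a = (\<lambda>s. (- 1) ^ s * F n s * x ^ (Suc s * Suc n + t s))"
  have trm: "(- 1) ^ s * F (Suc n) s * x ^ (s * Suc n + t s) - (- 1) ^ s * F n s * x ^ (s * n + t s) =
      (if s = 0 then 0 else a (s - 1)) - a s" if "s \<le> n" for s
  proof -
    have e1: "x ^ (s * Suc n + t s) = x ^ (s * n + t s) * x ^ s"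
      by (simp add: ac_simps flip: power_add)
    have e2: "x ^ (Suc s * Suc n + t s) = x ^ (s * n + t s) * x ^ s * x ^ Suc n"
      by (simp add: ac_simps flip: power_add)
    have "(- 1) ^ s * F (Suc n) s * x ^ (s * Suc n + t s) - (- 1) ^ s * F n s * x ^ (s * n + t s) =
      - ((- 1) ^ s * (F n s * (1 - x ^ s)) * x ^ (s * n + t s)) - a s"
      unfolding F_Suc[OF that] a_def e1 e2 by (simp add: algebra_simps)
    also have "- ((- 1) ^ s * (F n s * (1 - x ^ s)) * x ^ (s * n + t s)) = (if s = 0 then 0 else a (s - 1))"
    proof (cases s)
      case (Suc u)
      have "x ^ (s * n + t s) = x ^ (Suc u * Suc n + t u)"
        by (simp add: Suc t_Suc algebra_simps)
      then show ?thesis using that F_front[of s] by (simp add: Suc a_def)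
    qed simp
    finally show ?thesis .
  qed
  have "(\<Sum>s\<le>Suc n. (- 1) ^ s * F (Suc n) s * x ^ (s * Suc n + t s)) -
      (\<Sum>s\<le>n. (- 1) ^ s * F n s * x ^ (s * n + t s)) =
      (- 1) ^ Suc n * x ^ (Suc n * Suc n + t (Suc n)) + (\<Sum>s\<le>n. (if s = 0 then 0 else a (s - 1)) - a s)"
  proof -
    have "(\<Sum>s\<le>n. (- 1) ^ s * F (Suc n) s * x ^ (s * Suc n + t s)) - (\<Sum>s\<le>n. (- 1) ^ s * F n s * x ^ (s * n + t s)) =
        (\<Sum>s\<le>n. (if s = 0 then 0 else a (s - 1)) - a s)"
      unfolding sum_subtractf[symmetric] by (intro sum.cong refl trm) auto
    then show ?thesis unfolding sum.atMost_Suc F_self by (simp add: algebra_simps)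
  qed
  also have "(\<Sum>s\<le>n. (if s = 0 then 0 else a (s - 1)) - a s) = - a n"
    by (induction n) auto
  also have "- a n = (- 1) ^ Suc n * x ^ (Suc n * Suc n + t n)"
    by (simp add: a_def F_self)
  also have "{- int (Suc n)..int (Suc n)} = insert (int (Suc n)) (insert (- int (Suc n)) {- int n..int n})"
    by auto
  then have "(- 1) ^ Suc n * x ^ (Suc n * Suc n + t (Suc n)) + (- 1) ^ Suc n * x ^ (Suc n * Suc n + t n) =
      (\<Sum>s\<in>{- int (Suc n)..int (Suc n)}. (- 1) ^ nat \<bar>s\<bar> * x ^ pent s) - 
      (\<Sum>s\<in>{- int n..int n}. (- 1) ^ nat \<bar>s\<bar> * x ^ pent s)"
    using pent_int[of "Suc n"] pent_minus_Suc[of n] by (simp add: t_def nat_add_distrib)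
  finally show ?case using Suc.IH by (simp add: F_def t_def)
qed

definition euler_coeff :: "nat \<Rightarrow> rat" where
  "euler_coeff n = (if n \<in> range pent then (- 1) ^ nat \<bar>inv_into UNIV pent n\<bar> else 0)"

definition euler_fps :: "rat fps" where "euler_fps = Abs_fps euler_coeff"

text \<open>Euler's function, the infinite product of \<open>1 - q ^ i\<close> over positive
  \<open>i\<close>, given by its pentagonal series; \<open>euler_LIMSEQ\<close> proves the agreement
  for \<open>norm q < 1\<close>.\<close>

definition euler :: "complex \<Rightarrow> complex" where
  "euler q = (\<Sum>\<^sub>\<infinity>s. (- 1) ^ nat \<bar>s\<bar> * q ^ pent s)"

lemma pent_sum_summable:
  assumes "norm q < 1"
  shows "(\<lambda>s. (- 1) ^ nat \<bar>s\<bar> * q ^ pent s :: complex) summable_on UNIV"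
proof (rule abs_summable_summable, rule Infinite_Sum.abs_summable_on_comparison_test'[OF summable_on_int_power[of "norm q"]])
  fix s :: int
  have "nat \<bar>s\<bar> \<le> pent s" using abs_le_pent[of s] by simp
  then show "norm ((- 1) ^ nat \<bar>s\<bar> * q ^ pent s) \<le> norm q ^ nat \<bar>s\<bar>"
    using assms by (simp add: norm_mult norm_power power_decreasing)
qed (use assms in auto)

lemma euler_has_sum:
  assumes "norm q < 1"
  shows "((\<lambda>n. of_rat (euler_coeff n) * q ^ n) has_sum euler q) UNIV"
proof -
  have "((\<lambda>s. (- 1) ^ nat \<bar>s\<bar> * q ^ pent s) has_sum euler q) UNIV"
    unfolding euler_def by (rule has_sum_infsum[OF pent_sum_summable[OF assms]])
  also have "(\<lambda>s. (- 1) ^ nat \<bar>s\<bar> * q ^ pent s) = (\<lambda>n. of_rat (euler_coeff n) * q ^ n) \<circ> pent"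
    by (auto simp: euler_coeff_def fun_eq_iff inv_f_f[OF inj_pent] of_rat_power of_rat_minus)
  finally have "((\<lambda>n. of_rat (euler_coeff n) * q ^ n) has_sum euler q) (range pent)"
    by (simp only: has_sum_reindex[OF inj_pent])
  then show ?thesis
    by (rule has_sum_cong_neutral[THEN iffD1, rotated -1]) (auto simp: euler_coeff_def)
qed

text \<open>In the finite identity the term \<open>s = 0\<close> is the partial product, and the
  other side tends to the pentagonal series. All products over \<open>{s<..n}\<close> are bounded by
  one constant \<open>C\<close>, so the terms with \<open>s \<ge> 1\<close> together are at most
  \<open>C * (n * r ^ n)\<close>.\<close>

lemma euler_LIMSEQ:
  assumes "norm q < 1"
  shows "(\<lambda>n. \<Prod>i\<in>{0<..n}. 1 - q ^ i) \<longlonglongrightarrow> euler q"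
proof -
  define r where "r = norm q"
  have r: "0 \<le> r" "r < 1" using assms by (auto simp: r_def)
  define C where "C = exp (1 / (1 - r))"
  define G where "G = (\<lambda>n s. (- 1) ^ s * (\<Prod>i\<in>{s<..n}. 1 - q ^ i) * q ^ (s * n + s * Suc s div 2))"
  have C: "norm (\<Prod>i\<in>{s<..n}. 1 - q ^ i) \<le> C" for s n
  proof -
    have "norm (\<Prod>i\<in>{s<..n}. 1 - q ^ i) \<le> (\<Prod>i\<in>{s<..n}. exp (r ^ i))"
      unfolding prod_norm[symmetric]
    proof (rule prod_mono, safe)
      fix i
      have "norm (1 - q ^ i) \<le> 1 + r ^ i"
        using norm_triangle_ineq4[of 1 "q ^ i"] by (simp add: r_def norm_power)
      also have "\<dots> \<le> exp (r ^ i)" by (rule exp_ge_add_one_self)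
      finally show "norm (1 - q ^ i) \<le> exp (r ^ i)" .
    qed auto
    also have "\<dots> = exp (\<Sum>i\<in>{s<..n}. r ^ i)" by (simp add: exp_sum)
    also have "(\<Sum>i\<in>{s<..n}. r ^ i) \<le> (\<Sum>i. r ^ i)"
      using r by (intro sum_le_suminf summable_geometric) auto
    also have "(\<Sum>i. r ^ i) = 1 / (1 - r)" using r by (intro suminf_geometric) auto
    finally show ?thesis by (simp add: C_def)
  qed
  have A: "(\<Sum>s\<le>n. G n s) = (\<Sum>s\<in>{- int n..int n}. (- 1) ^ nat \<bar>s\<bar> * q ^ pent s)" for n
    unfolding G_def by (rule shanks_identity)
  have "(\<lambda>n. \<Sum>s\<in>{- int n..int n}. (- 1) ^ nat \<bar>s\<bar> * q ^ pent s) \<longlonglongrightarrow> euler q"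
  proof -
    have "filterlim (\<lambda>n. {- int n..int n}) (finite_subsets_at_top UNIV) sequentially"
    proof (subst filterlim_finite_subsets_at_top, intro allI impI)
      fix X :: "int set" assume X: "finite X \<and> X \<subseteq> UNIV"
      define B where "B = (\<Sum>x\<in>X. \<bar>x\<bar>)"
      have B: "\<forall>x\<in>X. \<bar>x\<bar> \<le> B" using X by (auto simp: B_def intro: member_le_sum)
      show "\<forall>\<^sub>F y in sequentially. finite {- int y..int y} \<and> X \<subseteq> {- int y..int y} \<and> {- int y..int y} \<subseteq> UNIV"
        using eventually_gt_at_top[of "nat B"] by eventually_elim (use B in fastforce)
    qed
    then show ?thesis
      using has_sum_infsum[OF pent_sum_summable[OF assms]] unfolding has_sum_def euler_def
      by (rule filterlim_compose[rotated])
  qed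
  then have lim: "(\<lambda>n. \<Sum>s\<le>n. G n s) \<longlonglongrightarrow> euler q" by (simp only: A)
  have rest: "(\<lambda>n. \<Sum>s\<in>{1..n}. G n s) \<longlonglongrightarrow> 0"
  proof (rule Lim_null_comparison)
    show "\<forall>\<^sub>F n in sequentially. norm (\<Sum>s\<in>{1..n}. G n s) \<le> C * (of_nat n * r ^ n)"
    proof (intro always_eventually allI)
      fix n
      have "norm (\<Sum>s\<in>{1..n}. G n s) \<le> (\<Sum>s\<in>{1..n}. C * r ^ n)"
      proof (rule sum_norm_le)
        fix s assume s: "s \<in> {1..n}"
        have "n \<le> s * n + s * Suc s div 2" using s by (simp add: trans_le_add1)
        then have "r ^ (s * n + s * Suc s div 2) \<le> r ^ n" using r by (intro power_decreasing) auto
        then show "norm (G n s) \<le> C * r ^ n"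
          unfolding G_def norm_mult norm_power r_def[symmetric] using C[where s = s and n = n] r
          by (auto intro!: mult_mono simp: C_def)
      qed
      then show "norm (\<Sum>s\<in>{1..n}. G n s) \<le> C * (of_nat n * r ^ n)" by (simp add: mult_ac)
    qed
    show "(\<lambda>n. C * (of_nat n * r ^ n)) \<longlonglongrightarrow> 0"
      using r by (intro tendsto_mult_right_zero powser_times_n_limit_0) auto
  qed
  have "(\<Sum>s\<le>n. G n s) - (\<Sum>s\<in>{1..n}. G n s) = (\<Prod>i\<in>{0<..n}. 1 - q ^ i)" for n
  proof -
    have "{..n} = insert 0 {1..n}" by auto
    then show ?thesis by (simp add: G_def)
  qed
  then show ?thesis using tendsto_diff[OF lim rest] by simp
qed

lemma euler_nonzero:
  assumes "norm q < 1"
  shows "euler q \<noteq> 0"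
proof -
  have "abs_convergent_prod (\<lambda>i. 1 - q ^ Suc i)"
  proof -
    have "summable (\<lambda>i. norm (- (q ^ Suc i)))"
      using assms by (simp add: norm_power norm_mult summable_mult)
    then show ?thesis using summable_imp_abs_convergent_prod[of "\<lambda>i. 1 - q ^ Suc i"] by simp
  qed
  then have conv: "convergent_prod (\<lambda>i. 1 - q ^ Suc i)" by (rule abs_convergent_prod_imp_convergent_prod)
  have ne: "1 - q ^ Suc i \<noteq> 0" for i
  proof
    assume "1 - q ^ Suc i = 0"
    then have "norm (q ^ Suc i) = 1" by simp
    moreover have "norm (q ^ Suc i) < 1"
      unfolding norm_power by (cases "q = 0") (use assms power_Suc_less_one[of "norm q" i] in auto)
    ultimately show False by simp
  qed
  have "(\<lambda>n. \<Prod>i\<le>n. 1 - q ^ Suc i) \<longlonglongrightarrow> prodinf (\<lambda>i. 1 - q ^ Suc i)"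
    using conv by (rule convergent_prod_LIMSEQ)
  moreover have "(\<lambda>n. \<Prod>i\<in>{0<..Suc n}. 1 - q ^ i) \<longlonglongrightarrow> euler q"
    using euler_LIMSEQ[OF assms] by (rule LIMSEQ_Suc)
  moreover have "(\<Prod>i\<in>{0<..Suc n}. 1 - q ^ i) = (\<Prod>i\<le>n. 1 - q ^ Suc i)" for n
    by (rule prod.reindex_bij_witness[of _ Suc "\<lambda>i. i - 1"]) auto
  ultimately have "euler q = prodinf (\<lambda>i. 1 - q ^ Suc i)"
    using LIMSEQ_unique by simp
  then show ?thesis using prodinf_nonzero[OF conv] ne by simp
qed

text \<open>\<open>chi12\<close> is supported on the classes 1 and 5 modulo 6, and
  \<open>n = 6 * s + 1\<close> gives \<open>n^2 / 24 = 1 / 24 + pent s\<close>. The reflection of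
  \<open>n\<close> to \<open>- n\<close> exchanges the two classes, which accounts for the factor
  2.\<close>

theorem eta_eq_euler:
  assumes z: "z \<in> uhp"
  shows "eta z = ec (z / 24) * euler (ec z)"
proof -
  define g where "g = (\<lambda>n. of_int (chi12 n) * exp (pi * \<i> * (of_int n)\<^sup>2 * (z / of_nat 12)))"
  have q: "norm (ec z) < 1" using z by (simp add: norm_ec)
  have "((\<lambda>s. (- 1) ^ nat \<bar>s\<bar> * ec z ^ pent s) has_sum euler (ec z)) UNIV"
    unfolding euler_def by (rule has_sum_infsum[OF pent_sum_summable[OF q]])
  then have S: "((\<lambda>s. ec (z / 24) * ((- 1) ^ nat \<bar>s\<bar> * ec z ^ pent s)) has_sum ec (z / 24) * euler (ec z)) UNIV"
    by (rule has_sum_cmult_right)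
  have g1: "g (6 * s + 1) = ec (z / 24) * ((- 1) ^ nat \<bar>s\<bar> * ec z ^ pent s)" for s
  proof -
    have "(6 * s + 1) mod 12 = (if even s then 1 else 7)" by presburger
    then have c: "chi12 (6 * s + 1) = (if even s then 1 else - 1)" by (simp add: chi12_def)
    have c': "complex_of_int (chi12 (6 * s + 1)) = (- 1) ^ nat \<bar>s\<bar>"
      unfolding c by (auto simp: even_nat_iff)
    have p: "complex_of_nat (pent s) = of_int s * (3 * of_int s + 1) / 2"
    proof -
      have "complex_of_int (2 * int (pent s)) = of_int (s * (3 * s + 1))" by (simp only: two_pent)
      then show ?thesis by (simp add: mult.commute)
    qed
    have "exp (pi * \<i> * (of_int (6 * s + 1))\<^sup>2 * (z / of_nat 12)) = ec (z / 24 + of_nat (pent s) * z)"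
    proof -
      have "pi * \<i> * (of_int (6 * s + 1))\<^sup>2 * (z / of_nat 12) = 2 * pi * \<i> * (z / 24 + of_nat (pent s) * z)"
        unfolding p by (simp add: field_simps power2_eq_square)
      then show ?thesis unfolding ec_def by (simp only:)
    qed
    then show ?thesis unfolding g_def c' ec_add ec_power by simp
  qed
  have gm: "g (- n) = g n" for n
  proof -
    have "(- n) mod 12 = (if n mod 12 = 0 then 0 else 12 - n mod 12)" by (simp add: zmod_zminus1_eq_if)
    then have "chi12 (- n) = chi12 n" unfolding chi12_def by auto
    then show ?thesis by (simp add: g_def)
  qed
  have "(g has_sum (\<Sum>a\<in>{0..<int 6}. if a \<in> {1, 5} then ec (z / 24) * euler (ec z) else 0)) UNIV"
  proof (rule has_sum_int_residues)
    fix a :: int assume "a \<in> {0..<int 6}"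
    then have "a \<in> {0, 1, 2, 3, 4, 5}" by auto
    then consider "a = 1" | "a = 5" | "a \<in> {0, 2, 3, 4}" by auto
    then show "((\<lambda>m. g (a + int 6 * m)) has_sum (if a \<in> {1, 5} then ec (z / 24) * euler (ec z) else 0)) UNIV"
    proof cases
      case 1
      then show ?thesis using S by (simp add: g1[symmetric] add.commute)
    next
      case 2
      have "((\<lambda>m. g (6 * m + 1)) has_sum ec (z / 24) * euler (ec z)) UNIV"
        using S by (simp only: g1)
      then have "((\<lambda>m. g (6 * (- m - 1) + 1)) has_sum ec (z / 24) * euler (ec z)) UNIV"
        by (subst has_sum_reindex_bij_witness[of _ "\<lambda>m. - m - 1" "\<lambda>m. - m - 1"]) auto
      moreover have "g (6 * (- m - 1) + 1) = g (5 + 6 * m)" for m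
        using gm[of "5 + 6 * m"] by (simp add: algebra_simps)
      ultimately show ?thesis using 2 by simp
    next
      case 3
      then have "chi12 (a + 6 * m) = 0" for m
        unfolding chi12_def by (auto; presburger)
      then show ?thesis using 3 by (auto simp: g_def)
    qed
  qed auto
  moreover have "(\<Sum>a\<in>{0..<int 6}. if a \<in> {1, 5} then ec (z / 24) * euler (ec z) else 0) = 2 * (ec (z / 24) * euler (ec z))"
  proof -
    have "{0..<int 6} = {0, 1, 2, 3, 4, 5}" by auto
    then show ?thesis by simp
  qed
  ultimately have "infsum g UNIV = 2 * (ec (z / 24) * euler (ec z))"
    by (simp add: infsumI)
  then show ?thesis by (simp add: eta_def theta_def g_def)
qed

lemma eta_nonzero: "z \<in> uhp \<Longrightarrow> eta z \<noteq> 0"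
  by (simp add: eta_eq_euler euler_nonzero norm_ec)

lemma eta_plus_int:
  assumes "z \<in> uhp"
  shows "eta (z + of_int m) = ec (of_int m / 24) * eta z"
proof -
  have "ec (z + of_int m) = ec z" by (rule ec_cong_int[of _ _ m]) simp
  moreover have "ec ((z + of_int m) / 24) = ec (of_int m / 24) * ec (z / 24)"
    by (simp add: add_divide_distrib ec_add)
  ultimately show ?thesis using assms by (simp add: eta_eq_euler)
qed

lemma divide_add_1_complex: "u = v + w \<Longrightarrow> w \<noteq> 0 \<Longrightarrow> u / w = v / w + (1 :: complex)"
  by (simp add: add_divide_distrib)

subsection \<open>The Hecke operator on eta quotients\<close>

locale prime_gt3 =
  fixes l :: nat
  assumes prime_l: "prime l" and l_gt3: "l > 3"
begin

lemma l_pos: "l > 0" "l > 2" "int l > 0" using l_gt3 by auto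

lemma prime_int_l: "prime (int l)" using prime_l by simp

lemma l_not_dvd_24: "\<not> int l dvd 24"
proof
  assume "int l dvd 24"
  moreover have "coprime (int l) (12 * 12)" 
    using coprime_12_if_prime[OF prime_l l_gt3] by (simp only: coprime_mult_right_iff simp_thms)
  moreover have "(24::int) dvd 12 * 12" by simp
  ultimately have "is_unit (int l)" by (meson coprime_common_divisor dvd_refl dvd_trans)
  then show False using l_gt3 by simp
qed

lemma coprime_l2_iff: "coprime (int (l\<^sup>2)) a \<longleftrightarrow> \<not> int l dvd a"
proof -
  have "coprime (int (l\<^sup>2)) a \<longleftrightarrow> coprime (int l) a" by simp
  also have "\<dots> \<longleftrightarrow> \<not> int l dvd a"
    using prime_imp_coprime[OF prime_int_l, of a] coprime_common_divisor[of "int l" a "int l"] l_gt3 by auto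
  finally show ?thesis .
qed

lemma l2_dvd_24_mult: "int (l\<^sup>2) dvd 24 * a \<longleftrightarrow> int (l\<^sup>2) dvd a"
  using coprime_l2_iff[of 24] l_not_dvd_24 coprime_dvd_mult_right_iff by blast

lemma l_dvd_24_mult: "int l dvd 24 * a \<longleftrightarrow> int l dvd a"
  using l_not_dvd_24 prime_int_l by (auto simp: prime_dvd_mult_iff)

lemma solve_mod_l2: "\<not> int l dvd a \<Longrightarrow> \<exists>j. int (l\<^sup>2) dvd a * j - b"
proof -
  assume "\<not> int l dvd a"
  then have "coprime a (int (l\<^sup>2))" using coprime_l2_iff coprime_commute by blast
  then obtain x where "[a * x = 1] (mod int (l\<^sup>2))" using cong_solve_coprime_int by blast
  then have "int (l\<^sup>2) dvd (a * x - 1) * b" by (simp add: cong_iff_dvd_diff)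
  then have "int (l\<^sup>2) dvd a * (x * b) - b" by (simp add: algebra_simps)
  then show ?thesis ..
qed

lemma l_dvd_if_l2_dvd: "int (l\<^sup>2) dvd a \<Longrightarrow> int l dvd a"
  by (metis dvd_mult_left of_nat_mult power2_eq_square)

lemma solve_mod_l: "\<not> int l dvd a \<Longrightarrow> \<exists>j. int l dvd a * j - b"
  using solve_mod_l2 l_dvd_if_l2_dvd by blast

lemma l2_mod_24: "\<exists>a. (int l)\<^sup>2 = 1 + 24 * a"
  using dvd_24_square_minus_one[OF prime_l l_gt3] by (metis add.commute diff_add_cancel dvdE)

text \<open>Pairs satisfying \<open>prim\<close>, modulo \<open>eqv\<close>, are the points of the projective line over \<open>\<int>/l\<^sup>2\<close>. The
  factors \<open>24\<close> below make shifts of the argument of \<open>\<eta>\<close> independent of the chosen representative.\<close>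

definition prim :: "int \<times> int \<Rightarrow> bool" where
  "prim x \<longleftrightarrow> \<not> (int l dvd fst x \<and> int l dvd snd x)"

definition eqv :: "int \<times> int \<Rightarrow> int \<times> int \<Rightarrow> bool" where
  "eqv x y \<longleftrightarrow> int (l\<^sup>2) dvd fst x * snd y - snd x * fst y"

lemma eqv_refl [simp]: "eqv x x" by (simp add: eqv_def mult.commute)

lemma eqv_sym: "eqv x y \<Longrightarrow> eqv y x"
  unfolding eqv_def by (subst dvd_minus_iff[symmetric]) (simp add: mult.commute)

lemma eqv_trans:
  assumes y: "prim y" and xy: "eqv x y" and yz: "eqv y z"
  shows "eqv x z"
proof -
  define w where "w = fst x * snd z - snd x * fst z"
  have "w * fst y = (fst x * snd y - snd x * fst y) * fst z + (fst y * snd z - snd y * fst z) * fst x"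
    "w * snd y = (fst x * snd y - snd x * fst y) * snd z + (fst y * snd z - snd y * fst z) * snd x"
    by (simp_all add: w_def algebra_simps)
  then have "int (l\<^sup>2) dvd w * fst y" "int (l\<^sup>2) dvd w * snd y"
    using xy yz unfolding eqv_def by (simp_all only: dvd_add dvd_mult2)
  then have "int (l\<^sup>2) dvd w"
    using y coprime_l2_iff coprime_dvd_mult_left_iff unfolding prim_def by blast
  then show ?thesis by (simp add: eqv_def w_def)
qed

lemma prim_A [simp]: "prim (1, a)" and prim_C [simp]: "prim (0, 1)"
  using l_gt3 by (auto simp: prim_def)

lemma prim_B: "\<not> int l dvd j \<Longrightarrow> prim (int l, 24 * j)"
  by (simp add: prim_def l_dvd_24_mult)

text \<open>Points are sorted by how often \<open>l\<close> divides the first entry: not at all,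
  once, or at least twice. As 24 is invertible modulo \<open>l\<close>, the second entry can be
  normalised to a multiple of 24 in the first two cases.\<close>

lemma prim_cases:
  assumes "prim x"
  obtains (A) j where "eqv x (1, 24 * j)" | (B) j where "\<not> int l dvd j" "eqv x (int l, 24 * j)" | (C) "eqv x (0, 1)"
proof (cases "int l dvd fst x")
  case False
  then have "\<not> int l dvd 24 * fst x" by (simp add: l_dvd_24_mult)
  then obtain j where "int (l\<^sup>2) dvd 24 * fst x * j - snd x" using solve_mod_l2 by blast
  then have "eqv x (1, 24 * j)" by (simp add: eqv_def mult_ac)
  then show thesis by (rule A)
next
  case True
  then obtain c where c: "fst x = int l * c" by auto
  have nd: "\<not> int l dvd snd x" using assms True by (simp add: prim_def)
  show thesis
  proof (cases "int l dvd c")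
    case True
    then have "eqv x (0, 1)" by (auto simp: eqv_def c power2_eq_square)
    then show thesis by (rule C)
  next
    case False
    then have "\<not> int l dvd 24 * c" by (simp add: l_dvd_24_mult)
    then obtain j where j: "int l dvd 24 * c * j - snd x" using solve_mod_l by blast
    then have "\<not> int l dvd j" using nd by (metis diff_diff_eq2 add_diff_cancel_left' dvd_diff dvd_mult)
    moreover have "fst x * (24 * j) - snd x * int l = int l * (24 * c * j - snd x)"
      by (simp add: c algebra_simps)
    then have "eqv x (int l, 24 * j)"
      using j by (simp add: eqv_def power2_eq_square)
    ultimately show thesis by (rule B)
  qed
qed

lemma eqv_AA: "eqv (1, 24 * i) (1, 24 * j) \<longleftrightarrow> int (l\<^sup>2) dvd j - i"
  using l2_dvd_24_mult[of "j - i"] by (simp add: eqv_def algebra_simps)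

lemma eqv_BB: "eqv (int l, 24 * i) (int l, 24 * j) \<longleftrightarrow> int l dvd j - i"
proof -
  have "int l * (24 * j) - 24 * i * int l = int l * (24 * (j - i))" by (simp add: algebra_simps)
  then show ?thesis using l_gt3 l_dvd_24_mult[of "j - i"] unfolding eqv_def by (simp add: power2_eq_square)
qed

lemma not_eqv_AB: "\<not> int l dvd j \<Longrightarrow> \<not> eqv (1, 24 * i) (int l, 24 * j)"
proof
  assume j: "\<not> int l dvd j" and "eqv (1, 24 * i) (int l, 24 * j)"
  then have "int l dvd 24 * j - 24 * i * int l" using l_dvd_if_l2_dvd by (simp add: eqv_def)
  then have "int l dvd 24 * j" by (metis diff_add_cancel dvd_add dvd_triv_right)
  then show False using j by (simp add: l_dvd_24_mult)
qed

lemma not_eqv_AC: "\<not> eqv (1, 24 * i) (0, 1)"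
  using l_gt3 l_dvd_if_l2_dvd[of 1] by (auto simp: eqv_def)

lemma not_eqv_BC: "\<not> eqv (int l, 24 * i) (0, 1)"
  using l_gt3 by (auto simp: eqv_def power2_eq_square dest: zdvd_imp_le)

text \<open>\<open>psi (c, d)\<close> is \<open>\<eta>(l\<^sup>2z)/\<eta>(z)\<close> composed with a matrix in \<open>SL\<^sub>2(\<int>)\<close> with lower row congruent to
  \<open>(c, d)\<close>; the constants are forced by the transformation formulas for \<open>\<eta>\<close>.\<close>

definition psi :: "int \<times> int \<Rightarrow> complex \<Rightarrow> complex" where
  "psi x z = (if \<exists>j. eqv x (1, 24 * j)
     then eta ((z + 24 * of_int (SOME j. eqv x (1, 24 * j))) / of_nat (l\<^sup>2)) / (of_nat l * eta z)
     else if \<exists>j. \<not> int l dvd j \<and> eqv x (int l, 24 * j)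
     then of_int (chi12 (int l) * Legendre (- (SOME j. \<not> int l dvd j \<and> eqv x (int l, 24 * j))) (int l)) * gauss_sum l / of_nat l *
       eta ((of_nat l * z + 24 * of_int (SOME j. \<not> int l dvd j \<and> eqv x (int l, 24 * j))) / of_nat l) / eta z
     else eta (of_nat (l\<^sup>2) * z) / eta z)"

lemma eqv_cong_left:
  assumes "prim x" "prim y" "eqv x y"
  shows "eqv x u \<longleftrightarrow> eqv y u"
  using assms eqv_trans eqv_sym by blast

lemma psi_cong:
  assumes "prim x" "prim y" "eqv x y"
  shows "psi x z = psi y z"
proof -
  have "eqv x = eqv y" using eqv_cong_left[OF assms] by blast
  then show ?thesis unfolding psi_def by (simp only:)
qed

lemma eta_shift_cong:
  assumes "M > 0" "int M dvd j - i" "z \<in> uhp"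
  shows "eta ((z + 24 * of_int j) / of_nat M) = eta ((z + 24 * of_int i) / of_nat M)"
proof -
  from assms(2) obtain t where "j - i = int M * t" by auto
  then have j: "j = i + int M * t" by simp
  have "(z + 24 * of_int j) / of_nat M = (z + 24 * of_int i) / of_nat M + of_int (24 * t)"
    using assms(1) by (simp add: j field_simps)
  moreover have w: "(z + 24 * of_int i) / of_nat M \<in> uhp"
    using assms by (simp add: Im_divide_of_nat)
  moreover have "ec (of_int (24 * t) / 24) = 1" using ec_int[of t] by simp
  ultimately show ?thesis by (simp only: eta_plus_int[OF w] mult_1)
qed

lemma psi_A:
  assumes "prim x" "eqv x (1, 24 * j)" "z \<in> uhp"
  shows "psi x z = eta ((z + 24 * of_int j) / of_nat (l\<^sup>2)) / (of_nat l * eta z)"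
proof -
  define i where "i = (SOME j. eqv x (1, 24 * j))"
  have i: "eqv x (1, 24 * i)" unfolding i_def by (rule someI[of _ j]) (rule assms)
  then have "eqv (1, 24 * j) (1, 24 * i)" using assms eqv_trans eqv_sym by blast
  then have "int (l\<^sup>2) dvd i - j" by (simp only: eqv_AA)
  then have "eta ((z + 24 * of_int i) / of_nat (l\<^sup>2)) = eta ((z + 24 * of_int j) / of_nat (l\<^sup>2))"
    using l_gt3 assms(3) by (intro eta_shift_cong) auto
  then show ?thesis unfolding psi_def i_def[symmetric] using assms(2) by auto
qed

lemma psi_B:
  assumes "prim x" "\<not> int l dvd j" "eqv x (int l, 24 * j)" "z \<in> uhp"
  shows "psi x z = of_int (chi12 (int l) * Legendre (- j) (int l)) * gauss_sum l / of_nat l *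
    eta ((of_nat l * z + 24 * of_int j) / of_nat l) / eta z"
proof -
  have nA: "\<not> (\<exists>j. eqv x (1, 24 * j))"
    using eqv_cong_left[OF assms(1) prim_B[OF assms(2)] assms(3)] not_eqv_AB[OF assms(2)] eqv_sym by blast
  define i where "i = (SOME j. \<not> int l dvd j \<and> eqv x (int l, 24 * j))"
  have i: "\<not> int l dvd i \<and> eqv x (int l, 24 * i)" unfolding i_def by (rule someI[of _ j]) (use assms in simp)
  then have "eqv (int l, 24 * j) (int l, 24 * i)" using assms eqv_trans eqv_sym by blast
  then have d: "int l dvd i - j" by (simp only: eqv_BB)
  have "eta ((of_nat l * z + 24 * of_int i) / of_nat l) = eta ((of_nat l * z + 24 * of_int j) / of_nat l)"
    using l_gt3 assms(4) d by (intro eta_shift_cong) auto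
  moreover have "Legendre (- i) (int l) = Legendre (- j) (int l)"
    using d by (intro Legendre_cong) (simp add: cong_iff_dvd_diff dvd_diff_commute)
  ultimately show ?thesis unfolding psi_def i_def[symmetric] using assms(2,3) nA by auto
qed

lemma psi_C:
  assumes "prim x" "eqv x (0, 1)"
  shows "psi x z = eta (of_nat (l\<^sup>2) * z) / eta z"
proof -
  have "\<not> (\<exists>j. eqv x (1, 24 * j))" "\<not> (\<exists>j. \<not> int l dvd j \<and> eqv x (int l, 24 * j))"
    using eqv_cong_left[OF assms(1) prim_C assms(2)] not_eqv_AC not_eqv_BC eqv_sym by blast+
  then show ?thesis unfolding psi_def by (simp only: if_False)
qed

text \<open>This excludes poles of negative powers of \<open>psi\<close>. The condition on the Gauss
  sum is discharged by \<open>gauss_sum_nonzero\<close>, once its square has been evaluated.\<close>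

lemma psi_nonzero: "prim x \<Longrightarrow> z \<in> uhp \<Longrightarrow> gauss_sum l \<noteq> 0 \<Longrightarrow> psi x z \<noteq> 0"
proof -
  assume x: "prim x" and z: "z \<in> uhp" and g: "gauss_sum l \<noteq> 0"
  have l0: "complex_of_nat l \<noteq> 0" using l_gt3 by simp
  show ?thesis
  proof (cases rule: prim_cases[OF x])
    case (1 j)
    have "eta ((z + 24 * of_int j) / of_nat (l\<^sup>2)) \<noteq> 0"
      using z l_gt3 by (intro eta_nonzero) (simp add: Im_divide_of_nat del: of_nat_power)
    then show ?thesis using psi_A[OF x 1 z] eta_nonzero[OF z] l0 by simp
  next
    case (2 j)
    have "eta ((of_nat l * z + 24 * of_int j) / of_nat l) \<noteq> 0"
      using z l_gt3 by (intro eta_nonzero) (simp add: Im_divide_of_nat)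
    moreover have "Legendre (- j) (int l) \<noteq> 0" using Legendre_unit_square[of l "- j"] 2 by auto
    moreover have "chi12 (int l) \<noteq> 0" using chi12_square[OF coprime_12_if_prime[OF prime_l l_gt3]] by auto
    ultimately show ?thesis using psi_B[OF x 2 z] eta_nonzero[OF z] l0 g by simp
  next
    case 3
    have "eta (of_nat (l\<^sup>2) * z) \<noteq> 0"
      using z l_gt3 by (intro eta_nonzero) (simp flip: of_nat_power)
    then show ?thesis using psi_C[OF x 3] eta_nonzero[OF z] by simp
  qed
qed

text \<open>Since \<open>l^2 = 1\<close> modulo 24, numerator and denominator pick up the same root
  of unity \<open>ec (1 / 24)\<close>, and the two cancel.\<close>

lemma psi_T:
  assumes x: "prim x" and z: "z \<in> uhp"
  shows "psi x (z + 1) = psi (fst x, snd x + fst x) z"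
proof -
  define y where "y = (fst x, snd x + fst x)"
  have y: "prim y" using x by (auto simp: prim_def y_def dvd_add_left_iff)
  have ey: "eqv y (a, b + a)" if "eqv x (a, b)" for a b
    using that by (simp add: eqv_def y_def algebra_simps)
  have z1: "z + 1 \<in> uhp" using z by simp
  obtain a where a: "(int l)\<^sup>2 = 1 + 24 * a" using l2_mod_24 by blast
  have a': "complex_of_nat (l\<^sup>2) = 1 + 24 * of_int a"
    using arg_cong[OF a, of complex_of_int] by simp
  have t1: "eta (w + 1) = ec (1 / 24) * eta w" if "w \<in> uhp" for w
    using eta_plus_int[OF that, of 1] by simp
  have "psi x (z + 1) = psi y z"
  proof (cases rule: prim_cases[OF x])
    case (1 j)
    \<comment> \<open>With \<open>l^2 = 1 + 24 * a\<close>, the argument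
      \<open>z + 1 + 24 * j\<close> equals \<open>(z + 24 * (j - a)) + l^2\<close>.\<close>
    have w: "(z + 24 * of_int (j - a)) / of_nat (l\<^sup>2) \<in> uhp"
      using z l_gt3 by (simp add: Im_divide_of_nat del: of_nat_power)
    have "1 * (24 * (j - a)) - (24 * j + 1) * 1 = - int (l\<^sup>2)" using a by simp
    then have "eqv (1, 24 * j + 1) (1, 24 * (j - a))"
      unfolding eqv_def fst_conv snd_conv by (simp only: dvd_minus_iff dvd_refl)
    then have "eqv y (1, 24 * (j - a))" using ey[OF 1] eqv_trans prim_A by blast
    then have py: "psi y z = eta ((z + 24 * of_int (j - a)) / of_nat (l\<^sup>2)) / (of_nat l * eta z)"
      using psi_A y z by blast
    have "(z + 1 + 24 * of_int j) / of_nat (l\<^sup>2) = (z + 24 * of_int (j - a)) / of_nat (l\<^sup>2) + 1"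
    proof -
      have "z + 1 + 24 * of_int j = (z + 24 * of_int (j - a)) + of_nat (l\<^sup>2)" unfolding a' by simp
      moreover have "complex_of_nat (l\<^sup>2) \<noteq> 0" using l_gt3 by simp
      ultimately show ?thesis by (rule divide_add_1_complex)
    qed
    then show ?thesis
      using psi_A[OF x 1 z1] py t1[OF w] t1[OF z] by simp
  next
    case (2 j)
    have w: "(of_nat l * z + 24 * of_int j) / of_nat l \<in> uhp"
      using z l_gt3 by (simp add: Im_divide_of_nat)
    have "eqv (int l, 24 * j + int l) (int l, 24 * j)"
      by (simp add: eqv_def power2_eq_square algebra_simps)
    moreover have "prim (int l, 24 * j + int l)" using 2(1) by (simp add: prim_def l_dvd_24_mult)
    ultimately have "eqv y (int l, 24 * j)" using ey[OF 2(2)] eqv_trans by blast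
    then have py: "psi y z = of_int (chi12 (int l) * Legendre (- j) (int l)) * gauss_sum l / of_nat l *
        eta ((of_nat l * z + 24 * of_int j) / of_nat l) / eta z"
      using psi_B y z 2(1) by blast
    have "(of_nat l * (z + 1) + 24 * of_int j) / of_nat l = (of_nat l * z + 24 * of_int j) / of_nat l + 1"
      using l_gt3 by (simp add: field_simps)
    then show ?thesis
      using psi_B[OF x 2 z1] py t1[OF w] t1[OF z] by simp
  next
    case 3
    have w: "of_nat (l\<^sup>2) * z \<in> uhp" using z l_gt3 by (simp flip: of_nat_power)
    have "eqv y (0, 1)" using ey[OF 3] by simp
    then have py: "psi y z = eta (of_nat (l\<^sup>2) * z) / eta z" using psi_C y by blast
    have "eta (of_nat (l\<^sup>2) * (z + 1)) = eta (of_nat (l\<^sup>2) * z + of_int (int (l\<^sup>2)))"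
      by (simp add: algebra_simps)
    also have "\<dots> = ec (of_int (int (l\<^sup>2)) / 24) * eta (of_nat (l\<^sup>2) * z)" by (rule eta_plus_int[OF w])
    also have "ec (of_int (int (l\<^sup>2)) / 24) = ec (1 / 24)"
      by (rule ec_cong_int[of _ _ a]) (use a' in \<open>simp add: field_simps\<close>)
    finally show ?thesis using psi_C[OF x 3] py t1[OF z] by simp
  qed
  then show ?thesis by (simp add: y_def)
qed

lemma csqrt_uhp_nonzero: "z \<in> uhp \<Longrightarrow> csqrt (- \<i> * z) \<noteq> 0"
  by auto

text \<open>Inversion sends \<open>(1, 24 * j)\<close> to a point of the first, second or third kind
  according to how often \<open>l\<close> divides \<open>j\<close>. The three cases rest on
  inversion at level \<open>l^2\<close>, \<open>l\<close> and 1, and the constants built into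
  \<open>psi\<close> are exactly those that arise.\<close>

lemma psi_S_A:
  assumes x: "prim x" and z: "z \<in> uhp" and A: "eqv x (1, 24 * j)"
  shows "psi x (- 1 / z) = psi (snd x, - fst x) z"
proof -
  define y where "y = (snd x, - fst x)"
  have y: "prim y" using x by (auto simp: prim_def y_def)
  have ey: "eqv y (24 * j, - 1)"
    using A by (simp add: eqv_def y_def algebra_simps)
  have zi: "- 1 / z \<in> uhp" using z by (rule uhp_inverse)
  have p: "prim (24 * j, - 1)" using l_gt3 by (simp add: prim_def)
  have z0: "csqrt (- \<i> * z) \<noteq> 0" using z by (rule csqrt_uhp_nonzero)
  have px: "psi x (- 1 / z) = eta ((- 1 / z + 24 * of_int j) / of_nat (l\<^sup>2)) / (of_nat l * (csqrt (- \<i> * z) * eta z))"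
    using psi_A[OF x A zi] eta_inversion[OF z] by simp
  consider "\<not> int l dvd j" | j0 where "j = int l * j0" "\<not> int l dvd j0" | "int (l\<^sup>2) dvd j"
  proof (cases "int l dvd j")
    case True
    then obtain j0 where "j = int l * j0" by auto
    then show ?thesis using that by (cases "int l dvd j0") (auto simp: power2_eq_square)
  qed (use that in blast)
  then have "psi x (- 1 / z) = psi y z"
  proof cases
    case 1
    have "\<not> int l dvd 24 * (24 * j)" using 1 by (simp only: l_dvd_24_mult not_False_eq_True)
    then obtain j' where j': "int (l\<^sup>2) dvd 24 * (24 * j) * j' - (- 1)" using solve_mod_l2 by blast
    then have "eqv (24 * j, - 1) (1, 24 * j')" by (simp add: eqv_def algebra_simps)
    then have "eqv y (1, 24 * j')" using ey p eqv_trans by blast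
    then have "psi y z = eta ((z + 24 * of_int j') / of_nat (l\<^sup>2)) / (of_nat l * eta z)"
      using psi_A y z by blast
    moreover have "eta ((- 1 / z + 24 * of_int j) / of_nat (l\<^sup>2)) = csqrt (- \<i> * z) * eta ((z + 24 * of_int j') / of_nat (l\<^sup>2))"
      using j' by (intro eta_inversion_prime_square prime_l l_gt3 z) (simp add: mult_ac)
    ultimately show ?thesis using px z0 by (simp add: mult.left_commute)
  next
    case 2
    have "\<not> int l dvd 24 * (24 * j0)" using 2(2) by (simp only: l_dvd_24_mult not_False_eq_True)
    then obtain j' where "int l dvd 24 * (24 * j0) * j' - (- 1)" using solve_mod_l by blast
    then have j': "int l dvd 576 * j0 * j' + 1" by (simp add: mult_ac)
    then have nj': "\<not> int l dvd j'" using not_dvd_if_inverse[OF prime_l] by blast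
    have "24 * j * (24 * j') - (- 1) * int l = int l * (576 * j0 * j' + 1)"
      using 2(1) by (simp add: algebra_simps)
    then have "eqv (24 * j, - 1) (int l, 24 * j')" using j' unfolding eqv_def
      by (simp add: power2_eq_square)
    then have "eqv y (int l, 24 * j')" using ey p eqv_trans by blast
    then have py: "psi y z = of_int (chi12 (int l) * Legendre (- j') (int l)) * gauss_sum l / of_nat l *
        eta ((of_nat l * z + 24 * of_int j') / of_nat l) / eta z"
      using psi_B y z nj' by blast
    have lz: "of_nat l * z \<in> uhp" using z l_gt3 by simp
    have "(- 1 / z + 24 * of_int j) / of_nat (l\<^sup>2) = (- 1 / (of_nat l * z) + 24 * of_int j0) / of_nat l"
      using l_gt3 z by (cases "z = 0") (auto simp: 2(1) field_simps power2_eq_square)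
    then have "eta ((- 1 / z + 24 * of_int j) / of_nat (l\<^sup>2)) =
      csqrt (- \<i> * (of_nat l * z)) * (of_int (chi12 (int l) * Legendre j0 (int l)) * gauss_sum l / of_real (sqrt (real l))) *
       eta ((of_nat l * z + 24 * of_int j') / of_nat l)"
      using eta_inversion_prime[OF prime_l l_gt3 j' lz] by (simp only:)
    also have "csqrt (- \<i> * (of_nat l * z)) = csqrt (- \<i> * z) * of_real (sqrt (real l))"
      using csqrt_divide_of_nat[of l "of_nat l * z"] l_gt3 lz by (simp add: field_simps)
    \<comment> \<open>Modulo \<open>l\<close> one has \<open>24 * 24 * j0 * (- j') = 1\<close>; the
      square drops out, so the two symbols have product 1 and agree.\<close>
    also have "Legendre j0 (int l) = Legendre (- j') (int l)"
    proof -
      have "Legendre (24 * 24 * (j0 * (- j'))) (int l) = Legendre 1 (int l)"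
        using j' by (intro Legendre_cong) (simp add: cong_iff_dvd_diff dvd_diff_commute mult_ac add.commute)
      then have "Legendre j0 (int l) * Legendre (- j') (int l) = Legendre 1 (int l)"
        using Legendre_unit_square[OF l_not_dvd_24] by (simp only: Legendre_mult[OF prime_l l_pos(2)] mult_1)
      moreover have "Legendre 1 (int l) = 1"
        using Legendre_mult[OF prime_l l_pos(2), of 1 1] Legendre_unit_square[of l 1] l_gt3 by simp
      ultimately have "Legendre j0 (int l) * Legendre (- j') (int l) = 1" by simp
      then show ?thesis by (simp add: zmult_eq_1_iff) argo
    qed
    finally show ?thesis using px py z0 l_gt3 by (simp add: field_simps)
  next
    case 3
    then have "eqv (24 * j, - 1) (0, 1)" by (simp add: eqv_def)
    then have "eqv y (0, 1)" using ey p eqv_trans by blast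
    then have py: "psi y z = eta (of_nat (l\<^sup>2) * z) / eta z" using psi_C y by blast
    have lz: "of_nat (l\<^sup>2) * z \<in> uhp" using z l_gt3 by (simp flip: of_nat_power)
    have "eta ((- 1 / z + 24 * of_int j) / of_nat (l\<^sup>2)) = eta ((- 1 / z + 24 * of_int 0) / of_nat (l\<^sup>2))"
      using l_gt3 3 zi by (intro eta_shift_cong) auto
    also have "(- 1 / z + 24 * of_int 0) / of_nat (l\<^sup>2) = - 1 / (of_nat (l\<^sup>2) * z)"
      by simp
    also have "eta \<dots> = csqrt (- \<i> * (of_nat (l\<^sup>2) * z)) * eta (of_nat (l\<^sup>2) * z)"
      by (rule eta_inversion[OF lz])
    also have "csqrt (- \<i> * (of_nat (l\<^sup>2) * z)) = of_nat l * csqrt (- \<i> * z)"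
      using csqrt_divide_of_nat[of "l\<^sup>2" "of_nat (l\<^sup>2) * z"] l_gt3 lz by (simp add: field_simps)
    finally show ?thesis using px py z0 l_gt3 by (simp add: field_simps)
  qed
  then show ?thesis by (simp add: y_def)
qed

lemma psi_S:
  assumes x: "prim x" and z: "z \<in> uhp"
  shows "psi x (- 1 / z) = psi (snd x, - fst x) z"
proof (cases "\<exists>j. eqv x (1, 24 * j)")
  case True
  then show ?thesis using psi_S_A[OF x z] by blast
next
  case False
  \<comment> \<open>Here \<open>y\<close> falls under the previous lemma; apply it at \<open>- 1 / z\<close>.\<close>
  define y where "y = (snd x, - fst x)"
  have y: "prim y" using x by (auto simp: prim_def y_def)
  have "\<exists>j. eqv y (1, 24 * j)"
  proof (cases rule: prim_cases[OF x])
    case (2 j)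
    have ey: "eqv y (24 * j, - int l)" using 2(2) by (simp add: eqv_def y_def algebra_simps)
    have p: "prim (24 * j, - int l)" using 2(1) by (simp add: prim_def l_dvd_24_mult)
    have "\<not> int l dvd 24 * (24 * j)" using 2(1) by (simp only: l_dvd_24_mult not_False_eq_True)
    then obtain j' where j': "int l dvd 24 * (24 * j) * j' - (- 1)" using solve_mod_l by blast
    have "24 * j * (24 * (int l * j')) - (- int l) * 1 = int l * (24 * (24 * j) * j' - (- 1))"
      by (simp add: algebra_simps)
    then have "eqv (24 * j, - int l) (1, 24 * (int l * j'))" using j' unfolding eqv_def
      by (simp add: power2_eq_square)
    then show ?thesis using ey p eqv_trans by blast
  next
    case 3
    then have "eqv y (1, 24 * 0)" by (simp add: eqv_def y_def)
    then show ?thesis by blast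
  qed (use False in blast)
  then obtain j where j: "eqv y (1, 24 * j)" ..
  have "psi y (- 1 / (- 1 / z)) = psi (snd y, - fst y) (- 1 / z)"
    by (rule psi_S_A[OF y uhp_inverse[OF z] j])
  moreover have "psi (snd y, - fst y) (- 1 / z) = psi x (- 1 / z)"
    by (rule psi_cong) (use x in \<open>auto simp: y_def prim_def eqv_def algebra_simps\<close>)
  ultimately show ?thesis by (simp add: y_def)
qed

end

section \<open>Action of the modular group on the translates\<close>

lemma moebius_uhp:
  fixes a b c d :: int
  assumes det: "a * d - b * c = 1" and z: "z \<in> uhp"
  shows "of_int c * z + of_int d \<noteq> 0" "(of_int a * z + of_int b) / (of_int c * z + of_int d) \<in> uhp"
proof -
  show ne: "of_int c * z + of_int d \<noteq> 0"
  proof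
    assume "of_int c * z + of_int d = 0"
    then have "Im (of_int c * z + of_int d) = 0" "Re (of_int c * z + of_int d) = 0" by simp_all
    then have "c = 0" "d = 0" using z by auto
    then show False using det by simp
  qed
  have "real_of_int a * d - real_of_int b * c = 1"
    using arg_cong[OF det, of real_of_int] by simp
  then have "Im ((of_int a * z + of_int b) * cnj (of_int c * z + of_int d)) = Im z"
    by (simp add: algebra_simps)
  moreover have "Im ((of_int a * z + of_int b) / (of_int c * z + of_int d)) =
      Im ((of_int a * z + of_int b) * cnj (of_int c * z + of_int d)) / (norm (of_int c * z + of_int d))\<^sup>2"
    by (simp add: complex_div_cnj[of "of_int a * z + of_int b"] Im_divide_of_real flip: of_real_power)
  ultimately show "(of_int a * z + of_int b) / (of_int c * z + of_int d) \<in> uhp"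
    using z ne by simp
qed

context prime_gt3
begin

definition act :: "int \<times> int \<Rightarrow> int \<Rightarrow> int \<Rightarrow> int \<Rightarrow> int \<Rightarrow> int \<times> int" where
  "act x a b c d = (fst x * a + snd x * c, fst x * b + snd x * d)"

lemma om_act:
  assumes "a * d - b * c = 1"
  shows "fst (act x a b c d) * snd (act y a b c d) - snd (act x a b c d) * fst (act y a b c d) =
    fst x * snd y - snd x * fst y"
proof -
  have "fst (act x a b c d) * snd (act y a b c d) - snd (act x a b c d) * fst (act y a b c d) =
    (a * d - b * c) * (fst x * snd y - snd x * fst y)"
    by (simp add: act_def algebra_simps)
  then show ?thesis using assms by simp
qed

lemma prim_act:
  assumes det: "a * d - b * c = 1" and x: "prim x"
  shows "prim (act x a b c d)"
proof -
  define y where "y = act x a b c d"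
  have "fst x = (a * d - b * c) * fst x" "snd x = (a * d - b * c) * snd x" using det by simp_all
  then have "fst x = d * fst y - c * snd y" "snd x = a * snd y - b * fst y"
    by (simp_all add: y_def act_def algebra_simps)
  then have "int l dvd fst x \<and> int l dvd snd x" if "int l dvd fst y \<and> int l dvd snd y"
    using that by simp
  then show ?thesis using x unfolding prim_def y_def by blast
qed

lemma eqv_act: "a * d - b * c = 1 \<Longrightarrow> eqv (act x a b c d) (act y a b c d) \<longleftrightarrow> eqv x y"
  unfolding eqv_def by (simp only: om_act)

lemma prim_uminus: "prim (- fst x, - snd x) \<longleftrightarrow> prim x"
  by (simp add: prim_def)

lemma psi_uminus: "prim x \<Longrightarrow> psi (- fst x, - snd x) z = psi x z"
  by (intro psi_cong) (auto simp: prim_uminus eqv_def)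

lemma psi_add_int:
  assumes x: "prim x" and z: "z \<in> uhp"
  shows "psi x (z + of_int m) = psi (fst x, snd x + fst x * m) z"
proof -
  have nat: "psi x (z + of_nat k) = psi (fst x, snd x + fst x * int k) z" if "prim x" "z \<in> uhp" for x z k
    using that
  proof (induction k arbitrary: x)
    case (Suc k)
    have p: "prim (fst x, snd x + fst x)" using Suc.prems(1) by (auto simp: prim_def dvd_add_left_iff)
    have "psi x (z + of_nat k + 1) = psi (fst x, snd x + fst x) (z + of_nat k)"
      using Suc.prems by (intro psi_T) auto
    then show ?case using Suc.IH[OF p Suc.prems(2)] by (simp add: algebra_simps)
  qed auto
  show ?thesis
  proof (cases "m \<ge> 0")
    case True
    then show ?thesis using nat[OF x z, of "nat m"] by simp
  next
    case False
    define y where "y = (fst x, snd x + fst x * m)"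
    have y: "prim y" using x by (auto simp: prim_def y_def dvd_add_left_iff)
    have zm: "z + of_int m \<in> uhp" using z by simp
    have "psi y (z + of_int m + of_nat (nat (- m))) = psi (fst y, snd y + fst y * int (nat (- m))) (z + of_int m)"
      by (rule nat[OF y zm])
    then show ?thesis using False by (simp add: y_def)
  qed
qed

text \<open>Euclid's algorithm on the lower left entry: with \<open>q = a div c\<close> the matrix
  is \<open>T^q S\<close> times a matrix with lower left entry \<open>a mod c\<close>, and
  \<open>psi_add_int\<close> and \<open>psi_S\<close> handle the two factors.\<close>

theorem psi_SL2:
  fixes a b c d :: int
  assumes "a * d - b * c = 1" "prim x" "z \<in> uhp"
  shows "psi x ((of_int a * z + of_int b) / (of_int c * z + of_int d)) = psi (act x a b c d) z"
  using assms
proof (induction "nat \<bar>c\<bar>" arbitrary: a b c d x rule: less_induct)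
  case less
  note det = less.prems(1) and x = less.prems(2) and z = less.prems(3)
  show ?case
  proof (cases "c = 0")
    \<comment> \<open>The matrix is a translation up to sign, and \<open>psi\<close> does not see
      the sign of a point.\<close>
    case True
    then have ad: "a * d = 1" using det by simp
    then have "a = d \<and> (d = 1 \<or> d = - 1)" by (auto simp: zmult_eq_1_iff)
    then consider "a = 1" "d = 1" | "a = - 1" "d = - 1" by auto
    then show ?thesis
    proof cases
      case 1
      then show ?thesis using True psi_add_int[OF x z, of b] by (simp add: act_def algebra_simps)
    next
      case 2
      have "psi (act x a b c d) z = psi (- fst (act x a b c d), - snd (act x a b c d)) z"
        by (rule psi_uminus[symmetric]) (rule prim_act[OF det x])
      then show ?thesis using True 2 psi_add_int[OF x z, of "- b"] by (simp add: act_def algebra_simps)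
    qed
  next
    case False
    define q where "q = a div c"
    define a' where "a' = a - q * c"
    define b' where "b' = b - q * d"
    have "a' = a mod c" by (simp add: a'_def q_def minus_div_mult_eq_mod)
    then have small: "\<bar>a'\<bar> < \<bar>c\<bar>" using False by (simp add: abs_mod_less)
    have det': "(- c) * b' - (- d) * a' = 1"
      using det by (simp add: a'_def b'_def algebra_simps)
    define w where "w = (of_int (- c) * z + of_int (- d)) / (of_int a' * z + of_int b')"
    have w: "w \<in> uhp" and ne: "of_int a' * z + of_int b' \<noteq> 0"
      using moebius_uhp[OF det' z] by (simp_all add: w_def)
    have ne2: "of_int c * z + of_int d \<noteq> 0" using moebius_uhp[OF det z] by simp
    have "(of_int a * z + of_int b) / (of_int c * z + of_int d) = - 1 / w + of_int q"
    proof -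
      have a: "complex_of_int a = of_int a' + of_int q * of_int c"
        and b: "complex_of_int b = of_int b' + of_int q * of_int d"
        by (simp_all add: a'_def b'_def)
      have "of_int a * z + of_int b = (of_int a' * z + of_int b') + of_int q * (of_int c * z + of_int d)"
        unfolding a b by (simp add: algebra_simps)
      then have "(of_int a * z + of_int b) / (of_int c * z + of_int d) =
          (of_int a' * z + of_int b') / (of_int c * z + of_int d) + of_int q"
        using ne2 by (simp add: add_divide_distrib)
      moreover have "- 1 / w = (of_int a' * z + of_int b') / (of_int c * z + of_int d)"
      proof -
        have "w = - ((of_int c * z + of_int d) / (of_int a' * z + of_int b'))"
        proof -
          have "of_int (- c) * z + of_int (- d) = - (of_int c * z + of_int d)" by simp
          then show ?thesis unfolding w_def by (simp only: minus_divide_left)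
        qed
        moreover have "- 1 / (- (X / Y)) = Y / X" for X Y :: complex by simp
        ultimately show ?thesis by (simp only:)
      qed
      ultimately show ?thesis by simp
    qed
    then have "psi x ((of_int a * z + of_int b) / (of_int c * z + of_int d)) = psi (fst x, snd x + fst x * q) (- 1 / w)"
      using psi_add_int[OF x uhp_inverse[OF w], of q] by simp
    also have "\<dots> = psi (snd x + fst x * q, - fst x) w"
      using psi_S[of "(fst x, snd x + fst x * q)" w] w x by (auto simp: prim_def dvd_add_left_iff)
    also have "\<dots> = psi (act (snd x + fst x * q, - fst x) (- c) (- d) a' b') z"
      unfolding w_def using x small by (intro less.hyps det' z) (auto simp: prim_def dvd_add_left_iff)
    also have "act (snd x + fst x * q, - fst x) (- c) (- d) a' b' = (- fst (act x a b c d), - snd (act x a b c d))"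
      by (simp add: act_def a'_def b'_def algebra_simps)
    also have "psi \<dots> z = psi (act x a b c d) z"
      by (rule psi_uminus) (rule prim_act[OF det x])
    finally show ?thesis .
  qed
qed

text \<open>One representative for each point of the projective line,
  \<open>l^2 + (l - 1) + 1\<close> in all.\<close>

definition reps :: "(int \<times> int) set" where
  "reps = (\<lambda>j. (1, 24 * j)) ` {0..<int (l\<^sup>2)} \<union> ((\<lambda>j. (int l, 24 * j)) ` {1..<int l} \<union> {(0, 1)})"

lemma not_l_dvd_interval: "j \<in> {1..<int l} \<Longrightarrow> \<not> int l dvd j"
  by (auto dest: zdvd_imp_le)

lemma reps_prim: "x \<in> reps \<Longrightarrow> prim x"
  unfolding reps_def using prim_B not_l_dvd_interval by auto

lemma reps_exists:
  assumes "prim x"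
  shows "\<exists>y\<in>reps. eqv x y"
proof (cases rule: prim_cases[OF assms])
  case (1 j)
  have "eqv (1, 24 * j) (1, 24 * (j mod int (l\<^sup>2)))"
    unfolding eqv_AA by (simp flip: mod_eq_dvd_iff)
  then have "eqv x (1, 24 * (j mod int (l\<^sup>2)))" using 1 eqv_trans prim_A by blast
  moreover have "j mod int (l\<^sup>2) \<in> {0..<int (l\<^sup>2)}" using l_gt3 by simp
  ultimately show ?thesis unfolding reps_def by blast
next
  case (2 j)
  have "eqv (int l, 24 * j) (int l, 24 * (j mod int l))"
    unfolding eqv_BB by (simp flip: mod_eq_dvd_iff)
  then have "eqv x (int l, 24 * (j mod int l))" using 2 eqv_trans prim_B by blast
  moreover have "j mod int l \<noteq> 0" using 2(1) by auto
  then have "j mod int l \<in> {1..<int l}" using l_gt3 pos_mod_bound[of "int l" j] pos_mod_sign[of "int l" j]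
    by (simp del: pos_mod_sign)
  ultimately show ?thesis unfolding reps_def by blast
next
  case 3
  then show ?thesis unfolding reps_def by blast
qed

lemma reps_unique:
  assumes "x \<in> reps" "y \<in> reps" "eqv x y"
  shows "x = y"
proof -
  have A: "i = j" if "i \<in> {0..<int (l\<^sup>2)}" "j \<in> {0..<int (l\<^sup>2)}" "eqv (1, 24 * i) (1, 24 * j)" for i j
  proof -
    have "j mod int (l\<^sup>2) = i mod int (l\<^sup>2)" using that(3) by (simp only: eqv_AA mod_eq_dvd_iff)
    then show ?thesis using that by simp
  qed
  have B: "i = j" if "i \<in> {1..<int l}" "j \<in> {1..<int l}" "eqv (int l, 24 * i) (int l, 24 * j)" for i j
  proof -
    have "j mod int l = i mod int l" using that(3) by (simp only: eqv_BB mod_eq_dvd_iff)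
    then show ?thesis using that by simp
  qed
  have AB: "\<not> eqv (1, 24 * i) (int l, 24 * j)" "\<not> eqv (int l, 24 * j) (1, 24 * i)" if "j \<in> {1..<int l}" for i j
    using not_eqv_AB[OF not_l_dvd_interval[OF that]] eqv_sym by blast+
  have AC: "\<not> eqv (1, 24 * i) (0, 1)" "\<not> eqv (0, 1) (1, 24 * i)" for i
    using not_eqv_AC eqv_sym by blast+
  have BC: "\<not> eqv (int l, 24 * i) (0, 1)" "\<not> eqv (0, 1) (int l, 24 * i)" for i
    using not_eqv_BC eqv_sym by blast+
  from assms(1,2) show ?thesis
    unfolding reps_def
    by (elim UnE imageE singletonE; use assms(3) A B AB AC BC in \<open>simp; blast\<close>)
qed

text \<open>A bijection of the projective line need not preserve the chosen representatives; it is
  followed by the normalisation \<open>rep\<close>, to which \<open>g\<close> is blind.\<close>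

lemma sum_reps_reindex:
  fixes g :: "int \<times> int \<Rightarrow> complex"
  assumes g: "\<And>x y. prim x \<Longrightarrow> prim y \<Longrightarrow> eqv x y \<Longrightarrow> g x = g y"
    and s: "\<And>x. prim x \<Longrightarrow> prim (\<sigma> x)" "\<And>x y. prim x \<Longrightarrow> prim y \<Longrightarrow> eqv x y \<Longrightarrow> eqv (\<sigma> x) (\<sigma> y)"
    and t: "\<And>x. prim x \<Longrightarrow> prim (\<tau> x)" "\<And>x y. prim x \<Longrightarrow> prim y \<Longrightarrow> eqv x y \<Longrightarrow> eqv (\<tau> x) (\<tau> y)"
    and st: "\<And>x. prim x \<Longrightarrow> eqv (\<sigma> (\<tau> x)) x" "\<And>x. prim x \<Longrightarrow> eqv (\<tau> (\<sigma> x)) x"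
  shows "(\<Sum>x\<in>reps. g (\<sigma> x)) = (\<Sum>x\<in>reps. g x)"
proof -
  define rep where "rep = (\<lambda>x. SOME y. y \<in> reps \<and> eqv x y)"
  have rep: "rep x \<in> reps" "eqv x (rep x)" if "prim x" for x
  proof -
    have "rep x \<in> reps \<and> eqv x (rep x)"
      unfolding rep_def by (rule someI_ex) (use reps_exists[OF that] in blast)
    then show "rep x \<in> reps" "eqv x (rep x)" by auto
  qed
  have inv: "rep (\<beta> (rep (\<alpha> x))) = x"
    if x: "x \<in> reps" and al: "\<And>x. prim x \<Longrightarrow> prim (\<alpha> x)" 
      and be: "\<And>x. prim x \<Longrightarrow> prim (\<beta> x)" "\<And>x y. prim x \<Longrightarrow> prim y \<Longrightarrow> eqv x y \<Longrightarrow> eqv (\<beta> x) (\<beta> y)"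
      and ba: "\<And>x. prim x \<Longrightarrow> eqv (\<beta> (\<alpha> x)) x" for \<alpha> \<beta> x
  proof -
    have px: "prim x" using x by (rule reps_prim)
    have p1: "prim (\<alpha> x)" "prim (rep (\<alpha> x))" "prim (\<beta> (\<alpha> x))" "prim (\<beta> (rep (\<alpha> x)))"
      using px al be rep reps_prim by blast+
    have "eqv (\<beta> (rep (\<alpha> x))) (\<beta> (\<alpha> x))" using be(2) p1 rep(2) eqv_sym by blast
    then have "eqv (\<beta> (rep (\<alpha> x))) x" using ba[OF px] eqv_trans p1(3) by blast
    then have "eqv (rep (\<beta> (rep (\<alpha> x)))) x" using eqv_trans[OF p1(4)] rep(2)[OF p1(4)] eqv_sym by blast
    then show ?thesis using reps_unique rep(1)[OF p1(4)] x by blast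
  qed
  show ?thesis
  proof (rule sum.reindex_bij_witness[of _ "\<lambda>x. rep (\<tau> x)" "\<lambda>x. rep (\<sigma> x)"])
    fix x assume x: "x \<in> reps"
    then have px: "prim x" by (rule reps_prim)
    show "rep (\<tau> (rep (\<sigma> x))) = x" by (rule inv[OF x s(1) t st(2)])
    show "rep (\<sigma> (rep (\<tau> x))) = x" by (rule inv[OF x t(1) s st(1)])
    show "rep (\<sigma> x) \<in> reps" "rep (\<tau> x) \<in> reps" using px s t rep by blast+
    show "g (rep (\<sigma> x)) = g (\<sigma> x)" using px s(1) rep reps_prim eqv_sym by (intro g) blast+
  qed
qed

text \<open>\<open>scale p\<close> is conjugation by \<open>diag(p, 1)\<close>, which describes how \<open>\<eta>(pz)\<close> transforms.\<close>

definition scale :: "nat \<Rightarrow> int \<times> int \<Rightarrow> int \<times> int" where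
  "scale p x = (fst x, int p * snd x)"

text \<open>That this is the Hecke image of \<open>eta_quot r s p\<close> divided by
  \<open>eta_quot r s p\<close> is the content of \<open>hecke_quot_expansion\<close>. In the
  present form invariance is a matter of permuting points.\<close>

definition hecke_quot :: "int \<Rightarrow> int \<Rightarrow> nat \<Rightarrow> complex \<Rightarrow> complex" where
  "hecke_quot r s p z = (\<Sum>x\<in>reps. psi x z powi r * psi (scale p x) (of_nat p * z) powi s)"

lemma prim_scale: "\<not> int l dvd int p \<Longrightarrow> prim x \<Longrightarrow> prim (scale p x)"
  using prime_int_l by (auto simp: prim_def scale_def prime_dvd_mult_iff)

lemma eqv_scale: "eqv x y \<Longrightarrow> eqv (scale p x) (scale p y)"
proof -
  have "fst (scale p x) * snd (scale p y) - snd (scale p x) * fst (scale p y) =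
    int p * (fst x * snd y - snd x * fst y)" by (simp add: scale_def algebra_simps)
  then show "eqv x y \<Longrightarrow> eqv (scale p x) (scale p y)" unfolding eqv_def by simp
qed

text \<open>The matrix acts on \<open>p * z\<close> through its conjugate with upper right entry
  \<open>p * b\<close> and lower left entry \<open>c\<close>, which is integral because the level
  divides the original entry. \<open>scale p\<close> intertwines the two actions, so the sum is only
  permuted.\<close>

lemma hecke_quot_Gamma0:
  fixes a b c d :: int
  assumes p: "p > 0" "\<not> int l dvd int p" and det: "a * d - b * (int p * c) = 1" and z: "z \<in> uhp"
  shows "hecke_quot r s p ((of_int a * z + of_int b) / (of_int (int p * c) * z + of_int d)) = hecke_quot r s p z"
proof -
  define w where "w = (of_int a * z + of_int b) / (of_int (int p * c) * z + of_int d)"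
  define g where "g = (\<lambda>x. psi x z powi r * psi (scale p x) (of_nat p * z) powi s)"
  have pz: "of_nat p * z \<in> uhp" using p z by simp
  have det': "a * d - int p * b * c = 1" using det by (simp add: mult_ac)
  have deti: "d * a - (- b) * (- (int p * c)) = 1" using det by (simp add: mult_ac)
  have pw: "of_nat p * w = (of_int a * (of_nat p * z) + of_int (int p * b)) / (of_int c * (of_nat p * z) + of_int d)"
    by (simp add: w_def algebra_simps)
  have "hecke_quot r s p w = (\<Sum>x\<in>reps. g (act x a b (int p * c) d))"
    unfolding hecke_quot_def
  proof (rule sum.cong)
    fix x assume "x \<in> reps"
    then have x: "prim x" by (rule reps_prim)
    have "psi x w = psi (act x a b (int p * c) d) z" unfolding w_def by (rule psi_SL2[OF det x z])
    moreover have "psi (scale p x) (of_nat p * w) = psi (act (scale p x) a (int p * b) c d) (of_nat p * z)"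
      unfolding pw by (rule psi_SL2[OF det' prim_scale[OF p(2) x] pz])
    moreover have "act (scale p x) a (int p * b) c d = scale p (act x a b (int p * c) d)"
      by (simp add: act_def scale_def algebra_simps)
    ultimately show "psi x w powi r * psi (scale p x) (of_nat p * w) powi s = g (act x a b (int p * c) d)"
      by (simp add: g_def)
  qed simp
  also have "\<dots> = (\<Sum>x\<in>reps. g x)"
  proof (rule sum_reps_reindex[where \<tau> = "\<lambda>x. act x d (- b) (- (int p * c)) a"])
    fix x y assume xy: "prim x" "prim y" "eqv x y"
    have "psi x z = psi y z" by (rule psi_cong[OF xy])
    moreover have "psi (scale p x) (of_nat p * z) = psi (scale p y) (of_nat p * z)"
      using xy p by (intro psi_cong prim_scale eqv_scale)
    ultimately show "g x = g y" by (simp add: g_def)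
  next
    fix x :: "int \<times> int"
    have "act (act x d (- b) (- (int p * c)) a) a b (int p * c) d = ((a * d - b * (int p * c)) * fst x, (a * d - b * (int p * c)) * snd x)"
      "act (act x a b (int p * c) d) d (- b) (- (int p * c)) a = ((a * d - b * (int p * c)) * fst x, (a * d - b * (int p * c)) * snd x)"
      by (simp_all add: act_def algebra_simps)
    then show "eqv (act (act x d (- b) (- (int p * c)) a) a b (int p * c) d) x"
      "eqv (act (act x a b (int p * c) d) d (- b) (- (int p * c)) a) x"
      using det by simp_all
  qed (use prim_act[OF det] prim_act[OF deti] eqv_act[OF det] eqv_act[OF deti] in blast)+
  finally show ?thesis by (simp add: w_def g_def hecke_quot_def)
qed

text \<open>The map \<open>\<sigma>\<close> is the Fricke matrix acting on points. Its determinant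
  \<open>p\<close> is a unit modulo \<open>l\<close>, and its square is the scalar
  \<open>- p\<close>, so it is an involution of the projective line. The exponents trade places
  because \<open>z\<close> and \<open>p * z\<close> do.\<close>

lemma hecke_quot_fricke:
  assumes p: "p > 0" "\<not> int l dvd int p" and z: "z \<in> uhp"
  shows "hecke_quot r s p (- 1 / (of_nat p * z)) = hecke_quot s r p z"
proof -
  define w where "w = - 1 / (of_nat p * z)"
  define g where "g = (\<lambda>x. psi x z powi s * psi (scale p x) (of_nat p * z) powi r)"
  define \<sigma> where "\<sigma> = (\<lambda>x::int \<times> int. (int p * snd x, - fst x))"
  have pz: "of_nat p * z \<in> uhp" using p z by simp
  have pw: "of_nat p * w = - 1 / z" using p by (simp add: w_def)
  have prim_\<sigma>: "prim (\<sigma> x)" if "prim x" for x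
    using that p prime_int_l by (auto simp: prim_def \<sigma>_def prime_dvd_mult_iff)
  have eqv_\<sigma>: "eqv (\<sigma> x) (\<sigma> y)" if "eqv x y" for x y
  proof -
    have "fst (\<sigma> x) * snd (\<sigma> y) - snd (\<sigma> x) * fst (\<sigma> y) = int p * (fst x * snd y - snd x * fst y)"
      by (simp add: \<sigma>_def algebra_simps)
    then show ?thesis using that unfolding eqv_def by simp
  qed
  have \<sigma>\<sigma>: "eqv (\<sigma> (\<sigma> x)) x" for x by (simp add: eqv_def \<sigma>_def)
  have "hecke_quot r s p w = (\<Sum>x\<in>reps. g (\<sigma> x))"
    unfolding hecke_quot_def
  proof (rule sum.cong)
    fix x assume "x \<in> reps"
    then have x: "prim x" by (rule reps_prim)
    have px: "prim (snd x, - fst x)" using x by (auto simp: prim_def)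
    have "psi x w = psi (snd x, - fst x) (of_nat p * z)" unfolding w_def by (rule psi_S[OF x pz])
    also have "\<dots> = psi (scale p (\<sigma> x)) (of_nat p * z)"
      by (intro psi_cong px prim_scale p prim_\<sigma> x) (simp add: eqv_def scale_def \<sigma>_def)
    finally have 1: "psi x w = psi (scale p (\<sigma> x)) (of_nat p * z)" .
    have "psi (scale p x) (of_nat p * w) = psi (snd (scale p x), - fst (scale p x)) z"
      unfolding pw by (rule psi_S[OF prim_scale[OF p(2) x] z])
    also have "(snd (scale p x), - fst (scale p x)) = \<sigma> x" by (simp add: scale_def \<sigma>_def)
    finally show "psi x w powi r * psi (scale p x) (of_nat p * w) powi s = g (\<sigma> x)"
      using 1 by (simp add: g_def)
  qed simp
  also have "\<dots> = (\<Sum>x\<in>reps. g x)"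
  proof (rule sum_reps_reindex[where \<tau> = \<sigma>])
    fix x y assume xy: "prim x" "prim y" "eqv x y"
    have "psi x z = psi y z" by (rule psi_cong[OF xy])
    moreover have "psi (scale p x) (of_nat p * z) = psi (scale p y) (of_nat p * z)"
      using xy p by (intro psi_cong prim_scale eqv_scale)
    ultimately show "g x = g y" by (simp add: g_def)
  qed (use prim_\<sigma> eqv_\<sigma> \<sigma>\<sigma> in blast)+
  finally show ?thesis by (simp add: w_def g_def hecke_quot_def)
qed

end

subsection \<open>Expansions at infinity\<close>

definition euler_scaled :: "nat \<Rightarrow> rat fps" where
  "euler_scaled m = Abs_fps (\<lambda>i. if m dvd i then euler_coeff (i div m) else 0)"

lemma euler_coeff_0 [simp]: "euler_coeff 0 = 1"
proof -
  have p0: "pent 0 = 0" by (simp add: pent_def)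
  have "0 \<in> range pent" using p0 by (metis rangeI)
  moreover have "inv_into UNIV pent 0 = 0" using inv_f_f[OF inj_pent, of 0] p0 by simp
  ultimately show ?thesis by (simp add: euler_coeff_def)
qed

lemma euler_coeff_Ints: "euler_coeff n \<in> \<int>"
  by (simp add: euler_coeff_def)

lemma euler_scaled_0 [simp]: "fps_nth (euler_scaled m) 0 = 1"
  by (simp add: euler_scaled_def)

lemma euler_scaled_Z: "euler_scaled m \<in> Z_fps"
  by (simp add: euler_scaled_def Z_fps_def euler_coeff_Ints)

lemma fps_mult_agree:
  fixes A B C :: "'a :: comm_ring_1 fps"
  assumes "\<And>i. i \<le> n \<Longrightarrow> fps_nth A i = fps_nth B i" "i \<le> n"
  shows "fps_nth (A * C) i = fps_nth (B * C) i"
  unfolding fps_mult_nth using assms by (intro sum.cong) auto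

lemma fps_power_agree:
  fixes A B :: "'a :: comm_ring_1 fps"
  assumes "\<And>i. i \<le> n \<Longrightarrow> fps_nth A i = fps_nth B i" "i \<le> n"
  shows "fps_nth (A ^ k) i = fps_nth (B ^ k) i"
  using assms(2)
proof (induction k arbitrary: i)
  case (Suc k)
  have "fps_nth (A ^ Suc k) i = fps_nth (B * A ^ k) i"
    using fps_mult_agree[OF assms(1) Suc.prems, of "A ^ k"] by simp
  also have "\<dots> = fps_nth (A ^ k * B) i" by (simp add: mult.commute)
  also have "\<dots> = fps_nth (B ^ k * B) i" by (rule fps_mult_agree[OF Suc.IH Suc.prems])
  finally show ?case by (simp add: mult.commute)
qed simp

lemma fps_inverse_agree:
  fixes A B :: "'a :: field fps"
  assumes "\<And>i. i \<le> n \<Longrightarrow> fps_nth A i = fps_nth B i" "i \<le> n" "fps_nth A 0 \<noteq> 0"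
  shows "fps_nth (inverse A) i = fps_nth (inverse B) i"
proof -
  have B0: "fps_nth B 0 \<noteq> 0" using assms(1)[of 0] assms(3) by simp
  have 1: "inverse A * A = 1" "inverse B * B = 1"
    using assms(3) B0 by (simp_all add: inverse_mult_eq_1)
  have "fps_nth (A * (inverse A * inverse B)) i = fps_nth (B * (inverse A * inverse B)) i"
    by (rule fps_mult_agree[OF assms(1,2)])
  moreover have "A * (inverse A * inverse B) = inverse B" "B * (inverse A * inverse B) = inverse A"
    using 1 by (simp_all add: algebra_simps)
  ultimately show ?thesis by simp
qed

lemma fps_powi_agree:
  fixes A B :: "'a :: field fps"
  assumes "\<And>i. i \<le> n \<Longrightarrow> fps_nth A i = fps_nth B i" "i \<le> n" "fps_nth A 0 \<noteq> 0"
  shows "fps_nth (A powi e) i = fps_nth (B powi e) i"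
  unfolding power_int_def using assms by (auto intro!: fps_power_agree[of n] fps_inverse_agree[of n])

lemma fps_powi_mult:
  fixes A B :: "'a :: field fps"
  shows "(A * B) powi e = A powi e * B powi e"
  by (simp add: power_int_def power_mult_distrib fps_inverse_mult)

lemma fps_powi_nth_0:
  fixes A :: "'a :: field fps"
  assumes "fps_nth A 0 = 1"
  shows "fps_nth (A powi e) 0 = 1"
  using assms by (simp add: power_int_def fps_power_zeroth)

text \<open>The finite identity at \<open>x = fps_X ^ m\<close>: every term with
  \<open>s \<ge> 1\<close> has order above \<open>n\<close>, so product and pentagonal series agree
  up to degree \<open>n\<close>.\<close>

lemma euler_scaled_agree:
  assumes m: "m > 0" and i: "i \<le> n"
  shows "fps_nth (\<Prod>j\<in>{0<..n}. 1 - (fps_X ^ m) ^ j) i = fps_nth (euler_scaled m) i"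
proof -
  define x :: "rat fps" where "x = fps_X ^ m"
  have xk: "x ^ k = fps_X ^ (m * k)" for k by (simp add: x_def power_mult)
  define G where "G = (\<lambda>s. (- 1) ^ s * (\<Prod>j\<in>{s<..n}. 1 - x ^ j) * x ^ (s * n + s * Suc s div 2))"
  have "{..n} = insert 0 {1..n}" by auto
  then have "(\<Sum>s\<le>n. G s) = (\<Prod>j\<in>{0<..n}. 1 - x ^ j) + (\<Sum>s\<in>{1..n}. G s)" by (simp add: G_def)
  moreover have "(\<Sum>s\<le>n. G s) = (\<Sum>s\<in>{- int n..int n}. (- 1) ^ nat \<bar>s\<bar> * x ^ pent s)"
    unfolding G_def by (rule shanks_identity)
  moreover have "fps_nth (\<Sum>s\<in>{1..n}. G s) i = 0"
    unfolding fps_sum_nth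
  proof (rule sum.neutral, safe)
    fix s assume s: "s \<in> {1..n}"
    have "1 * n \<le> s * n" using s by (intro mult_right_mono) auto
    moreover have "s * Suc s div 2 \<ge> 1" using s by (cases s) (auto simp: Suc_le_eq div_greater_zero_iff)
    ultimately have "i < s * n + s * Suc s div 2" using i by linarith
    also have "\<dots> \<le> m * (s * n + s * Suc s div 2)" using m by (cases m) auto
    finally show "fps_nth (G s) i = 0"
      unfolding G_def xk by (simp only: fps_X_power_mult_right_nth if_True)
  qed
  ultimately have "fps_nth (\<Prod>j\<in>{0<..n}. 1 - x ^ j) i = fps_nth (\<Sum>s\<in>{- int n..int n}. (- 1) ^ nat \<bar>s\<bar> * x ^ pent s) i"
    by (metis add.right_neutral fps_add_nth)
  also have "\<dots> = (\<Sum>s\<in>{- int n..int n}. (- 1) ^ nat \<bar>s\<bar> * (if i = m * pent s then 1 else 0))"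
    unfolding fps_sum_nth
  proof (rule sum.cong)
    fix s :: int
    show "fps_nth ((- 1) ^ nat \<bar>s\<bar> * x ^ pent s) i = (- 1) ^ nat \<bar>s\<bar> * (if i = m * pent s then 1 else 0)"
      unfolding xk by (cases "even (nat \<bar>s\<bar>)") (simp_all add: fps_X_power_nth)
  qed simp
  also have "\<dots> = fps_nth (euler_scaled m) i"
  proof (cases "\<exists>s0. i = m * pent s0")
    case True
    then obtain s0 where s0: "i = m * pent s0" by blast
    have "pent s0 \<le> i" using m s0 by simp
    then have s0n: "s0 \<in> {- int n..int n}" using abs_le_pent[of s0] i by auto
    have eq: "i = m * pent s \<longleftrightarrow> s = s0" for s
      using m inj_pent by (auto simp: s0 inj_eq)
    have "(\<Sum>s\<in>{- int n..int n}. (- 1) ^ nat \<bar>s\<bar> * (if i = m * pent s then 1 else 0)) = ((- 1) ^ nat \<bar>s0\<bar> :: rat)"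
      unfolding eq using s0n by (simp add: if_distrib[of "\<lambda>x. _ * x"] cong: if_cong)
    then show ?thesis using m by (simp add: euler_scaled_def s0 euler_coeff_def inv_f_f[OF inj_pent])
  next
    case False
    then have "\<not> (m dvd i \<and> i div m \<in> range pent)" by (auto elim!: dvdE)
    moreover have "(\<Sum>s\<in>{- int n..int n}. (- 1) ^ nat \<bar>s\<bar> * (if i = m * pent s then 1 else 0)) = (0 :: rat)"
      using False by (intro sum.neutral) auto
    ultimately show ?thesis by (auto simp: euler_scaled_def euler_coeff_def)
  qed
  finally show ?thesis by (simp add: x_def)
qed

lemma prod_one_minus_powi:
  assumes "m > 0"
  shows "(\<Prod>j\<le>n. (1 - fps_X ^ (m * Suc j) :: rat fps) powi e) = (\<Prod>j\<in>{0<..Suc n}. 1 - (fps_X ^ m) ^ j) powi e"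
proof (induction n)
  case 0
  have "{0<..Suc 0} = {1}" by auto
  then show ?case by (simp add: power_mult)
next
  case (Suc n)
  have "{0<..Suc (Suc n)} = insert (Suc (Suc n)) {0<..Suc n}" by auto
  then have "(\<Prod>j\<in>{0<..Suc (Suc n)}. 1 - x ^ j) = (1 - x ^ Suc (Suc n)) * (\<Prod>j\<in>{0<..Suc n}. 1 - x ^ j)" for x :: "rat fps"
    by simp
  from this[of "fps_X ^ m"] have "(\<Prod>j\<in>{0<..Suc (Suc n)}. 1 - (fps_X ^ m) ^ j :: rat fps) =
    (1 - fps_X ^ (m * Suc (Suc n))) * (\<Prod>j\<in>{0<..Suc n}. 1 - (fps_X ^ m) ^ j)"
    by (simp only: power_mult)
  then show ?case using Suc by (simp only: prod.atMost_Suc fps_powi_mult mult.commute)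
qed

lemma has_prod_euler_scaled:
  assumes m: "m > 0"
  shows "(\<lambda>j. (1 - fps_X ^ (m * Suc j) :: rat fps) powi e) has_prod (euler_scaled m powi e)"
proof -
  have "(\<lambda>n. \<Prod>j\<le>n. (1 - fps_X ^ (m * Suc j) :: rat fps) powi e) \<longlonglongrightarrow> euler_scaled m powi e"
    unfolding prod_one_minus_powi[OF m]
  proof (rule tendsto_fpsI)
    fix i
    show "eventually (\<lambda>n. fps_nth ((\<Prod>j\<in>{0<..Suc n}. 1 - (fps_X ^ m) ^ j) powi e) i = fps_nth (euler_scaled m powi e) i) sequentially"
      using eventually_ge_at_top[of i]
    proof eventually_elim
      case (elim n)
      show ?case
      proof (rule fps_powi_agree[of "Suc n"])
        show "fps_nth (\<Prod>j\<in>{0<..Suc n}. 1 - (fps_X ^ m) ^ j) i = fps_nth (euler_scaled m) i" if "i \<le> Suc n" for i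
          by (rule euler_scaled_agree[OF m that])
        show "fps_nth (\<Prod>j\<in>{0<..Suc n}. 1 - (fps_X ^ m) ^ j :: rat fps) 0 \<noteq> 0"
          using euler_scaled_agree[OF m, of 0 "Suc n"] by simp
      qed (use elim in auto)
    qed
  qed
  moreover have "euler_scaled m powi e \<noteq> 0"
    using fps_powi_nth_0[of "euler_scaled m" e] by auto
  ultimately show ?thesis by (simp add: has_prod_def raw_has_prod_def)
qed

text \<open>The bridge from the formal products in the statement to the analytic function
  \<open>euler\<close>, whose expansion in powers of \<open>q ^ m\<close> is
  \<open>euler_scaled m\<close>.\<close>

theorem eta_series_eq:
  assumes "p > 0"
  shows "eta_series r s p = euler_scaled 1 powi r * euler_scaled p powi s"
  using has_prod_unique[OF has_prod_euler_scaled[OF assms, of s]]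
    has_prod_unique[OF has_prod_euler_scaled[of 1 r, OF zero_less_one]]
  unfolding eta_series_def mult_1 by simp

definition cfps :: "rat fps \<Rightarrow> complex fps" where
  "cfps F = Abs_fps (\<lambda>n. of_rat (fps_nth F n))"

lemma cfps_nth [simp]: "fps_nth (cfps F) n = of_rat (fps_nth F n)"
  by (simp add: cfps_def)

lemma cfps_1 [simp]: "cfps 1 = 1"
  by (rule fps_ext) simp

lemma cfps_mult: "cfps (F * G) = cfps F * cfps G"
  by (rule fps_ext) (simp add: fps_mult_nth of_rat_sum of_rat_mult)

lemma cfps_add: "cfps (F + G) = cfps F + cfps G"
  by (rule fps_ext) (simp add: of_rat_add)

lemma cfps_power: "cfps (F ^ k) = cfps F ^ k"
  by (induction k) (simp_all add: cfps_mult)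

lemma cfps_inverse: "fps_nth F 0 \<noteq> 0 \<Longrightarrow> cfps (inverse F) = inverse (cfps F)"
proof -
  assume "fps_nth F 0 \<noteq> 0"
  then have "cfps (inverse F) * cfps F = 1"
    by (metis cfps_mult cfps_1 inverse_mult_eq_1)
  then show ?thesis using fps_inverse_unique[of "cfps F" "cfps (inverse F)"] by (simp add: mult.commute)
qed

lemma cfps_powi: "fps_nth F 0 \<noteq> 0 \<Longrightarrow> cfps (F powi e) = cfps F powi e"
  by (simp add: power_int_def cfps_power cfps_inverse)

lemma has_fps_expansion_powi:
  fixes F :: "complex fps"
  assumes "f has_fps_expansion F" "fps_nth F 0 \<noteq> 0"
  shows "(\<lambda>z. f z powi e) has_fps_expansion F powi e"
  unfolding power_int_def using assms
  by (auto intro!: has_fps_expansion_power has_fps_expansion_inverse)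

lemma eventually_norm_less_1: "eventually (\<lambda>q::complex. norm q < 1) (nhds 0)"
  using eventually_nhds_in_open[of "ball 0 1" "0::complex"] by simp

lemma euler_scaled_sums:
  assumes m: "m > 0" and q: "norm q < 1"
  shows "(\<lambda>n. fps_nth (cfps (euler_scaled m)) n * q ^ n) sums euler (q ^ m)"
proof -
  have qm: "norm (q ^ m) < 1" 
    using q m by (simp add: norm_power power_less_one_iff)
  have inj: "inj (\<lambda>n. m * n)" using m by (auto intro: injI)
  have "((\<lambda>n. fps_nth (cfps (euler_scaled m)) n * q ^ n) \<circ> (\<lambda>n. m * n) has_sum euler (q ^ m)) UNIV"
    using euler_has_sum[OF qm] m by (simp add: o_def euler_scaled_def power_mult)
  then have "((\<lambda>n. fps_nth (cfps (euler_scaled m)) n * q ^ n) has_sum euler (q ^ m)) (range (\<lambda>n. m * n))"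
    by (simp only: has_sum_reindex[OF inj])
  then have "((\<lambda>n. fps_nth (cfps (euler_scaled m)) n * q ^ n) has_sum euler (q ^ m)) UNIV"
    by (rule has_sum_cong_neutral[THEN iffD1, rotated -1]) (auto simp: euler_scaled_def elim!: dvdE)
  then show ?thesis by (rule has_sum_imp_sums)
qed

lemma euler_scaled_expansion:
  assumes "m > 0"
  shows "(\<lambda>q. euler (q ^ m)) has_fps_expansion cfps (euler_scaled m)"
  by (rule has_fps_expansionI, rule eventually_mono[OF eventually_norm_less_1])
     (rule euler_scaled_sums[OF assms])

lemma euler_scaled_holomorphic:
  assumes "m > 0"
  shows "(\<lambda>q. euler (q ^ m)) holomorphic_on ball 0 1"
proof -
  have "(\<lambda>q. euler (q ^ m)) analytic_on ball 0 1"
    by (rule power_series_analytic[where a = "fps_nth (cfps (euler_scaled m))"])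
       (use euler_scaled_sums[OF assms] in auto)
  then show ?thesis by (rule analytic_imp_holomorphic)
qed

definition eta_quot_q :: "int \<Rightarrow> int \<Rightarrow> nat \<Rightarrow> complex \<Rightarrow> complex" where
  "eta_quot_q r s p q = euler q powi r * euler (q ^ p) powi s"

lemma euler_power_nonzero: "m > 0 \<Longrightarrow> norm q < 1 \<Longrightarrow> euler (q ^ m) \<noteq> 0"
  by (rule euler_nonzero) (simp add: norm_power power_less_one_iff)

lemma eta_quot_q_expansion:
  assumes p: "p > 0"
  shows "eta_quot_q r s p has_fps_expansion cfps (eta_series r s p)"
proof -
  have "(\<lambda>q. euler (q ^ 1) powi r * euler (q ^ p) powi s) has_fps_expansion
      cfps (euler_scaled 1) powi r * cfps (euler_scaled p) powi s"
    using p by (intro has_fps_expansion_mult has_fps_expansion_powi euler_scaled_expansion) auto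
  then show ?thesis
    unfolding eta_series_eq[OF p] eta_quot_q_def[abs_def] by (simp add: cfps_mult cfps_powi)
qed

text \<open>As \<open>euler\<close> has no zeros in the unit disc, the quotient is holomorphic
  there, so its expansion converges in the whole disc and not only near 0.\<close>

lemma eta_quot_q_sums:
  assumes p: "p > 0" and q: "norm q < 1"
  shows "(\<lambda>n. of_rat (fps_nth (eta_series r s p) n) * q ^ n) sums eta_quot_q r s p q"
proof -
  have "(\<lambda>q. euler (q ^ 1) powi r * euler (q ^ p) powi s) holomorphic_on ball 0 1"
    using p by (intro holomorphic_intros euler_scaled_holomorphic) (auto simp: euler_power_nonzero euler_nonzero)
  then have "eta_quot_q r s p holomorphic_on eball 0 1"
    unfolding eta_quot_q_def[abs_def] by (simp add: one_ereal_def)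
  from has_fps_expansion_imp_sums_complex[OF eta_quot_q_expansion[OF p] this, of q]
  show ?thesis using q by (simp add: one_ereal_def)
qed

lemma eta_quot_q_nonzero: "p > 0 \<Longrightarrow> norm q < 1 \<Longrightarrow> eta_quot_q r s p q \<noteq> 0"
  by (simp add: eta_quot_q_def euler_nonzero euler_power_nonzero)

text \<open>The coefficient of \<open>q\<^bsup>N/24\<^esup>\<close> in \<open>\<eta>(z)\<^sup>r \<eta>(pz)\<^sup>s\<close>. With this indexing the Hecke operator has no shift \<open>\<Delta>\<close>.\<close>

definition shifted_coeff :: "int \<Rightarrow> int \<Rightarrow> nat \<Rightarrow> int \<Rightarrow> rat" where
  "shifted_coeff r s p N = eta_coeff r s p (of_int (N - (r + s * int p)) / 24)"

lemma shifted_coeff_at: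
  "shifted_coeff r s p (24 * int n + (r + s * int p)) = fps_nth (eta_series r s p) n"
  by (simp add: shifted_coeff_def eta_coeff_def)

lemma shifted_coeff_eq_0:
  assumes "N \<notin> range (\<lambda>n. 24 * int n + (r + s * int p))"
  shows "shifted_coeff r s p N = 0"
proof -
  have "(of_int (N - (r + s * int p)) / 24 :: rat) \<notin> \<nat>"
  proof
    assume "(of_int (N - (r + s * int p)) / 24 :: rat) \<in> \<nat>"
    then obtain n where "(of_int (N - (r + s * int p)) / 24 :: rat) = of_nat n" by (elim Nats_cases)
    then have "(of_int (N - (r + s * int p)) :: rat) = of_int (24 * int n)" by simp
    then have "N - (r + s * int p) = 24 * int n" by (simp only: of_int_eq_iff)
    then have "N = 24 * int n + (r + s * int p)" by simp
    then show False using assms by blast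
  qed
  then show ?thesis by (simp add: shifted_coeff_def eta_coeff_def)
qed

lemma eta_quot_q_has_sum:
  assumes p: "p > 0" and q: "norm q < 1"
  shows "((\<lambda>n. of_rat (fps_nth (eta_series r s p) n) * q ^ n) has_sum eta_quot_q r s p q) UNIV"
proof (rule norm_summable_imp_has_sum)
  \<comment> \<open>Convergence at a radius strictly between \<open>norm q\<close> and 1 gives
    absolute convergence at \<open>q\<close>.\<close>
  define \<rho> where "\<rho> = (1 + norm q) / 2"
  have \<rho>: "norm q < \<rho>" "\<rho> < 1" "\<rho> > 0" using q by (auto simp: \<rho>_def field_simps add_pos_nonneg)
  have "summable (\<lambda>n. of_rat (fps_nth (eta_series r s p) n) * (complex_of_real \<rho>) ^ n)"
    using eta_quot_q_sums[OF p, of "complex_of_real \<rho>" r s] \<rho> by (auto simp: sums_iff)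
  then show "summable (\<lambda>n. norm (of_rat (fps_nth (eta_series r s p) n) * q ^ n))"
    by (rule powser_insidea) (use \<rho> in auto)
  show "(\<lambda>n. of_rat (fps_nth (eta_series r s p) n) * q ^ n) sums eta_quot_q r s p q"
    by (rule eta_quot_q_sums[OF p q])
qed

definition eta_quot :: "int \<Rightarrow> int \<Rightarrow> nat \<Rightarrow> complex \<Rightarrow> complex" where
  "eta_quot r s p z = eta z powi r * eta (of_nat p * z) powi s"

lemma eta_quot_eq_q:
  assumes p: "p > 0" and z: "z \<in> uhp"
  shows "eta_quot r s p z = ec (of_int (r + s * int p) * z / 24) * eta_quot_q r s p (ec z)"
proof -
  have pz: "of_nat p * z \<in> uhp" using p z by simp
  have e: "ec (of_nat p * z) = ec z ^ p" by (simp add: ec_power)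
  have "ec (of_int (r + s * int p) * z / 24) = ec (of_int r * (z / 24)) * ec (of_int s * (of_nat p * z / 24))"
    unfolding ec_add[symmetric] by (simp add: field_simps)
  then show ?thesis
    unfolding eta_quot_def eta_quot_q_def eta_eq_euler[OF z] eta_eq_euler[OF pz] e power_int_mult_distrib ec_powi
    by simp
qed

lemma eta_quot_has_sum:
  assumes p: "p > 0" and z: "z \<in> uhp"
  shows "((\<lambda>N. of_rat (shifted_coeff r s p N) * ec (of_int N * z / 24)) has_sum eta_quot r s p z) UNIV"
proof -
  define h where "h = (\<lambda>n::nat. 24 * int n + (r + s * int p))"
  have inj: "inj h" by (auto intro!: injI simp: h_def)
  have q: "norm (ec z) < 1" using z by (simp add: norm_ec)
  have "((\<lambda>n. ec (of_int (r + s * int p) * z / 24) * (of_rat (fps_nth (eta_series r s p) n) * ec z ^ n)) has_sum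
      ec (of_int (r + s * int p) * z / 24) * eta_quot_q r s p (ec z)) UNIV"
    by (intro has_sum_cmult_right eta_quot_q_has_sum p q)
  also have "(\<lambda>n. ec (of_int (r + s * int p) * z / 24) * (of_rat (fps_nth (eta_series r s p) n) * ec z ^ n)) =
      (\<lambda>N. of_rat (shifted_coeff r s p N) * ec (of_int N * z / 24)) \<circ> h"
  proof
    fix n
    have "ec (of_int (h n) * z / 24) = ec (of_int (r + s * int p) * z / 24) * ec z ^ n"
      unfolding ec_power ec_add[symmetric] by (simp add: h_def field_simps)
    then show "ec (of_int (r + s * int p) * z / 24) * (of_rat (fps_nth (eta_series r s p) n) * ec z ^ n) =
        ((\<lambda>N. of_rat (shifted_coeff r s p N) * ec (of_int N * z / 24)) \<circ> h) n"
      using shifted_coeff_at[of r s p n] by (simp add: h_def)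
  qed
  finally have "((\<lambda>N. of_rat (shifted_coeff r s p N) * ec (of_int N * z / 24)) has_sum eta_quot r s p z) (range h)"
    by (simp only: has_sum_reindex[OF inj] eta_quot_eq_q[OF p z])
  then show ?thesis
    by (rule has_sum_cong_neutral[THEN iffD1, rotated -1]) (auto simp: h_def shifted_coeff_eq_0)
qed

lemma powi_unit_odd:
  fixes u :: int
  assumes "u * u = 1" "odd m"
  shows "(of_int u :: 'a :: field_char_0) powi m = of_int u"
proof -
  have u: "u = 1 \<or> u = - 1" using assms(1) by (auto simp: zmult_eq_1_iff)
  then show ?thesis using assms(2) by (auto simp: power_int_minus_left)
qed

lemma powi_unit_abs:
  fixes u :: int
  assumes "u * u = 1"
  shows "(of_int u :: 'a :: field_char_0) powi m = of_int (u ^ nat \<bar>m\<bar>)"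
proof -
  have u: "u = 1 \<or> u = - 1" using assms(1) by (auto simp: zmult_eq_1_iff)
  then show ?thesis by (auto simp: power_int_minus_left minus_one_power_iff even_nat_iff)
qed

context prime_gt3
begin

lemma Legendre_1: "Legendre 1 (int l) = 1"
  using Legendre_mult[OF prime_l l_pos(2), of 1 1] Legendre_unit_square[of l 1] l_gt3 by simp

text \<open>Inversion fixes the point \<i>. Applying \<open>eta_inversion_prime\<close> there, from
  shift 1 to shift \<open>j\<close> and back, shows that the two constants have product 1, because
  \<eta> does not vanish. This evaluates the square of the Gauss sum.\<close>

lemma gauss_sum_square: "gauss_sum l * gauss_sum l = of_int (Legendre (- 1) (int l)) * of_nat l"
proof -
  have "\<not> int l dvd 24 * (24 * 1)" using l_gt3 by (simp only: l_dvd_24_mult) simp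
  then obtain j where "int l dvd 24 * (24 * 1) * j - (- 1)" using solve_mod_l by blast
  then have j: "int l dvd 576 * 1 * j + 1" "int l dvd 576 * j * 1 + 1" by simp_all
  have i: "\<i> \<in> uhp" by simp
  define K where "K = (\<lambda>j. complex_of_int (chi12 (int l) * Legendre j (int l)) * gauss_sum l / of_real (sqrt (real l)))"
  have ii: "- 1 / \<i> = \<i>" by simp
  have cs: "csqrt (- \<i> * \<i>) = 1" by simp
  have 1: "eta ((\<i> + 24 * of_int 1) / of_nat l) = K 1 * eta ((\<i> + 24 * of_int j) / of_nat l)"
    using eta_inversion_prime[OF prime_l l_gt3 j(1) i] unfolding ii cs K_def by simp
  have 2: "eta ((\<i> + 24 * of_int j) / of_nat l) = K j * eta ((\<i> + 24 * of_int 1) / of_nat l)"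
    using eta_inversion_prime[OF prime_l l_gt3 j(2) i] unfolding ii cs K_def by simp
  have ne: "eta ((\<i> + 24 * of_int 1) / of_nat l) \<noteq> 0"
    using l_gt3 by (intro eta_nonzero) (simp add: Im_divide_of_nat)
  have "eta ((\<i> + 24 * of_int 1) / of_nat l) = (K 1 * K j) * eta ((\<i> + 24 * of_int 1) / of_nat l)"
    using 1 2 by simp
  then have "K 1 * K j = 1" using ne by simp
  moreover have "complex_of_real (sqrt (real l)) * of_real (sqrt (real l)) = of_nat l"
    by (simp flip: of_real_mult)
  ultimately have "complex_of_int (chi12 (int l) * chi12 (int l) * (Legendre 1 (int l) * Legendre j (int l))) * (gauss_sum l * gauss_sum l) = of_nat l"
    using l_gt3 by (simp add: K_def field_simps)
  moreover have "Legendre 1 (int l) * Legendre j (int l) = Legendre (- 1) (int l)"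
  proof -
    have "Legendre (24 * 24 * (1 * j)) (int l) = Legendre (- 1) (int l)"
      using j by (intro Legendre_cong) (simp add: cong_iff_dvd_diff)
    then show ?thesis
      using Legendre_unit_square[OF l_not_dvd_24] by (simp only: Legendre_mult[OF prime_l l_pos(2)] Legendre_1 mult_1)
  qed
  ultimately have "complex_of_int (Legendre (- 1) (int l)) * (gauss_sum l * gauss_sum l) = of_nat l"
    using chi12_square[OF coprime_12_if_prime[OF prime_l l_gt3]] by simp
  then have "complex_of_int (Legendre (- 1) (int l) * Legendre (- 1) (int l)) * (gauss_sum l * gauss_sum l) = of_int (Legendre (- 1) (int l)) * of_nat l"
    by (simp add: mult.assoc)
  then show ?thesis using Legendre_unit_square[of l "- 1"] l_gt3 by simp
qed

lemma gauss_sum_nonzero: "gauss_sum l \<noteq> 0"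
  using gauss_sum_square Legendre_unit_square[of l "- 1"] l_gt3 by auto

text \<open>The constant produced by the points \<open>(l, 24 * j)\<close>;
  \<open>hecke_coeff_eq\<close> matches it with the symbol of \<theta> and the power of
  \<open>l\<close> in the statement.\<close>

definition hecke_const :: "int \<Rightarrow> int \<Rightarrow> nat \<Rightarrow> rat" where
  "hecke_const r s p = of_int (Legendre (int p) (int l) ^ nat \<bar>s\<bar> * chi12 (int l) *
     Legendre (- 1) (int l) ^ nat \<bar>(r + s - 1) div 2\<bar>) * of_nat l powi (- ((r + s - 1) div 2))"

text \<open>The coefficient of \<open>q^(M/24)\<close> in the Hecke image of
  \<open>eta_quot r s p\<close>. At \<open>M = 24 * n + (r + s * p)\<close> it becomes the left side
  of the congruence.\<close>

definition hecke_coeff :: "int \<Rightarrow> int \<Rightarrow> nat \<Rightarrow> int \<Rightarrow> rat" where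
  "hecke_coeff r s p M = of_nat l powi (2 - (r + s)) * shifted_coeff r s p (int (l\<^sup>2) * M) +
     hecke_const r s p * of_int (Legendre M (int l)) * shifted_coeff r s p M +
     (if int (l\<^sup>2) dvd M then shifted_coeff r s p (M div int (l\<^sup>2)) else 0)"

text \<open>As \<open>r + s\<close> is odd, the Gauss sum enters with an even exponent, so its sign is not needed.\<close>

lemma gauss_sum_powi:
  assumes "odd (r + s)"
  shows "(gauss_sum l / of_nat l) powi (r + s) * gauss_sum l =
    of_int (Legendre (- 1) (int l) ^ nat \<bar>(r + s - 1) div 2\<bar>) * of_nat l powi (- ((r + s - 1) div 2)) * of_int (Legendre (- 1) (int l))"
proof -
  define t where "t = (r + s - 1) div 2"
  have rs: "r + s = t + t + 1" using assms by (auto simp: t_def elim!: oddE)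
  define h where "h = gauss_sum l / of_nat l"
  define u where "u = Legendre (- 1) (int l)"
  have uu: "u * u = 1" unfolding u_def using Legendre_unit_square[of l "- 1"] l_gt3 by simp
  have h0: "h \<noteq> 0" using gauss_sum_nonzero l_gt3 by (simp add: h_def)
  have hh: "h * h = of_int u / of_nat l" and hg: "h * gauss_sum l = of_int u"
    using gauss_sum_square l_gt3 by (simp_all add: h_def u_def field_simps)
  have "h powi (r + s) = (h * h) powi t * h"
  proof -
    have "h powi (t + t + 1) = h powi (t + t) * h powi 1" by (rule power_int_add) (use h0 in simp)
    also have "h powi (t + t) = h powi t * h powi t" by (rule power_int_add) (use h0 in simp)
    finally show ?thesis unfolding rs power_int_mult_distrib by (simp only: power_int_1_right)
  qed
  then have "h powi (r + s) * gauss_sum l = (h * h) powi t * of_int u"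
    by (simp add: hg mult.assoc)
  also have "(h * h) powi t = of_int u powi t * of_nat l powi (- t)"
    unfolding hh power_int_divide_distrib by (simp add: power_int_minus divide_inverse)
  also have "of_int u powi t = complex_of_int (u ^ nat \<bar>t\<bar>)" by (rule powi_unit_abs[OF uu])
  finally show ?thesis by (simp add: h_def u_def t_def)
qed

lemma powi_quot_A:
  fixes X Y E D L :: complex
  assumes "E \<noteq> 0" "D \<noteq> 0" "L \<noteq> 0"
  shows "(E powi r * D powi s) * ((X / (L * E)) powi r * (Y / (L * D)) powi s) = L powi (- (r + s)) * (X powi r * Y powi s)"
proof -
  have *: "(U / (L * V)) powi m * V powi m = U powi m * L powi (- m)" if "V \<noteq> 0" for U V :: complex and m
    using that assms(3) by (simp add: power_int_divide_distrib power_int_mult_distrib power_int_minus field_simps)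
  have "L powi (- (r + s)) = L powi (- r) * L powi (- s)"
    using power_int_add[of L "- r" "- s"] assms(3) by simp
  moreover have "(E powi r * D powi s) * ((X / (L * E)) powi r * (Y / (L * D)) powi s) =
      ((X / (L * E)) powi r * E powi r) * ((Y / (L * D)) powi s * D powi s)"
    by (simp only: mult_ac)
  ultimately show ?thesis unfolding *[OF assms(1)] *[OF assms(2)] by (simp only: mult_ac)
qed

text \<open>As \<open>r + s\<close> is odd, the sign \<open>u\<close> common to both factors
  survives exactly once.\<close>

lemma powi_quot_B:
  fixes X Y E D h :: complex and u v :: int
  assumes "E \<noteq> 0" "D \<noteq> 0" "h \<noteq> 0" "u * u = 1" "v * v = 1" "odd (r + s)"
  shows "(E powi r * D powi s) * ((of_int u * h * X / E) powi r * (of_int (v * u) * h * Y / D) powi s) =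
    of_int (v ^ nat \<bar>s\<bar> * u) * h powi (r + s) * (X powi r * Y powi s)"
proof -
  have u0: "complex_of_int u \<noteq> 0" using assms(4) by auto
  have "complex_of_int u powi r * of_int u powi s = of_int u"
    using powi_unit_odd[OF assms(4,6), where 'a = complex] u0 by (simp add: power_int_add)
  moreover have "complex_of_int v powi s = of_int (v ^ nat \<bar>s\<bar>)" by (rule powi_unit_abs[OF assms(5)])
  moreover have "h powi (r + s) = h powi r * h powi s" using assms(3) by (simp add: power_int_add)
  moreover have "(E powi r * D powi s) * ((of_int u * h * X / E) powi r * (of_int (v * u) * h * Y / D) powi s) =
     (of_int v powi s * (of_int u powi r * of_int u powi s)) * (h powi r * h powi s) * (X powi r * Y powi s)"
    using assms(1,2) by (simp add: power_int_divide_distrib power_int_mult_distrib field_simps)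
  ultimately show ?thesis by simp
qed

text \<open>The three kinds of points give the three terms of \<open>hecke_coeff\<close>. Summing
  over \<open>j\<close> modulo \<open>l^2\<close> isolates the exponents divisible by
  \<open>l^2\<close>; summing over \<open>j\<close> modulo \<open>l\<close>, weighted by the
  Legendre symbol, produces the twisted term; the point \<open>(0, 1)\<close> substitutes
  \<open>l^2 * z\<close>.\<close>

theorem hecke_quot_expansion:
  assumes p: "p > 0" "\<not> int l dvd int p" and odd: "odd (r + s)" and z: "z \<in> uhp"
  shows "((\<lambda>M. of_rat (hecke_coeff r s p M) * ec (of_int M * z / 24)) has_sum
    eta_quot r s p z * hecke_quot r s p z) UNIV"
proof -
  define f where "f = eta_quot r s p"
  define c where "c = shifted_coeff r s p"
  define T where "T = (\<lambda>x. f z * (psi x z powi r * psi (scale p x) (of_nat p * z) powi s))"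
  have l0: "complex_of_nat l \<noteq> 0" using l_gt3 by simp
  have pz: "of_nat p * z \<in> uhp" using p z by simp
  note ez = eta_nonzero[OF z] and epz = eta_nonzero[OF pz]
  have fsum: "((\<lambda>N. of_rat (c N) * ec (of_int N * w / 24)) has_sum f w) UNIV" if "w \<in> uhp" for w
    unfolding f_def c_def by (rule eta_quot_has_sum[OF p(1) that])

  have TA: "T (1, 24 * j) = of_nat l powi (- (r + s)) * f ((z + 24 * of_int j) / of_nat (l\<^sup>2))" for j
  proof -
    have "psi (scale p (1, 24 * j)) (of_nat p * z) = 
        eta ((of_nat p * z + 24 * of_int (int p * j)) / of_nat (l\<^sup>2)) / (of_nat l * eta (of_nat p * z))"
      by (rule psi_A[OF _ _ pz]) (use l_gt3 in \<open>simp_all add: scale_def eqv_def prim_def mult_ac\<close>)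
    moreover have "(of_nat p * z + 24 * of_int (int p * j)) / of_nat (l\<^sup>2) = of_nat p * ((z + 24 * of_int j) / of_nat (l\<^sup>2))"
      by (simp add: algebra_simps add_divide_distrib)
    ultimately show ?thesis
      unfolding T_def f_def eta_quot_def psi_A[OF prim_A eqv_refl z]
      by (simp only: powi_quot_A[OF ez epz l0])
  qed
  have TC: "T (0, 1) = f (of_nat (l\<^sup>2) * z)"
  proof -
    have "psi (scale p (0, 1)) (of_nat p * z) = eta (of_nat (l\<^sup>2) * (of_nat p * z)) / eta (of_nat p * z)"
      by (rule psi_C) (use p in \<open>simp_all add: scale_def eqv_def prim_def\<close>)
    then show ?thesis
      unfolding T_def f_def eta_quot_def psi_C[OF prim_C eqv_refl]
      using powi_quot_A[OF ez epz, of 1 r s "eta (of_nat (l\<^sup>2) * z)" "eta (of_nat (l\<^sup>2) * (of_nat p * z))"]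
      by (simp add: mult_ac)
  qed
  define K where "K = complex_of_int (Legendre (int p) (int l) ^ nat \<bar>s\<bar> * chi12 (int l) * Legendre (- 1) (int l)) *
    (gauss_sum l / of_nat l) powi (r + s)"
  have TB: "T (int l, 24 * j) = K * (of_int (Legendre j (int l)) * f ((of_nat l * z + 24 * of_int j) / of_nat l))"
    if j: "\<not> int l dvd j" for j
  proof -
    define u where "u = chi12 (int l) * Legendre (- j) (int l)"
    define v where "v = Legendre (int p) (int l)"
    have pj: "\<not> int l dvd int p * j" using j p prime_int_l by (auto simp: prime_dvd_mult_iff)
    have Lu: "Legendre (- j) (int l) * Legendre (- j) (int l) = 1" using Legendre_unit_square[of l "- j"] j by simp
    have uu: "u * u = 1" 
      using Lu chi12_square[OF coprime_12_if_prime[OF prime_l l_gt3]] by (simp add: u_def mult_ac)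
    have vv: "v * v = 1" unfolding v_def by (rule Legendre_unit_square[OF p(2)])
    have h0: "gauss_sum l / of_nat l \<noteq> 0" using gauss_sum_nonzero l0 by simp
    have Lp: "Legendre (- (int p * j)) (int l) = v * Legendre (- j) (int l)"
      using Legendre_mult[OF prime_l l_pos(2), of "int p" "- j"] by (simp add: v_def)
    have 1: "psi (int l, 24 * j) z = of_int u * (gauss_sum l / of_nat l) * eta ((of_nat l * z + 24 * of_int j) / of_nat l) / eta z"
      using psi_B[OF prim_B[OF j] j eqv_refl z] by (simp add: u_def)
    have a1: "psi (scale p (int l, 24 * j)) (of_nat p * z) = of_int (chi12 (int l) * Legendre (- (int p * j)) (int l)) * gauss_sum l / of_nat l * 
        eta ((of_nat l * (of_nat p * z) + 24 * of_int (int p * j)) / of_nat l) / eta (of_nat p * z)"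
      by (rule psi_B[OF prim_scale[OF p(2) prim_B[OF j]] pj _ pz]) (simp add: scale_def eqv_def mult_ac)
    have a2: "(of_nat l * (of_nat p * z) + 24 * of_int (int p * j)) / of_nat l = of_nat p * ((of_nat l * z + 24 * of_int j) / of_nat l)"
      by (simp add: algebra_simps add_divide_distrib)
    have 2: "psi (scale p (int l, 24 * j)) (of_nat p * z) = of_int (v * u) * (gauss_sum l / of_nat l) *
        eta (of_nat p * ((of_nat l * z + 24 * of_int j) / of_nat l)) / eta (of_nat p * z)"
      unfolding a1 a2 Lp by (simp add: u_def)
    have "Legendre (- j) (int l) = Legendre (- 1) (int l) * Legendre j (int l)"
      using Legendre_mult[OF prime_l l_pos(2), of "- 1" j] by simp
    then have u': "u = chi12 (int l) * Legendre (- 1) (int l) * Legendre j (int l)" by (simp add: u_def)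
    show ?thesis
      unfolding T_def f_def eta_quot_def 1 2 powi_quot_B[OF ez epz h0 uu vv odd]
      by (simp add: K_def u' v_def mult_ac)
  qed

  have "f z * hecke_quot r s p z = (\<Sum>x\<in>reps. T x)"
    by (simp add: hecke_quot_def T_def sum_distrib_left)
  also have "\<dots> = (\<Sum>j\<in>{0..<int (l\<^sup>2)}. T (1, 24 * j)) + ((\<Sum>j\<in>{1..<int l}. T (int l, 24 * j)) + T (0, 1))"
  proof -
    have "(\<Sum>x\<in>reps. T x) = (\<Sum>x\<in>(\<lambda>j. (1, 24 * j)) ` {0..<int (l\<^sup>2)}. T x) +
       ((\<Sum>x\<in>(\<lambda>j. (int l, 24 * j)) ` {1..<int l}. T x) + (\<Sum>x\<in>{(0, 1)}. T x))"
      unfolding reps_def using l_gt3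
      by (subst sum.union_disjoint; (subst sum.union_disjoint)?) (auto simp: sum.union_disjoint)
    then show ?thesis by (simp add: sum.reindex inj_on_def)
  qed
  finally have split: "f z * hecke_quot r s p z = (\<Sum>j\<in>{0..<int (l\<^sup>2)}. T (1, 24 * j)) + ((\<Sum>j\<in>{1..<int l}. T (int l, 24 * j)) + T (0, 1))" .

  have sumA: "((\<lambda>M. of_nat l powi (2 - (r + s)) * (of_rat (c (int (l\<^sup>2) * M)) * ec (of_int M * z / 24))) has_sum
     (\<Sum>j\<in>{0..<int (l\<^sup>2)}. T (1, 24 * j))) UNIV"
  proof -
    have l2: "l\<^sup>2 > 0" using l_gt3 by simp
    have "((\<lambda>N. \<Sum>j\<in>{0..<int (l\<^sup>2)}. of_rat (c N) * ec (of_int N * ((z + 24 * of_int j) / of_nat (l\<^sup>2)) / 24)) has_sum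
        (\<Sum>j\<in>{0..<int (l\<^sup>2)}. f ((z + 24 * of_int j) / of_nat (l\<^sup>2)))) UNIV"
      by (intro has_sum_sum fsum) (use z l_gt3 in \<open>simp add: Im_divide_of_nat del: of_nat_power\<close>)
    also have "(\<lambda>N. \<Sum>j\<in>{0..<int (l\<^sup>2)}. of_rat (c N) * ec (of_int N * ((z + 24 * of_int j) / of_nat (l\<^sup>2)) / 24)) =
      (\<lambda>N. of_rat (c N) * ec (of_int N * z / (24 * of_nat (l\<^sup>2))) * (if int (l\<^sup>2) dvd N then of_nat (l\<^sup>2) else 0))"
    proof
      fix N
      have "ec (of_int N * ((z + 24 * of_int j) / of_nat (l\<^sup>2)) / 24) = ec (of_int N * z / (24 * of_nat (l\<^sup>2))) * eN (l\<^sup>2) (j * N)" for j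
        unfolding eN_def ec_add[symmetric] using l2 by (simp add: field_simps)
      then show "(\<Sum>j\<in>{0..<int (l\<^sup>2)}. of_rat (c N) * ec (of_int N * ((z + 24 * of_int j) / of_nat (l\<^sup>2)) / 24)) =
          of_rat (c N) * ec (of_int N * z / (24 * of_nat (l\<^sup>2))) * (if int (l\<^sup>2) dvd N then of_nat (l\<^sup>2) else 0)"
        unfolding sum_eN[OF l2, symmetric] by (simp only: sum_distrib_left mult.assoc)
    qed
    finally have "((\<lambda>N. of_rat (c N) * ec (of_int N * z / (24 * of_nat (l\<^sup>2))) * (if int (l\<^sup>2) dvd N then of_nat (l\<^sup>2) else 0)) has_sum
        (\<Sum>j\<in>{0..<int (l\<^sup>2)}. f ((z + 24 * of_int j) / of_nat (l\<^sup>2)))) (range (\<lambda>M. int (l\<^sup>2) * M))"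
      by (rule has_sum_cong_neutral[THEN iffD1, rotated -1]) (auto elim!: dvdE)
    moreover have inj: "inj (\<lambda>M. int (l\<^sup>2) * M)" using l2 by (auto intro!: injI)
    ultimately have "((\<lambda>M. of_rat (c (int (l\<^sup>2) * M)) * ec (of_int M * z / 24) * of_nat (l\<^sup>2)) has_sum
        (\<Sum>j\<in>{0..<int (l\<^sup>2)}. f ((z + 24 * of_int j) / of_nat (l\<^sup>2)))) UNIV"
      using l0 by (simp add: has_sum_reindex o_def)
    from has_sum_cmult_right[OF this, of "of_nat l powi (- (r + s))"] 
    have "((\<lambda>M. of_nat l powi (- (r + s)) * (of_rat (c (int (l\<^sup>2) * M)) * ec (of_int M * z / 24) * of_nat (l\<^sup>2))) has_sum
        (\<Sum>j\<in>{0..<int (l\<^sup>2)}. T (1, 24 * j))) UNIV"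
      by (simp only: TA sum_distrib_left)
    \<comment> \<open>The additional exponent 2 is the value \<open>l^2\<close> of the full
      character sum.\<close>
    moreover have "complex_of_nat l powi (2 - (r + s)) = of_nat l powi (- (r + s)) * of_nat (l\<^sup>2)"
    proof -
      have "2 - (r + s) = - (r + s) + 2" by simp
      then have "complex_of_nat l powi (2 - (r + s)) = of_nat l powi (- (r + s)) * of_nat l powi 2"
        using power_int_add[of "complex_of_nat l" "- (r + s)" 2] l0 by (simp only: simp_thms)
      then show ?thesis by simp
    qed
    ultimately show ?thesis by (simp add: mult_ac)
  qed

  have sumB: "((\<lambda>M. of_rat (hecke_const r s p * of_int (Legendre M (int l)) * c M) * ec (of_int M * z / 24)) has_sum
     (\<Sum>j\<in>{1..<int l}. T (int l, 24 * j))) UNIV"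
  proof -
    have "((\<lambda>N. \<Sum>j\<in>{1..<int l}. of_int (Legendre j (int l)) * (of_rat (c N) * ec (of_int N * ((of_nat l * z + 24 * of_int j) / of_nat l) / 24))) has_sum
        (\<Sum>j\<in>{1..<int l}. of_int (Legendre j (int l)) * f ((of_nat l * z + 24 * of_int j) / of_nat l))) UNIV"
      by (intro has_sum_sum has_sum_cmult_right fsum) (use z l_gt3 in \<open>simp add: Im_divide_of_nat\<close>)
    also have "(\<lambda>N. \<Sum>j\<in>{1..<int l}. of_int (Legendre j (int l)) * (of_rat (c N) * ec (of_int N * ((of_nat l * z + 24 * of_int j) / of_nat l) / 24))) =
       (\<lambda>N. of_rat (c N) * ec (of_int N * z / 24) * (of_int (Legendre N (int l)) * gauss_sum l))"
    proof
      fix N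
      have e: "ec (of_int N * ((of_nat l * z + 24 * of_int j) / of_nat l) / 24) = ec (of_int N * z / 24) * eN l (j * N)" for j
        unfolding eN_def ec_add[symmetric] using l0 by (simp add: field_simps)
      have "of_int (Legendre N (int l)) * gauss_sum l = (\<Sum>j\<in>{0..<int l}. of_int (Legendre j (int l)) * eN l (j * N))"
        by (rule sum_Legendre_eN[OF prime_l l_pos(2), symmetric])
      \<comment> \<open>The residue \<open>j = 0\<close> is missing among the points of the second
        kind, but its symbol is 0.\<close>
      also have "{0..<int l} = insert 0 {1..<int l}" using l_gt3 by auto
      also have "(\<Sum>j\<in>insert 0 {1..<int l}. of_int (Legendre j (int l)) * eN l (j * N)) =
          (\<Sum>j\<in>{1..<int l}. of_int (Legendre j (int l)) * eN l (j * N))"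
        by (simp add: Legendre_def)
      finally show "(\<Sum>j\<in>{1..<int l}. of_int (Legendre j (int l)) * (of_rat (c N) * ec (of_int N * ((of_nat l * z + 24 * of_int j) / of_nat l) / 24))) =
         of_rat (c N) * ec (of_int N * z / 24) * (of_int (Legendre N (int l)) * gauss_sum l)"
        unfolding e by (simp add: sum_distrib_left mult_ac)
    qed
    finally have S: "((\<lambda>N. of_rat (c N) * ec (of_int N * z / 24) * (of_int (Legendre N (int l)) * gauss_sum l)) has_sum
      (\<Sum>j\<in>{1..<int l}. of_int (Legendre j (int l)) * f ((of_nat l * z + 24 * of_int j) / of_nat l))) UNIV" .
    have "(\<Sum>j\<in>{1..<int l}. T (int l, 24 * j)) =
        K * (\<Sum>j\<in>{1..<int l}. of_int (Legendre j (int l)) * f ((of_nat l * z + 24 * of_int j) / of_nat l))"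
      unfolding sum_distrib_left by (rule sum.cong[OF refl TB[OF not_l_dvd_interval]])
    then have S2: "((\<lambda>N. K * (of_rat (c N) * ec (of_int N * z / 24) * (of_int (Legendre N (int l)) * gauss_sum l))) has_sum
      (\<Sum>j\<in>{1..<int l}. T (int l, 24 * j))) UNIV"
      using has_sum_cmult_right[OF S, of K] by (simp only:)
    have kg: "K * gauss_sum l = of_rat (hecke_const r s p)"
    proof -
      define u where "u = Legendre (- 1) (int l)"
      have uu: "complex_of_int u * of_int u = 1" 
        using Legendre_unit_square[of l "- 1"] l_gt3 unfolding u_def by (simp flip: of_int_mult)
      have "complex_of_nat l powi m = of_rat (of_nat l powi m)" for m
        by (simp add: power_int_def of_rat_power of_rat_inverse)
      then show ?thesis
        unfolding K_def mult.assoc[of _ "_ powi _"] gauss_sum_powi[OF odd] hecke_const_def u_def[symmetric]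
        using uu by (simp add: of_rat_mult of_rat_power mult_ac)
    qed
    have "K * (of_rat (c N) * ec (of_int N * z / 24) * (of_int (Legendre N (int l)) * gauss_sum l)) =
       of_rat (hecke_const r s p * of_int (Legendre N (int l)) * c N) * ec (of_int N * z / 24)" for N
      by (simp only: of_rat_mult of_rat_of_int_eq kg[symmetric] mult_ac)
    then show ?thesis using S2 by (simp only:)
  qed

  have sumC: "((\<lambda>M. of_rat (if int (l\<^sup>2) dvd M then c (M div int (l\<^sup>2)) else 0) * ec (of_int M * z / 24)) has_sum T (0, 1)) UNIV"
  proof -
    have l2: "int (l\<^sup>2) \<noteq> 0" using l_gt3 by simp
    have inj: "inj (\<lambda>M. int (l\<^sup>2) * M)" using l2 by (auto intro!: injI)
    have lz: "of_nat (l\<^sup>2) * z \<in> uhp" using z l_gt3 by (simp flip: of_nat_power)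
    have "((\<lambda>N. of_rat (c N) * ec (of_int N * (of_nat (l\<^sup>2) * z) / 24)) has_sum T (0, 1)) UNIV"
      unfolding TC by (rule fsum[OF lz])
    also have "(\<lambda>N. of_rat (c N) * ec (of_int N * (of_nat (l\<^sup>2) * z) / 24)) =
       (\<lambda>M. of_rat (if int (l\<^sup>2) dvd M then c (M div int (l\<^sup>2)) else 0) * ec (of_int M * z / 24)) \<circ> (\<lambda>M. int (l\<^sup>2) * M)"
      using l2 by (auto simp: fun_eq_iff mult_ac)
    finally have "((\<lambda>M. of_rat (if int (l\<^sup>2) dvd M then c (M div int (l\<^sup>2)) else 0) * ec (of_int M * z / 24)) has_sum T (0, 1)) (range (\<lambda>M. int (l\<^sup>2) * M))"
      by (simp only: has_sum_reindex[OF inj])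
    then show ?thesis
      by (rule has_sum_cong_neutral[THEN iffD1, rotated -1]) (auto elim!: dvdE)
  qed

  have lp: "complex_of_nat l powi m = of_rat (of_nat l powi m)" for m
    by (simp add: power_int_def of_rat_power of_rat_inverse)
  have "(\<lambda>M. of_rat (hecke_coeff r s p M) * ec (of_int M * z / 24)) =
    (\<lambda>M. of_nat l powi (2 - (r + s)) * (of_rat (c (int (l\<^sup>2) * M)) * ec (of_int M * z / 24)) +
      (of_rat (hecke_const r s p * of_int (Legendre M (int l)) * c M) * ec (of_int M * z / 24) +
       of_rat (if int (l\<^sup>2) dvd M then c (M div int (l\<^sup>2)) else 0) * ec (of_int M * z / 24)))"
    unfolding hecke_coeff_def c_def[symmetric] lp
    by (simp only: of_rat_add of_rat_mult distrib_right mult.assoc add.assoc)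
  then show ?thesis
    using has_sum_add[OF sumA has_sum_add[OF sumB sumC]] split by (simp add: f_def)
qed

end

subsection \<open>Functions invariant under a congruence subgroup of prime level\<close>

abbreviation at_ii_inf :: "complex filter" where "at_ii_inf \<equiv> filtercomap Im at_top"

lemma eventually_at_ii_inf: "eventually P at_ii_inf \<longleftrightarrow> (\<exists>Y. \<forall>z. Im z \<ge> Y \<longrightarrow> P z)"
  by (auto simp: eventually_filtercomap_at_top_linorder)

text \<open>On \<open>\<bar>Re z\<bar> \<le> 1/2\<close>, \<open>Im z \<le> 1/2\<close> the map \<open>z \<mapsto> - 1/z\<close> at least doubles the imaginary part.\<close>

lemma S_T_reduction:
  fixes K :: "complex \<Rightarrow> 'a"
  assumes T: "\<And>z. z \<in> uhp \<Longrightarrow> K (z + 1) = K z" and S: "\<And>z. z \<in> uhp \<Longrightarrow> K (- 1 / z) = K z"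
    and z: "z \<in> uhp"
  shows "\<exists>w. Im w \<ge> 1 / 2 \<and> \<bar>Re w\<bar> \<le> 1 / 2 \<and> K w = K z"
proof -
  have Tn: "K (z + of_nat n) = K z" if "z \<in> uhp" for z n
  proof (induction n)
    case (Suc n)
    have "K (z + of_nat n + 1) = K (z + of_nat n)" using that by (intro T) auto
    then show ?case using Suc by (simp add: add_ac)
  qed auto
  have Ti: "K (z + of_int n) = K z" if z: "z \<in> uhp" for z n
  proof (cases "n \<ge> 0")
    case True
    then show ?thesis using Tn[OF z, of "nat n"] by simp
  next
    case False
    then show ?thesis using Tn[of "z + of_int n" "nat (- n)"] z by simp
  qed
  have shift: "\<exists>w. Im w = Im z \<and> \<bar>Re w\<bar> \<le> 1 / 2 \<and> K w = K z" if "z \<in> uhp" for z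
  proof (intro exI[of _ "z + of_int (- round (Re z))"] conjI)
    show "K (z + of_int (- round (Re z))) = K z" by (rule Ti[OF that])
    show "\<bar>Re (z + of_int (- round (Re z)))\<bar> \<le> 1 / 2"
      using of_int_round_abs_le[of "Re z"] by (simp add: abs_minus_commute)
  qed simp
  have main: "\<exists>w. Im w \<ge> 1 / 2 \<and> \<bar>Re w\<bar> \<le> 1 / 2 \<and> K w = K z" if "z \<in> uhp" "Im z \<ge> (1 / 2) ^ Suc n" for n z
    using that
  proof (induction n arbitrary: z)
    case 0
    obtain w where "Im w = Im z" "\<bar>Re w\<bar> \<le> 1 / 2" "K w = K z" using shift[OF 0(1)] by blast
    then show ?case using 0(2) by (intro exI[of _ w]) auto
  next
    case (Suc n)
    obtain w where w: "Im w = Im z" "\<bar>Re w\<bar> \<le> 1 / 2" "K w = K z" using shift[OF Suc.prems(1)] by blast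
    show ?case
    proof (cases "Im z \<ge> 1 / 2")
      case True
      then show ?thesis using w by (intro exI[of _ w]) auto
    next
      case False
      have wu: "w \<in> uhp" using w Suc.prems by simp
      have "(Re w)\<^sup>2 \<le> (1 / 2)\<^sup>2" using w(2) by (simp add: abs_le_square_iff[symmetric])
      moreover have "(Im w)\<^sup>2 \<le> (1 / 2)\<^sup>2" using False w wu by (intro power_mono) auto
      ultimately have n: "(Re w)\<^sup>2 + (Im w)\<^sup>2 \<le> 1 / 2" by (simp add: power2_eq_square)
      have pos: "(Re w)\<^sup>2 + (Im w)\<^sup>2 > 0" using wu by (auto simp: sum_power2_gt_zero_iff)
      have "Im (- 1 / w) = Im w / ((Re w)\<^sup>2 + (Im w)\<^sup>2)"
        by (simp add: Im_divide)
      also have "\<dots> \<ge> 2 * Im w"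
      proof -
        have "2 * Im w * ((Re w)\<^sup>2 + (Im w)\<^sup>2) \<le> 2 * Im w * (1 / 2)" using n wu by (intro mult_left_mono) auto
        then show ?thesis using pos by (simp add: field_simps)
      qed
      finally have dbl: "2 * Im w \<le> Im (- 1 / w)" .
      then have "Im (- 1 / w) \<ge> (1 / 2) ^ Suc n" using Suc.prems(2) w(1) by simp
      moreover have "- 1 / w \<in> uhp" using wu dbl by auto
      ultimately obtain v where "Im v \<ge> 1 / 2" "\<bar>Re v\<bar> \<le> 1 / 2" "K v = K (- 1 / w)"
        using Suc.IH by blast
      then show ?thesis using S[OF wu] w(3) by auto
    qed
  qed
  obtain n where "(1 / 2 :: real) ^ n < Im z" using real_arch_pow_inv[of "Im z" "1 / 2"] z by auto
  moreover have "(1 / 2 :: real) ^ Suc n \<le> (1 / 2) ^ n" by simp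
  ultimately have "(1 / 2) ^ Suc n \<le> Im z" by linarith
  then show ?thesis by (rule main[OF z])
qed

text \<open>Values of modulus at least \<open>norm (K z0)\<close> occur only below some height, and
  by \<open>S_T_reduction\<close> they are all taken in a compact box. So a nonzero value would
  force \<open>norm (K z)\<close> to attain its maximum in the half-plane and \<open>K\<close> to be
  constant, contradicting the limit.\<close>

lemma level_one_cusp_function_eq_0:
  assumes hol: "K holomorphic_on uhp"
    and T: "\<And>z. z \<in> uhp \<Longrightarrow> K (z + 1) = K z" and S: "\<And>z. z \<in> uhp \<Longrightarrow> K (- 1 / z) = K z"
    and lim: "(K \<longlongrightarrow> 0) at_ii_inf"
    and z0: "z0 \<in> uhp"
  shows "K z0 = 0"
proof (rule ccontr)
  assume ne: "K z0 \<noteq> 0"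
  define e where "e = norm (K z0)"
  have e: "e > 0" using ne by (simp add: e_def)
  have "eventually (\<lambda>z. norm (K z) < e) at_ii_inf"
    using tendstoD[OF lim e] by (simp add: dist_norm)
  then obtain Y0 where Y0: "\<And>z. Im z \<ge> Y0 \<Longrightarrow> norm (K z) < e"
    unfolding eventually_at_ii_inf by blast
  define Y where "Y = max 1 Y0"
  have Y: "norm (K z) < e" if "Im z \<ge> Y" for z using that Y0 by (simp add: Y_def)
  define C where "C = cbox (Complex (- (1 / 2)) (1 / 2)) (Complex (1 / 2) Y)"
  have C: "z \<in> C \<longleftrightarrow> \<bar>Re z\<bar> \<le> 1 / 2 \<and> 1 / 2 \<le> Im z \<and> Im z \<le> Y" for z
    by (auto simp: C_def in_cbox_complex_iff)
  have inC: "\<exists>w\<in>C. K w = K z" if u: "z \<in> uhp" and le: "norm (K z) \<ge> e" for z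
  proof -
    obtain w where w: "Im w \<ge> 1 / 2" "\<bar>Re w\<bar> \<le> 1 / 2" "K w = K z"
      using S_T_reduction[of K z, OF T S u] by blast
    then have "Im w < Y" using Y[of w] le by force
    then show ?thesis using w C by (intro bexI[of _ w]) auto
  qed
  have "continuous_on C (\<lambda>z. norm (K z))"
    by (intro continuous_on_norm holomorphic_on_imp_continuous_on holomorphic_on_subset[OF hol])
       (use C in \<open>auto intro: less_le_trans[of 0 "1 / 2"]\<close>)
  moreover have "compact C" by (simp add: C_def)
  moreover have "C \<noteq> {}" using inC[OF z0] by (auto simp: e_def)
  ultimately obtain z1 where z1: "z1 \<in> C" "\<And>z. z \<in> C \<Longrightarrow> norm (K z) \<le> norm (K z1)"
    using continuous_attains_sup by metis
  have e1: "e \<le> norm (K z1)" using inC[OF z0] z1(2) by (metis e_def order_refl)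
  have z1u: "z1 \<in> uhp" using z1(1) C by (auto intro: less_le_trans[of 0 "1 / 2"])
  have "norm (K z) \<le> norm (K z1)" if "z \<in> uhp" for z
  proof (cases "norm (K z) \<ge> e")
    case True
    then show ?thesis using inC[OF that] z1(2) by metis
  qed (use e1 in auto)
  then have "K constant_on uhp"
    by (intro maximum_modulus_principle[OF hol open_uhp connected_uhp open_uhp order_refl z1u]) auto
  then obtain c where c: "\<And>z. z \<in> uhp \<Longrightarrow> K z = c" by (auto simp: constant_on_def)
  have "Im (\<i> * of_real Y) \<ge> Y" "\<i> * of_real Y \<in> uhp" by (auto simp: Y_def)
  then have "norm c < e" using Y c by metis
  then show False using c[OF z0] by (simp add: e_def)
qed

text \<open>\<open>V\<close> is a \<open>\<Gamma>\<^sub>0(p)\<close>-invariant function and \<open>U m z = V (- 1 / (z + m))\<close>: the matrices \<open>1\<close> and \<open>S T\<^sup>m\<close> with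
  \<open>0 \<le> m < p\<close> represent the cosets of \<open>\<Gamma>\<^sub>0(p)\<close> in \<open>SL\<^sub>2(\<int>)\<close>, and \<open>S\<close>, \<open>T\<close> permute these functions.\<close>

definition modular_family :: "nat \<Rightarrow> (complex \<Rightarrow> complex) \<Rightarrow> (int \<Rightarrow> complex \<Rightarrow> complex) \<Rightarrow> bool" where
  "modular_family p V U \<longleftrightarrow> V holomorphic_on uhp \<and> (\<forall>m. U m holomorphic_on uhp) \<and>
    (\<forall>z\<in>uhp. V (z + 1) = V z \<and> V (- 1 / z) = U 0 z \<and> U 0 (- 1 / z) = V z \<and>
      (\<forall>m. U m (z + 1) = U (m + 1) z \<and> U (m + int p) z = U m z) \<and>
      (\<forall>m m'. int p dvd m * m' + 1 \<longrightarrow> U m (- 1 / z) = U m' z))"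

lemma modular_family_const: "modular_family p (\<lambda>z. c) (\<lambda>m z. c)"
  by (simp add: modular_family_def)

lemma modular_family_add:
  "modular_family p V U \<Longrightarrow> modular_family p V' U' \<Longrightarrow> modular_family p (\<lambda>z. V z + V' z) (\<lambda>m z. U m z + U' m z)"
  unfolding modular_family_def by (auto intro!: holomorphic_intros)

lemma modular_family_mult:
  "modular_family p V U \<Longrightarrow> modular_family p V' U' \<Longrightarrow> modular_family p (\<lambda>z. V z * V' z) (\<lambda>m z. U m z * U' m z)"
  unfolding modular_family_def by (auto intro!: holomorphic_intros)

lemma modular_family_power:
  "modular_family p V U \<Longrightarrow> modular_family p (\<lambda>z. V z ^ n) (\<lambda>m z. U m z ^ n)"
  by (induction n) (simp_all add: modular_family_const modular_family_mult)

lemma modular_family_sum: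
  "(\<And>i. i \<in> I \<Longrightarrow> modular_family p (V i) (U i)) \<Longrightarrow>
    modular_family p (\<lambda>z. \<Sum>i\<in>I. V i z) (\<lambda>m z. \<Sum>i\<in>I. U i m z)"
  by (induction I rule: infinite_finite_induct) (auto simp: modular_family_const modular_family_add)

text \<open>If \<open>g\<close> is not identically 0, then \<open>f\<close> vanishes on the nonempty
  open set where \<open>g\<close> does not, hence everywhere.\<close>

lemma holomorphic_mult_eq_0:
  assumes "f holomorphic_on uhp" "g holomorphic_on uhp" "\<And>z. z \<in> uhp \<Longrightarrow> f z * g z = 0"
  shows "(\<forall>z\<in>uhp. f z = 0) \<or> (\<forall>z\<in>uhp. g z = 0)"
proof (rule disjCI)
  assume "\<not> (\<forall>z\<in>uhp. g z = 0)"
  then obtain w where w: "w \<in> uhp" "g w \<noteq> 0" by blast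
  define A where "A = {z \<in> uhp. g z \<noteq> 0}"
  have "open A"
  proof -
    have "A = uhp \<inter> g -` (- {0})" by (auto simp: A_def)
    then show ?thesis
      using continuous_open_preimage[OF holomorphic_on_imp_continuous_on[OF assms(2)] open_uhp, of "- {0}"] by auto
  qed
  show "\<forall>z\<in>uhp. f z = 0"
  proof
    fix z assume z: "z \<in> uhp"
    show "f z = 0"
    proof (rule analytic_continuation_open[of A uhp f "\<lambda>_. 0"])
      show "A \<noteq> {}" using w by (auto simp: A_def)
      show "f z = 0" if "z \<in> A" for z using that assms(3)[of z] by (auto simp: A_def)
    qed (use \<open>open A\<close> open_uhp connected_uhp assms z in \<open>auto simp: A_def\<close>)
  qed
qed

lemma holomorphic_prod_eq_0:
  assumes "finite I" "\<And>i. i \<in> I \<Longrightarrow> f i holomorphic_on uhp" "\<And>z. z \<in> uhp \<Longrightarrow> (\<Prod>i\<in>I. f i z) = 0"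
  shows "\<exists>i\<in>I. \<forall>z\<in>uhp. f i z = 0"
  using assms
proof (induction I rule: finite_induct)
  case empty
  then show ?case using empty(2)[of \<i>] by simp
next
  case (insert i I)
  have "(\<forall>z\<in>uhp. f i z = 0) \<or> (\<forall>z\<in>uhp. (\<Prod>i\<in>I. f i z) = 0)"
    by (rule holomorphic_mult_eq_0) (use insert in \<open>auto intro!: holomorphic_on_prod\<close>)
  then show ?case using insert by auto
qed

text \<open>The product of all \<open>V\<close> and \<open>U m\<close> is a level one function vanishing at the cusp, hence zero.\<close>

theorem modular_family_eq_0:
  assumes p: "prime p" and fam: "modular_family p V U"
    and V: "(V \<longlongrightarrow> L) at_ii_inf" and U: "\<And>m. (U m \<longlongrightarrow> 0) at_ii_inf"
    and z: "z \<in> uhp"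
  shows "V z = 0"
proof -
  have hV: "V holomorphic_on uhp" and hU: "U m holomorphic_on uhp" for m
    using fam by (auto simp: modular_family_def)
  have V1: "V (z + 1) = V z" and VS: "V (- 1 / z) = U 0 z" and U0: "U 0 (- 1 / z) = V z"
    and U1: "U m (z + 1) = U (m + 1) z" and Up: "U (m + int p) z = U m z"
    and US: "int p dvd m * m' + 1 \<Longrightarrow> U m (- 1 / z) = U m' z"
    if "z \<in> uhp" for z m m'
    using fam that by (auto simp: modular_family_def)
  have p1: "p > 1" using p by (rule prime_gt_1_nat)
  define K where "K = (\<lambda>z. V z * (\<Prod>m\<in>{0..<int p}. U m z))"
  have split: "{0..<int p} = insert 0 {1..<int p}" using p1 by auto
  have split': "{1..<int p + 1} = insert (int p) {1..<int p}" using p1 by auto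
  have K0: "K z = 0" if "z \<in> uhp" for z
  proof (rule level_one_cusp_function_eq_0[OF _ _ _ _ that])
    show "K holomorphic_on uhp" unfolding K_def by (intro holomorphic_intros hV hU)
    show "K (z + 1) = K z" if z: "z \<in> uhp" for z
    proof -
      have "(\<Prod>m\<in>{0..<int p}. U m (z + 1)) = (\<Prod>m\<in>{0..<int p}. U (m + 1) z)"
        using U1[OF z] by simp
      also have "\<dots> = (\<Prod>m\<in>{1..<int p + 1}. U m z)"
        by (rule prod.reindex_bij_witness[of _ "\<lambda>m. m - 1" "\<lambda>m. m + 1"]) auto
      also have "\<dots> = (\<Prod>m\<in>{0..<int p}. U m z)"
        unfolding split split' using Up[OF z, of 0] by simp
      finally show ?thesis using V1[OF z] by (simp add: K_def)
    qed
    show "K (- 1 / z) = K z" if z: "z \<in> uhp" for z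
    proof -
      have pp: "prime (int p)" using p by simp
      have ex: "\<exists>m'\<in>{1..<int p}. int p dvd m * m' + 1" if m: "m \<in> {1..<int p}" for m
      proof -
        have "\<not> int p dvd m" using m by (auto dest: zdvd_imp_le)
        then have "coprime m (int p)" using prime_imp_coprime[OF pp] coprime_commute by blast
        then obtain x where x: "[m * x = 1] (mod int p)" using cong_solve_coprime_int by blast
        define m' where "m' = (- x) mod int p"
        have "[m * m' + 1 = m * (- x) + 1] (mod int p)"
          unfolding m'_def by (intro cong_add cong_mult cong_mod_self cong_refl)
        also have "[m * (- x) + 1 = 0] (mod int p)"
          using x by (simp add: cong_iff_dvd_diff dvd_diff_commute)
        finally have d: "int p dvd m * m' + 1" by (simp add: cong_0_iff)
        have "m' \<noteq> 0" using d p1 by (auto dest: zdvd_imp_le)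
        moreover have "0 \<le> m'" "m' < int p" using p1 by (auto simp: m'_def)
        ultimately show ?thesis using d by (intro bexI[of _ m']) auto
      qed
      have uniq: "a = b" if ab: "a \<in> {1..<int p}" "b \<in> {1..<int p}" "int p dvd m * a + 1" "int p dvd m * b + 1" for a b m
      proof -
        have "int p dvd (m * a + 1) - (m * b + 1)" using ab by (intro dvd_diff)
        then have "int p dvd m * (a - b)" by (simp add: algebra_simps)
        moreover have "\<not> int p dvd m"
        proof
          assume "int p dvd m"
          then have "int p dvd 1" using ab(3) by (metis dvd_add_right_iff dvd_mult2)
          then show False using p1 by (auto dest: zdvd_imp_le)
        qed
        ultimately have "int p dvd a - b" using pp by (auto simp: prime_dvd_mult_iff)
        then have "a mod int p = b mod int p" by (simp add: mod_eq_dvd_iff)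
        then show ?thesis using ab by simp
      qed
      \<comment> \<open>\<open>iv m\<close> is \<open>- 1 / m\<close> modulo \<open>p\<close>.
        Inversion permutes the \<open>U m\<close> with \<open>m\<close> prime to \<open>p\<close> by
        this involution and exchanges \<open>V\<close> with \<open>U 0\<close>.\<close>
      define iv where "iv = (\<lambda>m. SOME m'. m' \<in> {1..<int p} \<and> int p dvd m * m' + 1)"
      have iv: "iv m \<in> {1..<int p}" "int p dvd m * iv m + 1" if "m \<in> {1..<int p}" for m
        using someI_ex[of "\<lambda>m'. m' \<in> {1..<int p} \<and> int p dvd m * m' + 1"] ex[OF that] unfolding iv_def by blast+
      have iviv: "iv (iv m) = m" if m: "m \<in> {1..<int p}" for m
        using uniq[of "iv (iv m)" m "iv m"] iv[OF m] iv[OF iv(1)[OF m]] m by (simp add: mult.commute)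
      have eqU: "U (iv m) z = U m (- 1 / z)" if "m \<in> {1..<int p}" for m
        using US[OF z iv(2)[OF that]] by simp
      have "(\<Prod>m\<in>{1..<int p}. U m (- 1 / z)) = (\<Prod>m\<in>{1..<int p}. U m z)"
        by (rule prod.reindex_bij_witness[of _ iv iv]; use eqU iviv iv(1) in blast)
      then show ?thesis
        unfolding K_def split using VS[OF z] U0[OF z] by simp
    qed
    have "(K \<longlongrightarrow> L * (\<Prod>m\<in>{0..<int p}. 0)) at_ii_inf"
      unfolding K_def by (intro tendsto_mult V tendsto_prod U)
    then show "(K \<longlongrightarrow> 0) at_ii_inf" using p1 by (simp add: split)
  qed
  have "(\<forall>z\<in>uhp. V z = 0) \<or> (\<forall>z\<in>uhp. (\<Prod>m\<in>{0..<int p}. U m z) = 0)"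
    by (rule holomorphic_mult_eq_0) (use K0 in \<open>auto simp: K_def intro!: hV hU holomorphic_on_prod\<close>)
  then show ?thesis
  proof
    assume "\<forall>z\<in>uhp. (\<Prod>m\<in>{0..<int p}. U m z) = 0"
    then obtain m where m: "\<And>w. w \<in> uhp \<Longrightarrow> U m w = 0"
      using holomorphic_prod_eq_0[of "{0..<int p}" U] hU by auto
    \<comment> \<open>If one \<open>U m\<close> vanishes identically, translations carry this to
      \<open>U 0\<close>, and inversion carries it on to \<open>V\<close>.\<close>
    have Un: "U 0 (w + of_nat n) = U (int n) w" if "w \<in> uhp" for w n
      using that
    proof (induction n arbitrary: w)
      case (Suc n)
      have "U 0 (w + 1 + of_nat n) = U (int n) (w + 1)" by (rule Suc.IH) (use Suc.prems in auto)
      also have "\<dots> = U (int n + 1) w" by (rule U1[OF Suc.prems])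
      finally show ?case by (simp add: add_ac)
    qed auto
    have Upn: "U (m + int p * int n) w = U m w" if "w \<in> uhp" for w n
    proof (induction n)
      case (Suc n)
      then show ?case using Up[OF that, of "m + int p * int n"] by (simp add: algebra_simps)
    qed auto
    define n where "n = nat (m + int p * int (nat \<bar>m\<bar>))"
    have "\<bar>m\<bar> \<le> int p * \<bar>m\<bar>" using p1 mult_right_mono[of 1 "int p" "\<bar>m\<bar>"] by simp
    then have n: "int n = m + int p * int (nat \<bar>m\<bar>)" by (simp add: n_def)
    have U00: "U 0 w = 0" if "w \<in> uhp" for w
    proof -
      have wn: "w - of_nat n \<in> uhp" using that by simp
      have "U 0 (w - of_nat n + of_nat n) = U (int n) (w - of_nat n)" by (rule Un[OF wn])
      also have "\<dots> = U m (w - of_nat n)" unfolding n by (rule Upn[OF wn])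
      finally show ?thesis using m[OF wn] by simp
    qed
    have "V (- 1 / (- 1 / z)) = U 0 (- 1 / z)"
      by (rule VS[OF uhp_inverse[OF z]])
    also have "\<dots> = 0" by (rule U00[OF uhp_inverse[OF z]])
    finally show "V z = 0" by simp
  qed (use z in auto)
qed

context prime_gt3
begin

lemma psi_holomorphic: "prim x \<Longrightarrow> psi x holomorphic_on uhp"
proof -
  assume x: "prim x"
  have comp: "(\<lambda>z. eta (g z)) holomorphic_on uhp" if "g holomorphic_on uhp" "\<And>z. z \<in> uhp \<Longrightarrow> g z \<in> uhp" for g
    by (rule holomorphic_on_compose_gen[OF that(1) eta_holomorphic, unfolded o_def]) (use that(2) in auto)
  have l0: "of_nat l \<noteq> (0::complex)" using l_gt3 by simp
  have *: "(\<lambda>z. c * eta ((a * z + b) / of_nat M) / (d * eta z)) holomorphic_on uhp"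
    if "Im b = 0" "Im a = 0" "Re a > 0" "M > 0" "d \<noteq> 0" for a b c d :: complex and M
  proof (intro holomorphic_intros eta_holomorphic comp)
    show "(a * z + b) / of_nat M \<in> uhp" if "z \<in> uhp" for z
      using that \<open>Im b = 0\<close> \<open>Im a = 0\<close> \<open>Re a > 0\<close> \<open>M > 0\<close> by (simp add: Im_divide_of_nat)
  qed (use that eta_nonzero in auto)
  show ?thesis
  proof (cases rule: prim_cases[OF x])
    case (1 j)
    have "psi x z = 1 * eta ((1 * z + 24 * of_int j) / of_nat (l\<^sup>2)) / (of_nat l * eta z)" if "z \<in> uhp" for z
      using psi_A[OF x 1 that] by simp
    moreover have "(\<lambda>z. 1 * eta ((1 * z + 24 * of_int j) / of_nat (l\<^sup>2)) / (of_nat l * eta z)) holomorphic_on uhp"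
      using l_gt3 by (intro *) auto
    ultimately show ?thesis using holomorphic_transform by force
  next
    case (2 j)
    define k where "k = of_int (chi12 (int l) * Legendre (- j) (int l)) * gauss_sum l / of_nat l"
    have "psi x z = k * eta ((of_nat l * z + 24 * of_int j) / of_nat l) / (1 * eta z)" if "z \<in> uhp" for z
      using psi_B[OF x 2 that] by (simp add: k_def)
    moreover have "(\<lambda>z. k * eta ((of_nat l * z + 24 * of_int j) / of_nat l) / (1 * eta z)) holomorphic_on uhp"
      using l_gt3 by (intro *) auto
    ultimately show ?thesis using holomorphic_transform by force
  next
    case 3
    have "psi x z = 1 * eta ((of_nat (l\<^sup>2) * z + 0) / of_nat 1) / (1 * eta z)" if "z \<in> uhp" for z
      using psi_C[OF x 3] by simp
    moreover have "(\<lambda>z. 1 * eta ((of_nat (l\<^sup>2) * z + 0) / of_nat 1) / (1 * eta z)) holomorphic_on uhp"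
      using l_gt3 by (intro *) auto
    ultimately show ?thesis using holomorphic_transform by force
  qed
qed

lemma hecke_quot_holomorphic:
  assumes p: "p > 0" "\<not> int l dvd int p"
  shows "hecke_quot r s p holomorphic_on uhp"
proof -
  have pz: "of_nat p * z \<in> uhp" if "z \<in> uhp" for z :: complex using that p by simp
  have "(\<lambda>z. psi (scale p x) (of_nat p * z)) holomorphic_on uhp" if "prim x" for x
    by (rule holomorphic_on_compose_gen[OF _ psi_holomorphic[OF prim_scale[OF p(2) that]], unfolded o_def])
       (use pz in \<open>auto intro!: holomorphic_intros\<close>)
  moreover have "psi (scale p x) (of_nat p * z) \<noteq> 0" if "prim x" "z \<in> uhp" for x z
    by (rule psi_nonzero[OF prim_scale[OF p(2) that(1)] pz[OF that(2)] gauss_sum_nonzero])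
  ultimately show ?thesis
    unfolding hecke_quot_def[abs_def]
    using psi_holomorphic psi_nonzero gauss_sum_nonzero reps_prim
    by (intro holomorphic_on_sum holomorphic_on_mult holomorphic_on_power_int) blast+
qed

text \<open>The conjugates are the values of \<open>hecke_quot r s p\<close> at
  \<open>- 1 / (z + m)\<close>. The Fricke involution rewrites them as
  \<open>hecke_quot s r p\<close> at \<open>(z + m) / p\<close>, and in this form their behaviour at
  infinity is visible.\<close>

theorem hecke_quot_modular_family:
  assumes p: "p > 0" "\<not> int l dvd int p"
  shows "modular_family p (hecke_quot r s p) (\<lambda>m z. hecke_quot s r p ((z + of_int m) / of_nat p))"
proof -
  have inv: "- 1 / z \<in> uhp" if "z \<in> uhp" for z by (rule uhp_inverse[OF that])
  have quot: "(z + of_int m) / of_nat p \<in> uhp" if "z \<in> uhp" for z :: complex and m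
    using that p by (simp add: Im_divide_of_nat)
  have U: "hecke_quot s r p ((z + of_int m) / of_nat p) = hecke_quot r s p (- 1 / (z + of_int m))" if "z \<in> uhp" for z m
    using hecke_quot_fricke[OF p quot[OF that, of m], of r s] p by simp
  have "(\<lambda>z. hecke_quot s r p ((z + of_int m) / of_nat p)) holomorphic_on uhp" for m
    by (rule holomorphic_on_compose_gen[OF _ hecke_quot_holomorphic[OF p], unfolded o_def])
       (use quot in \<open>auto intro!: holomorphic_intros\<close>)
  moreover have "hecke_quot r s p (z + 1) = hecke_quot r s p z" if "z \<in> uhp" for z r s
    using hecke_quot_Gamma0[OF p, of 1 1 1 0 z r s] that by simp
  moreover have "hecke_quot s r p ((z + of_int (m + int p)) / of_nat p) = hecke_quot s r p ((z + of_int m) / of_nat p)" if "z \<in> uhp" for z m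
  proof -
    have "(z + of_int (m + int p)) / of_nat p = (z + of_int m) / of_nat p + 1"
      using p by (simp add: field_simps)
    then show ?thesis using hecke_quot_Gamma0[OF p, of 1 1 1 0 "(z + of_int m) / of_nat p" s r] quot[OF that] by simp
  qed
  moreover have "hecke_quot r s p (- 1 / z) = hecke_quot s r p ((z + of_int 0) / of_nat p)" if "z \<in> uhp" for z
    using U[OF that, of 0] by simp
  moreover have "hecke_quot s r p ((- 1 / z + of_int 0) / of_nat p) = hecke_quot r s p z" if "z \<in> uhp" for z
    using U[OF inv[OF that], of 0] by simp
  moreover have "hecke_quot s r p ((- 1 / z + of_int m) / of_nat p) = hecke_quot s r p ((z + of_int m') / of_nat p)"
    if z: "z \<in> uhp" and mm: "int p dvd m * m' + 1" for z m m'
  proof -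
    obtain k where k: "m * m' + 1 = int p * k" using mm by auto
    define w where "w = - 1 / (z + of_int m')"
    have zm: "z + of_int m' \<in> uhp" using z by simp
    have w: "w \<in> uhp" unfolding w_def by (rule inv[OF zm])
    have zm0: "z + of_int m' \<noteq> 0" and z0: "z \<noteq> 0" using z by (auto simp: complex_eq_iff)
    \<comment> \<open>The matrix with rows \<open>(- m', - 1)\<close> and \<open>(p * k, m)\<close>
      lies in the congruence subgroup and carries \<open>S T^m'\<close> to
      \<open>S T^m S\<close>.\<close>
    have "(- m') * m - (- 1) * (int p * k) = 1" using k by (simp add: algebra_simps)
    then have "hecke_quot r s p ((of_int (- m') * w + of_int (- 1)) / (of_int (int p * k) * w + of_int m)) = hecke_quot r s p w"
      using hecke_quot_Gamma0[OF p _ w] by blast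
    moreover have "(of_int (- m') * w + of_int (- 1)) / (of_int (int p * k) * w + of_int m) = - 1 / (- 1 / z + of_int m)"
    proof -
      have e1: "(of_int (- m') * w + of_int (- 1)) = - z / (z + of_int m')"
        using zm0 by (simp add: w_def field_simps)
      have e2: "of_int (int p * k) * w + of_int m = (of_int m * z - 1) / (z + of_int m')"
        unfolding k[symmetric] using zm0 by (simp add: w_def field_simps)
      have e3: "- 1 / z + of_int m = (of_int m * z - 1) / z" using z0 by (simp add: field_simps)
      show ?thesis unfolding e1 e2 e3 using zm0 z0 by simp
    qed
    ultimately show ?thesis unfolding U[OF inv[OF z]] U[OF z] w_def by simp
  qed
  ultimately show ?thesis
    using hecke_quot_holomorphic[OF p]
    unfolding modular_family_def by (auto simp: add_ac)
qed

end

subsection \<open>The Hauptmodul\<close>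

text \<open>For the five admissible \<open>p\<close> the division is exact, and
  \<open>k * (p - 1) = 24\<close> gives \<open>phi p\<close> order exactly 1 at infinity.\<close>

definition hauptmodul_exp :: "nat \<Rightarrow> nat" where "hauptmodul_exp p = 24 div (p - 1)"

definition phi :: "nat \<Rightarrow> complex \<Rightarrow> complex" where
  "phi p z = (eta (of_nat p * z) / eta z) ^ hauptmodul_exp p"

text \<open>This is \<open>p^(k/2)\<close> times \<open>phi p\<close> at
  \<open>- 1 / (z + m)\<close>, and also the reciprocal of \<open>phi p\<close> at
  \<open>(z + m) / p\<close>. Keeping the shift in both values of \<eta> makes the behaviour under
  translation immediate.\<close>

definition phi_inv :: "nat \<Rightarrow> int \<Rightarrow> complex \<Rightarrow> complex" where
  "phi_inv p m z = (eta ((z + of_int m) / of_nat p) / eta (z + of_int m)) ^ hauptmodul_exp p"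

lemma uhp_div_shift: "p > 0 \<Longrightarrow> z \<in> uhp \<Longrightarrow> (z + of_int m) / of_nat p \<in> uhp"
  by (simp add: Im_divide_of_nat)

lemma phi_inv_eq_inverse:
  assumes "p > 0" "z \<in> uhp"
  shows "phi_inv p m z = inverse (phi p ((z + of_int m) / of_nat p))"
  using assms by (simp add: phi_inv_def phi_def power_divide)

locale genus_0_prime =
  fixes p k :: nat
  assumes p_cases: "p \<in> {2, 3, 5, 7, 13}" and k_eq: "k = 24 div (p - 1)"
begin

lemma k_facts: "k * (p - 1) = 24" "k = hauptmodul_exp p" "even k" "p > 0" "prime p" "k > 0"
  using p_cases by (auto simp: k_eq hauptmodul_exp_def)

lemma eta_shift_power:
  assumes "z \<in> uhp"
  shows "eta (z + of_int m) ^ k = ec (of_int (int k * m) / 24) * eta z ^ k"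
  unfolding eta_plus_int[OF assms] power_mult_distrib ec_power by simp

text \<open>A shift of \<open>m\<close> by \<open>p * t\<close> multiplies the two
  \<open>k\<close>-th powers by roots of unity whose exponents differ by
  \<open>k * (p - 1) * t / 24 = t\<close>, an integer.\<close>

lemma phi_inv_periodic:
  assumes z: "z \<in> uhp"
  shows "phi_inv p (m + int p * t) z = phi_inv p m z"
proof -
  have w: "(z + of_int m) / of_nat p \<in> uhp" using k_facts(4) z by (rule uhp_div_shift)
  have zm: "z + of_int m \<in> uhp" using z by simp
  have a: "(z + of_int (m + int p * t)) / of_nat p = (z + of_int m) / of_nat p + of_int t"
    using k_facts(4) by (simp add: field_simps)
  have b: "z + of_int (m + int p * t) = (z + of_int m) + of_int (int p * t)" by simp
  have "ec (of_int (int k * t) / 24) = ec (of_int (int k * (int p * t)) / 24)"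
  proof (rule ec_cong_int[where n = "- t"])
    have "int k * (int p * t) - int k * t = 24 * t"
    proof -
      have "int k * (int p - 1) = 24" using k_facts(1) k_facts(4) by (metis of_nat_mult of_nat_diff of_nat_numeral One_nat_def Suc_leI of_nat_1)
      then have "int k * (int p - 1) * t = 24 * t" by simp
      then show ?thesis by (simp add: algebra_simps)
    qed
    then have "complex_of_int (int k * (int p * t)) - of_int (int k * t) = 24 * of_int t"
      by (metis of_int_diff of_int_mult of_int_numeral)
    then show "of_int (int k * t) / 24 - of_int (int k * (int p * t)) / 24 = complex_of_int (- t)"
      by (simp add: field_simps)
  qed
  moreover have "eta ((z + of_int (m + int p * t)) / of_nat p) ^ k = ec (of_int (int k * t) / 24) * eta ((z + of_int m) / of_nat p) ^ k"
    unfolding a by (rule eta_shift_power[OF w])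
  moreover have "eta (z + of_int (m + int p * t)) ^ k = ec (of_int (int k * (int p * t)) / 24) * eta (z + of_int m) ^ k"
    unfolding b by (rule eta_shift_power[OF zm])
  ultimately show ?thesis
    unfolding phi_inv_def k_facts(2)[symmetric] power_divide by (simp only: mult_divide_mult_cancel_left_if ec_nonzero if_False)
qed

lemma phi_inv_cong:
  assumes "int p dvd m' - m" "z \<in> uhp"
  shows "phi_inv p m' z = phi_inv p m z"
proof -
  obtain t where "m' - m = int p * t" using assms(1) by auto
  then have "m' = m + int p * t" by simp
  then show ?thesis using phi_inv_periodic[OF assms(2)] by simp
qed

lemma phi_T:
  assumes z: "z \<in> uhp"
  shows "phi p (z + 1) = phi p z"
proof -
  have pz: "of_nat p * z \<in> uhp" using z k_facts(4) by simp
  have a: "of_nat p * (z + 1) = of_nat p * z + of_int (int p)" by (simp add: algebra_simps)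
  have "ec (of_int (int k * int p) / 24) = ec (of_int (int k * 1) / 24)"
  proof (rule ec_cong_int[where n = 1])
    have "k * p = 24 + k" using k_facts(1,4) by (cases p) auto
    then have "complex_of_nat (k * p) = of_nat (24 + k)" by (simp only:)
    then show "of_int (int k * int p) / 24 - of_int (int k * 1) / 24 = complex_of_int 1"
      by (simp add: field_simps)
  qed
  moreover have "eta (of_nat p * (z + 1)) ^ k = ec (of_int (int k * int p) / 24) * eta (of_nat p * z) ^ k"
    unfolding a by (rule eta_shift_power[OF pz])
  moreover have "eta (z + 1) ^ k = ec (of_int (int k * 1) / 24) * eta z ^ k"
    using eta_shift_power[OF z, of 1] by (simp only: of_int_1)
  ultimately show ?thesis
    unfolding phi_def k_facts(2)[symmetric] power_divide by (simp only: mult_divide_mult_cancel_left_if ec_nonzero if_False)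
qed

lemma sqrt_power_k: "complex_of_real (sqrt (real p)) ^ k = of_nat p ^ (k div 2)"
proof -
  have "k = 2 * (k div 2)" using k_facts(3) by simp
  then have "complex_of_real (sqrt (real p)) ^ k = (complex_of_real (sqrt (real p)) ^ 2) ^ (k div 2)"
    by (metis power_mult)
  also have "complex_of_real (sqrt (real p)) ^ 2 = of_nat p"
    by (simp flip: of_real_power)
  finally show ?thesis .
qed

text \<open>In each of the \<open>k\<close> factors the numerator is inverted at
  \<open>z / p\<close> instead of \<open>z\<close>, which brings a square root of \<open>p\<close>
  into the denominator. This is the origin of the modulus \<open>p^(k/2)\<close>.\<close>

lemma phi_S:
  assumes z: "z \<in> uhp"
  shows "of_nat p ^ (k div 2) * phi p (- 1 / z) = phi_inv p 0 z"
proof -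
  have p0: "complex_of_nat p \<noteq> 0" using k_facts(4) by simp
  have zp: "z / of_nat p \<in> uhp" using uhp_div_shift[OF k_facts(4) z, of 0] by simp
  have c0: "csqrt (- \<i> * z) \<noteq> 0" using z by auto
  have "eta (of_nat p * (- 1 / z)) = eta (- 1 / (z / of_nat p))" by simp
  also have "\<dots> = csqrt (- \<i> * (z / of_nat p)) * eta (z / of_nat p)" by (rule eta_inversion[OF zp])
  also have "csqrt (- \<i> * (z / of_nat p)) = csqrt (- \<i> * z) / of_real (sqrt (real p))"
    by (rule csqrt_divide_of_nat[OF k_facts(4) z])
  finally have "phi p (- 1 / z) = (eta (z / of_nat p) / eta z / of_real (sqrt (real p))) ^ k"
    unfolding phi_def eta_inversion[OF z] k_facts(2)[symmetric] using c0 by (simp add: mult.commute)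
  also have "\<dots> = phi_inv p 0 z / of_nat p ^ (k div 2)"
    unfolding power_divide[of _ "of_real (sqrt (real p))"] sqrt_power_k by (simp add: phi_inv_def k_facts(2))
  finally show ?thesis using p0 by simp
qed

lemma phi_inv_S0:
  assumes z: "z \<in> uhp"
  shows "phi_inv p 0 (- 1 / z) = of_nat p ^ (k div 2) * phi p z"
  using phi_S[OF uhp_inverse[OF z]] by simp

lemma k_cases: "(p = 2 \<and> k = 24) \<or> (p = 3 \<and> k = 12) \<or> (p = 5 \<and> k = 6) \<or> (p = 7 \<and> k = 4) \<or> (p = 13 \<and> k = 2)"
  using p_cases k_eq by auto

lemma power_even_csqrt: "csqrt w ^ k = w ^ (k div 2)"
proof -
  have "k = 2 * (k div 2)" using k_facts(3) by simp
  then have "csqrt w ^ k = (csqrt w ^ 2) ^ (k div 2)" by (metis power_mult)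
  then show ?thesis by simp
qed

text \<open>For \<open>p \<in> {2, 3}\<close> the number \<open>24\<close> is not invertible modulo \<open>p\<close>, so the theta formulas do not
  apply; instead \<open>(1 - 1/z)/p = S T\<^bsup>-p\<^esup> S ((z - 1)/p)\<close> is used.\<close>

lemma phi_inv_S_1:
  assumes z: "z \<in> uhp" and p23: "p = 2 \<or> p = 3"
  shows "phi_inv p 1 (- 1 / z) = phi_inv p (- 1) z"
proof -
  define w where "w = (z + of_int (- 1)) / of_nat p"
  have w: "w \<in> uhp" unfolding w_def by (rule uhp_div_shift[OF k_facts(4) z])
  have z': "z = of_nat p * w + 1" using k_facts(4) by (simp add: w_def)
  have w0: "w \<noteq> 0" and z0: "z \<noteq> 0" using w z by (auto simp: complex_eq_iff)
  define u where "u = - 1 / w + of_int (- int p)"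
  have u: "u \<in> uhp" using uhp_inverse[OF w] by (simp add: u_def)
  \<comment> \<open>The automorphy factors of the two inversions multiply to \<open>z\<close>. As
    \<open>k\<close> is even, only their \<open>k / 2\<close>-th powers occur, and no branches of
    the square root have to be compared.\<close>
  have uw: "- \<i> * u * (- \<i> * w) = z" using w0 by (simp add: u_def z' field_simps)
  have pw: "(- \<i> * u) ^ (k div 2) * (- \<i> * w) ^ (k div 2) = z ^ (k div 2)"
    unfolding power_mult_distrib[symmetric] uw ..
  have u0: "u \<noteq> 0" using u by (auto simp: complex_eq_iff)
  have uz: "u = - (z / w)" using w0 by (simp add: u_def z' field_simps)
  have "(- 1 / z + of_int 1) / of_nat p = - 1 / u"
  proof -
    have zw: "z - 1 = of_nat p * w" using k_facts(4) by (simp add: w_def)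
    have "- 1 / z + of_int 1 = of_nat p * w / z" unfolding zw[symmetric] using z0 by (simp add: field_simps)
    then show ?thesis unfolding uz using k_facts(4) by simp
  qed
  then have "eta ((- 1 / z + of_int 1) / of_nat p) ^ k = (- \<i> * u) ^ (k div 2) * eta u ^ k"
    by (simp only: eta_inversion[OF u] power_mult_distrib power_even_csqrt)
  also have "eta u ^ k = ec (of_int (int k * (- int p)) / 24) * ((- \<i> * w) ^ (k div 2) * eta w ^ k)"
    unfolding u_def eta_shift_power[OF uhp_inverse[OF w]] by (simp only: eta_inversion[OF w] power_mult_distrib power_even_csqrt)
  finally have 1: "eta ((- 1 / z + of_int 1) / of_nat p) ^ k = z ^ (k div 2) * ec (of_int (int k * (- int p)) / 24) * eta w ^ k"
    by (simp only: pw[symmetric] mult_ac)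
  have 2: "eta (- 1 / z + of_int 1) ^ k = ec (of_int (int k * 1) / 24) * ((- \<i> * z) ^ (k div 2) * eta z ^ k)"
    unfolding eta_shift_power[OF uhp_inverse[OF z]] by (simp only: eta_inversion[OF z] power_mult_distrib power_even_csqrt)
  have 3: "eta (z + of_int (- 1)) ^ k = ec (of_int (int k * (- 1)) / 24) * eta z ^ k"
    by (rule eta_shift_power[OF z])
  \<comment> \<open>The roots of unity left over are compared for the two pairs
    \<open>p = 2\<close>, \<open>k = 24\<close> and \<open>p = 3\<close>,
    \<open>k = 12\<close>.\<close>
  have const: "ec (of_int (int k * (- int p)) / 24) * ec (of_int (int k * (- 1)) / 24) = ec (of_int (int k * 1) / 24) * (- \<i>) ^ (k div 2)"
  proof -
    have h: "ec (1 / 2) = - 1" by (simp add: ec_def)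
    have i6: "(- \<i>) ^ 6 = - 1" "(- \<i>) ^ 12 = 1" by (simp_all add: eval_nat_numeral)
    from p23 k_cases have "(p = 2 \<and> k = 24) \<or> (p = 3 \<and> k = 12)" by auto
    then show ?thesis
    proof
      assume a: "p = 2 \<and> k = 24"
      have "ec (- 2) = 1" "ec (- 1) = 1" "ec 1 = 1" using ec_int[of "- 2"] ec_int[of "- 1"] ec_int[of 1] by simp_all
      then show ?thesis using a i6 by simp
    next
      assume a: "p = 3 \<and> k = 12"
      have "ec (- 3 / 2) = ec (1 / 2)" "ec (- 1 / 2) = ec (1 / 2)"
        by (rule ec_cong_int[where n = "- 2"], simp) (rule ec_cong_int[where n = "- 1"], simp)
      then show ?thesis using a i6 h by simp
    qed
  qed
  have nz: "eta z \<noteq> 0" "z ^ (k div 2) \<noteq> 0"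
    using eta_nonzero[OF z] z0 by auto
  have nz3: "(- \<i> * z) ^ (k div 2) = (- \<i>) ^ (k div 2) * z ^ (k div 2)" by (rule power_mult_distrib)
  have "phi_inv p 1 (- 1 / z) = z ^ (k div 2) * ec (of_int (int k * (- int p)) / 24) * eta w ^ k /
      (ec (of_int (int k * 1) / 24) * ((- \<i> * z) ^ (k div 2) * eta z ^ k))"
    unfolding phi_inv_def k_facts(2)[symmetric] power_divide 1 2 ..
  also have "\<dots> = (ec (of_int (int k * (- int p)) / 24) / (ec (of_int (int k * 1) / 24) * (- \<i>) ^ (k div 2))) * (eta w ^ k / eta z ^ k)"
    unfolding nz3 using nz z0 by (simp add: field_simps)
  also have "\<dots> = (1 / ec (of_int (int k * (- 1)) / 24)) * (eta w ^ k / eta z ^ k)"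
    unfolding const[symmetric] by simp
  also have "\<dots> = phi_inv p (- 1) z"
    unfolding phi_inv_def k_facts(2)[symmetric] power_divide 3 w_def[symmetric] by simp
  finally show ?thesis .
qed

lemma phi_inv_S:
  assumes z: "z \<in> uhp" and mm: "int p dvd m * m' + 1"
  shows "phi_inv p m (- 1 / z) = phi_inv p m' z"
proof (cases "p = 2 \<or> p = 3")
  case True
  \<comment> \<open>Modulo 2 or 3, \<open>m * m' = - 1\<close> forces \<open>m\<close> and
    \<open>m'\<close> to be 1 and -1 in some order.\<close>
  have m: "(int p dvd m - 1 \<and> int p dvd m' - (- 1)) \<or> (int p dvd m - (- 1) \<and> int p dvd m' - 1)"
  proof -
    have "[m * m' + 1 = (m mod int p) * (m' mod int p) + 1] (mod int p)"
      by (intro cong_add cong_mult cong_refl) (auto simp: Cong.cong_def)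
    then have d: "int p dvd (m mod int p) * (m' mod int p) + 1" using mm by (simp add: cong_dvd_iff)
    show ?thesis
    proof (cases "p = 2")
      case True
      have "odd m" "odd m'" using mm True by auto
      then show ?thesis using True by auto
    next
      case False
      then have p3: "p = 3" using \<open>p = 2 \<or> p = 3\<close> by simp
      have "m mod 3 \<in> {0, 1, 2}" for m :: int unfolding insert_iff empty_iff by presburger
      from this[of m] this[of m']
      have "(m mod 3 = 1 \<and> m' mod 3 = 2) \<or> (m mod 3 = 2 \<and> m' mod 3 = 1)"
        using d p3 by auto
      then show ?thesis unfolding p3 by (simp; presburger)
    qed
  qed
  then show ?thesis
  proof
    assume m: "int p dvd m - 1 \<and> int p dvd m' - (- 1)"
    have "phi_inv p m (- 1 / z) = phi_inv p 1 (- 1 / z)" by (rule phi_inv_cong) (use m uhp_inverse[OF z] in auto)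
    also have "\<dots> = phi_inv p (- 1) z" by (rule phi_inv_S_1[OF z True])
    also have "\<dots> = phi_inv p m' z" by (rule phi_inv_cong[symmetric]) (use m z in auto)
    finally show ?thesis .
  next
    assume m: "int p dvd m - (- 1) \<and> int p dvd m' - 1"
    have "phi_inv p m (- 1 / z) = phi_inv p (- 1) (- 1 / z)" by (rule phi_inv_cong) (use m uhp_inverse[OF z] in auto)
    also have "\<dots> = phi_inv p 1 (- 1 / (- 1 / z))" by (rule phi_inv_S_1[OF uhp_inverse[OF z] True, symmetric])
    also have "\<dots> = phi_inv p 1 z" by simp
    also have "\<dots> = phi_inv p m' z" by (rule phi_inv_cong[symmetric]) (use m z in auto)
    finally show ?thesis .
  qed
next
  case False
  then have p5: "(p = 5 \<and> k = 6) \<or> (p = 7 \<and> k = 4) \<or> (p = 13 \<and> k = 2)" using k_cases by auto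
  interpret P: prime_gt3 p using p5 by unfold_locales auto
  have pp: "prime (int p)" using k_facts(5) by simp
  \<comment> \<open>As 24 is invertible modulo \<open>p\<close>, the shifts may be taken as
    multiples of 24, to which \<open>eta_inversion_prime\<close> at level \<open>p\<close>
    applies.\<close>
  obtain a where a: "int p dvd 24 * a - m" using P.solve_mod_l[OF P.l_not_dvd_24] by blast
  obtain a' where a': "int p dvd 24 * a' - m'" using P.solve_mod_l[OF P.l_not_dvd_24] by blast
  have aa: "int p dvd 576 * a * a' + 1"
  proof -
    have "[24 * a * (24 * a') + 1 = m * m' + 1] (mod int p)"
      using a a' by (intro cong_add cong_mult cong_refl) (auto simp: cong_iff_dvd_diff)
    then have "int p dvd 24 * a * (24 * a') + 1" using mm by (simp add: cong_dvd_iff)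
    then show ?thesis by (simp add: mult_ac)
  qed
  have zi: "- 1 / z \<in> uhp" by (rule uhp_inverse[OF z])
  have c0: "csqrt (- \<i> * z) \<noteq> 0" using z by auto
  define \<kappa> where "\<kappa> = of_int (chi12 (int p) * Legendre a (int p)) * gauss_sum p / of_real (sqrt (real p))"
  have na: "\<not> int p dvd a" using not_dvd_if_inverse[OF k_facts(5) aa] by blast
  have per: "eta (w + of_int (24 * b)) ^ k = eta w ^ k" if "w \<in> uhp" for w b
  proof -
    have "of_int (int k * (24 * b)) / 24 = complex_of_int (int k * b)" by simp
    then show ?thesis unfolding eta_shift_power[OF that] by (simp only: ec_int mult_1)
  qed
  \<comment> \<open>\<open>\<kappa> ^ 2\<close> is the Legendre symbol of -1. It equals 1 for
    \<open>p = 5\<close> and \<open>p = 13\<close>, and for \<open>p = 7\<close> its sign disappears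
    because \<open>k / 2\<close> is even.\<close>
  have "\<kappa> ^ k = 1"
  proof -
    have sp: "complex_of_real (sqrt (real p)) * of_real (sqrt (real p)) = of_nat p" by (simp flip: of_real_mult)
    have "\<kappa> * \<kappa> = of_int ((chi12 (int p) * chi12 (int p)) * (Legendre a (int p) * Legendre a (int p))) * (gauss_sum p * gauss_sum p) / of_nat p"
      unfolding \<kappa>_def sp[symmetric] by simp
    also have "\<dots> = of_int (Legendre (- 1) (int p))"
      unfolding chi12_square[OF coprime_12_if_prime[OF P.prime_l P.l_gt3]] Legendre_unit_square[OF na] P.gauss_sum_square
      using k_facts(4) by simp
    finally have kk: "\<kappa> ^ 2 = of_int (Legendre (- 1) (int p))" by (simp add: power2_eq_square)
    have "\<kappa> ^ k = (\<kappa> ^ 2) ^ (k div 2)" using k_facts(3) by (simp flip: power_mult)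
    also have "\<dots> = of_int (Legendre (- 1) (int p) ^ (k div 2))" by (simp add: kk)
    also have "Legendre (- 1) (int p) ^ (k div 2) = 1"
      using p5
    proof (elim disjE)
      assume c: "p = 5 \<and> k = 6"
      have "QuadRes 5 (- 1)" unfolding QuadRes_def by (intro exI[of _ 2]) (simp add: cong_iff_dvd_diff)
      then show ?thesis using c by (simp add: Legendre_def cong_0_iff)
    next
      assume c: "p = 7 \<and> k = 4"
      then show ?thesis by (auto simp: Legendre_def cong_0_iff)
    next
      assume c: "p = 13 \<and> k = 2"
      have "QuadRes 13 (- 1)" unfolding QuadRes_def by (intro exI[of _ 5]) (simp add: cong_iff_dvd_diff)
      then show ?thesis using c by (simp add: Legendre_def cong_0_iff)
    qed
    finally show ?thesis by simp
  qed
  have "phi_inv p m (- 1 / z) = phi_inv p (24 * a) (- 1 / z)"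
    by (rule phi_inv_cong) (use a zi in \<open>auto simp: dvd_diff_commute\<close>)
  also have "\<dots> = eta ((- 1 / z + 24 * of_int a) / of_nat p) ^ k / eta (- 1 / z) ^ k"
    using per[OF zi, of a] by (simp add: phi_inv_def k_facts(2) power_divide)
  also have "\<dots> = (csqrt (- \<i> * z) * \<kappa> * eta ((z + 24 * of_int a') / of_nat p)) ^ k / (csqrt (- \<i> * z) * eta z) ^ k"
    unfolding eta_inversion_prime[OF P.prime_l P.l_gt3 aa z] eta_inversion[OF z] \<kappa>_def ..
  also have "\<dots> = eta ((z + 24 * of_int a') / of_nat p) ^ k / eta z ^ k"
    using c0 \<open>\<kappa> ^ k = 1\<close> by (simp add: power_mult_distrib)
  also have "\<dots> = phi_inv p (24 * a') z"
    using per[OF z, of a'] by (simp add: phi_inv_def k_facts(2) power_divide)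
  also have "\<dots> = phi_inv p m' z"
    by (rule phi_inv_cong) (use a' z in auto)
  finally show ?thesis .
qed

lemma phi_holomorphic: "phi p holomorphic_on uhp"
proof -
  have "(\<lambda>z. eta (of_nat p * z)) holomorphic_on uhp"
    by (rule holomorphic_on_compose_gen[OF _ eta_holomorphic, unfolded o_def])
       (use k_facts(4) in \<open>auto intro!: holomorphic_intros\<close>)
  then show ?thesis
    unfolding phi_def[abs_def] by (intro holomorphic_intros eta_holomorphic) (auto simp: eta_nonzero)
qed

lemma phi_nonzero: "z \<in> uhp \<Longrightarrow> phi p z \<noteq> 0"
  using k_facts(4) by (simp add: phi_def eta_nonzero)

text \<open>The factor \<open>p^(k/2)\<close> is placed at infinity: the conjugates are then
  reciprocals of values of \<open>phi p\<close> without powers of \<open>p\<close>, so principal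
  parts at the cusp 0 can be matched over the \<open>p\<close>-integral numbers.\<close>

theorem phi_modular_family: "modular_family p (\<lambda>z. of_nat p ^ (k div 2) * phi p z) (phi_inv p)"
proof -
  have "phi_inv p m holomorphic_on uhp" for m
  proof -
    have "(\<lambda>z. inverse (phi p ((z + of_int m) / of_nat p))) holomorphic_on uhp"
      by (intro holomorphic_intros holomorphic_on_compose_gen[OF _ phi_holomorphic, unfolded o_def])
         (use uhp_div_shift[OF k_facts(4)] phi_nonzero in \<open>auto intro!: holomorphic_intros\<close>)
    then show ?thesis
      by (rule holomorphic_transform) (use phi_inv_eq_inverse[OF k_facts(4)] in auto)
  qed
  moreover have "phi_inv p m (z + 1) = phi_inv p (m + 1) z" for m z
    by (simp add: phi_inv_def add_ac)
  moreover have "phi_inv p (m + int p) z = phi_inv p m z" if "z \<in> uhp" for m z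
    using phi_inv_periodic[OF that, of m 1] by simp
  ultimately show ?thesis
    unfolding modular_family_def
    using phi_holomorphic phi_T phi_S phi_inv_S0 phi_inv_S by (auto intro!: holomorphic_intros)
qed

end

subsection \<open>Congruences\<close>

text \<open>The reduced denominator divides every other one, so any representation with denominator
  prime to \<open>p\<close> suffices; closure under ring operations is then easy to check.\<close>

lemma p_integral_iff:
  assumes p: "prime p"
  shows "x \<in> p_integral p \<longleftrightarrow> (\<exists>a b. \<not> int p dvd b \<and> x = of_int a / of_int b)"
proof
  assume x: "x \<in> p_integral p"
  obtain a b where ab: "quotient_of x = (a, b)" by force
  then have "x = of_int a / of_int b" by (rule quotient_of_div)
  then show "\<exists>a b. \<not> int p dvd b \<and> x = of_int a / of_int b"
    using x ab by (auto simp: p_integral_def)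
next
  assume "\<exists>a b. \<not> int p dvd b \<and> x = of_int a / of_int b"
  then obtain a b where b: "\<not> int p dvd b" and x: "x = of_int a / of_int b" by blast
  obtain c d where cd: "quotient_of x = (c, d)" by force
  have x': "x = of_int c / of_int d" using cd by (rule quotient_of_div)
  have d: "d > 0" using cd by (rule quotient_of_denom_pos)
  have cop: "coprime c d" using cd by (rule quotient_of_coprime)
  have b0: "b \<noteq> 0" using b by auto
  have "(of_int (a * d) :: rat) = of_int (c * b)"
    using x x' d b0 by (simp add: field_simps)
  then have "a * d = c * b" by (simp only: of_int_eq_iff)
  then have "d dvd c * b" by (metis dvd_triv_right)
  then have "d dvd b" using cop by (simp add: coprime_commute coprime_dvd_mult_right_iff)
  then have "\<not> int p dvd d" using b dvd_trans by blast
  then show "x \<in> p_integral p" by (simp add: p_integral_def cd)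
qed

context
  fixes p :: nat
  assumes p: "prime p"
begin

lemma p_integral_of_int [simp]: "of_int a \<in> p_integral p"
proof -
  have "\<not> int p dvd 1" using p prime_gt_1_nat[OF p] by (auto dest: zdvd_imp_le)
  then show ?thesis unfolding p_integral_iff[OF p] by (intro exI[of _ a] exI[of _ 1]) auto
qed

lemma p_integral_0 [simp]: "0 \<in> p_integral p" and p_integral_1 [simp]: "1 \<in> p_integral p"
  using p_integral_of_int[of 0] p_integral_of_int[of 1] by simp_all

lemma p_integral_mult: "x \<in> p_integral p \<Longrightarrow> y \<in> p_integral p \<Longrightarrow> x * y \<in> p_integral p"
proof -
  assume "x \<in> p_integral p" "y \<in> p_integral p"
  then obtain a b c d where "\<not> int p dvd b" "x = of_int a / of_int b" "\<not> int p dvd d" "y = of_int c / of_int d"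
    unfolding p_integral_iff[OF p] by blast
  then show ?thesis
    unfolding p_integral_iff[OF p] using p by (intro exI[of _ "a * c"] exI[of _ "b * d"]) (auto simp: prime_dvd_mult_iff)
qed

lemma p_integral_add: "x \<in> p_integral p \<Longrightarrow> y \<in> p_integral p \<Longrightarrow> x + y \<in> p_integral p"
proof -
  assume "x \<in> p_integral p" "y \<in> p_integral p"
  then obtain a b c d where *: "\<not> int p dvd b" "x = of_int a / of_int b" "\<not> int p dvd d" "y = of_int c / of_int d"
    unfolding p_integral_iff[OF p] by blast
  then have "b \<noteq> 0" "d \<noteq> 0" by auto
  then have "x + y = of_int (a * d + c * b) / of_int (b * d)" using * by (simp add: field_simps)
  then show ?thesis
    unfolding p_integral_iff[OF p] using p * by (intro exI[of _ "a * d + c * b"] exI[of _ "b * d"]) (auto simp: prime_dvd_mult_iff)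
qed

lemma p_integral_minus: "x \<in> p_integral p \<Longrightarrow> - x \<in> p_integral p"
  using p_integral_mult[OF p_integral_of_int[of "- 1"]] by simp

lemma p_integral_diff: "x \<in> p_integral p \<Longrightarrow> y \<in> p_integral p \<Longrightarrow> x - y \<in> p_integral p"
  using p_integral_add[of x "- y"] p_integral_minus by simp

lemma p_integral_sum: "(\<And>i. i \<in> I \<Longrightarrow> f i \<in> p_integral p) \<Longrightarrow> sum f I \<in> p_integral p"
  by (induction I rule: infinite_finite_induct) (auto intro: p_integral_add)

lemma p_integral_power: "x \<in> p_integral p \<Longrightarrow> x ^ n \<in> p_integral p"
  by (induction n) (auto intro: p_integral_mult)

lemma p_integral_Ints: "x \<in> \<int> \<Longrightarrow> x \<in> p_integral p"
  by (elim Ints_cases) simp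

lemma p_integral_powi:
  assumes "\<not> p dvd l"
  shows "of_nat l powi n \<in> p_integral p"
proof -
  have "inverse (of_nat l) \<in> p_integral p"
    unfolding p_integral_iff[OF p] using assms
    by (intro exI[of _ 1] exI[of _ "int l"]) (auto simp: divide_inverse)
  moreover have "of_nat l \<in> p_integral p" using p_integral_of_int[of "int l"] by simp
  ultimately show ?thesis by (auto simp: power_int_def intro: p_integral_power)
qed

definition fps_p_integral :: "rat fps set" where
  "fps_p_integral = {F. \<forall>n. fps_nth F n \<in> p_integral p}"

lemma fps_p_integralD: "F \<in> fps_p_integral \<Longrightarrow> fps_nth F n \<in> p_integral p"
  by (simp add: fps_p_integral_def)

lemma fps_p_integral_mult: "F \<in> fps_p_integral \<Longrightarrow> G \<in> fps_p_integral \<Longrightarrow> F * G \<in> fps_p_integral"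
  unfolding fps_p_integral_def by (auto simp: fps_mult_nth intro!: p_integral_sum p_integral_mult)

lemma fps_p_integral_Z: "F \<in> Z_fps \<Longrightarrow> F \<in> fps_p_integral"
  by (auto simp: fps_p_integral_def Z_fps_def intro: p_integral_Ints)

lemma fps_p_integral_power: "F \<in> fps_p_integral \<Longrightarrow> F ^ n \<in> fps_p_integral"
  by (induction n) (auto intro: fps_p_integral_mult fps_p_integral_Z Z_fps_one)

lemma fps_p_integral_inverse:
  assumes F: "F \<in> fps_p_integral" and F0: "fps_nth F 0 = 1"
  shows "inverse F \<in> fps_p_integral"
proof -
  have "fps_nth (inverse F) n \<in> p_integral p" for n
  proof (induction n rule: less_induct)
    case (less n)
    have "F * inverse F = 1" using F0 inverse_mult_eq_1'[of F] by simp
    then have eq: "(\<Sum>i=0..n. fps_nth F i * fps_nth (inverse F) (n - i)) = fps_nth 1 n"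
      by (metis fps_mult_nth)
    have "{0..n} = insert 0 {1..n}" by auto
    then have "fps_nth (inverse F) n = fps_nth 1 n - (\<Sum>i\<in>{1..n}. fps_nth F i * fps_nth (inverse F) (n - i))"
      using eq F0 by simp
    moreover have "(\<Sum>i\<in>{1..n}. fps_nth F i * fps_nth (inverse F) (n - i)) \<in> p_integral p"
      by (intro p_integral_sum p_integral_mult less.IH fps_p_integralD[OF F]) auto
    moreover have "(fps_nth 1 n :: rat) \<in> p_integral p" by simp
    ultimately show ?case using p_integral_diff by simp
  qed
  then show ?thesis by (simp add: fps_p_integral_def)
qed

lemma fps_p_integral_powi:
  assumes F: "F \<in> fps_p_integral" and F0: "fps_nth F 0 = 1"
  shows "F powi n \<in> fps_p_integral"
  unfolding power_int_def using assms by (auto intro!: fps_p_integral_power fps_p_integral_inverse)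

text \<open>The series \<open>fps_X ^ (N - j) * V ^ j\<close> starts in degree \<open>N - j\<close>
  with coefficient 1, so the system is unitriangular and is solved degree by degree within the
  \<open>p\<close>-integral numbers. It expresses a principal part of order \<open>N\<close>,
  multiplied by \<open>q^N\<close>, through powers of the reciprocal Hauptmodul.\<close>

lemma triangular_solve:
  fixes B V :: "rat fps"
  assumes B: "B \<in> fps_p_integral" and V: "V \<in> fps_p_integral" and V0: "fps_nth V 0 = 1"
  shows "\<exists>b. (\<forall>j\<le>N. b j \<in> p_integral p) \<and>
    (\<forall>i\<le>N. fps_nth B i = (\<Sum>j\<le>N. b j * fps_nth (fps_X ^ (N - j) * V ^ j) i))"
proof -
  have V0': "fps_nth (V ^ j) 0 = 1" for j using V0 by (simp add: fps_power_zeroth)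
  have main: "\<exists>c. (\<forall>j<M. c j \<in> p_integral p) \<and>
    (\<forall>i<M. fps_nth B i = (\<Sum>j<M. c j * fps_nth (fps_X ^ j * V ^ (N - j)) i))" for M
  proof (induction M)
    case (Suc M)
    then obtain c where c: "\<forall>j<M. c j \<in> p_integral p"
      and eq: "\<forall>i<M. fps_nth B i = (\<Sum>j<M. c j * fps_nth (fps_X ^ j * V ^ (N - j)) i)" by blast
    define t where "t = fps_nth B M - (\<Sum>j<M. c j * fps_nth (fps_X ^ j * V ^ (N - j)) M)"
    have "fps_nth (fps_X ^ j * V ^ (N - j)) M \<in> p_integral p" for j
      by (intro fps_p_integralD fps_p_integral_mult fps_p_integral_power V fps_p_integral_Z Z_fps_X_power)
    then have t: "t \<in> p_integral p"
      unfolding t_def using c by (intro p_integral_diff fps_p_integralD[OF B] p_integral_sum p_integral_mult) auto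
    define c' where "c' = c(M := t)"
    have s: "(\<Sum>j<M. c' j * f j) = (\<Sum>j<M. c j * f j)" for f :: "nat \<Rightarrow> rat"
      by (rule sum.cong) (auto simp: c'_def)
    have "fps_nth B i = (\<Sum>j<Suc M. c' j * fps_nth (fps_X ^ j * V ^ (N - j)) i)" if "i < Suc M" for i
    proof (cases "i = M")
      case True
      then show ?thesis using s[of "\<lambda>j. fps_nth (fps_X ^ j * V ^ (N - j)) M"] V0'[of "N - M"]
        by (simp add: c'_def t_def fps_X_power_mult_nth)
    next
      case False
      then show ?thesis using that eq s[of "\<lambda>j. fps_nth (fps_X ^ j * V ^ (N - j)) i"]
        by (simp add: fps_X_power_mult_nth)
    qed
    moreover have "\<forall>j<Suc M. c' j \<in> p_integral p" using c t by (simp add: c'_def less_Suc_eq)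
    ultimately show ?case by blast
  qed auto
  from main[of "Suc N"] obtain c where c: "\<forall>j<Suc N. c j \<in> p_integral p"
    and eq: "\<forall>i<Suc N. fps_nth B i = (\<Sum>j<Suc N. c j * fps_nth (fps_X ^ j * V ^ (N - j)) i)" by blast
  have "(\<Sum>j<Suc N. c j * fps_nth (fps_X ^ j * V ^ (N - j)) i) = (\<Sum>j\<le>N. c (N - j) * fps_nth (fps_X ^ (N - j) * V ^ j) i)" for i
    by (rule sum.reindex_bij_witness[of _ "\<lambda>j. N - j" "\<lambda>j. N - j"]) auto
  then show ?thesis using c eq by (intro exI[of _ "\<lambda>j. c (N - j)"]) auto
qed

end

lemma ex_ec_eq:
  assumes "q \<noteq> 0" "norm q < 1"
  shows "\<exists>z\<in>uhp. ec z = q"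
proof
  define z where "z = Ln q / (2 * pi * \<i>)"
  show "ec z = q" using assms(1) by (simp add: ec_def z_def)
  have "Im z = - Re (Ln q) / (2 * pi)"
    by (simp add: z_def Im_divide power2_eq_square)
  then show "z \<in> uhp" using assms by (simp add: divide_neg_pos)
qed

lemma ec_tendsto_0: "filterlim ec (at 0) at_ii_inf"
proof -
  have "((\<lambda>z. exp (- (2 * pi) * Im z)) \<longlongrightarrow> 0) at_ii_inf"
  proof -
    have "((\<lambda>y. exp (- (2 * pi) * y)) \<longlongrightarrow> 0) at_top" by real_asymp
    then show ?thesis using filterlim_compose[OF _ filterlim_filtercomap] by blast
  qed
  then have "((\<lambda>z. norm (ec z)) \<longlongrightarrow> 0) at_ii_inf" by (simp add: norm_ec)
  then have "(ec \<longlongrightarrow> 0) at_ii_inf" by (rule tendsto_norm_zero_cancel)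
  then show ?thesis by (simp add: filterlim_at)
qed

lemma at_ii_inf_shift:
  assumes "p > 0"
  shows "filterlim (\<lambda>z. (z + of_int m) / of_nat p) at_ii_inf at_ii_inf"
  unfolding filterlim_iff
proof (intro allI impI)
  fix P assume "eventually P at_ii_inf"
  then obtain Y where Y: "\<And>z. Im z \<ge> Y \<Longrightarrow> P z" unfolding eventually_at_ii_inf by blast
  have "P ((z + of_int m) / of_nat p)" if "Im z \<ge> real p * Y" for z
    using that assms by (intro Y) (simp add: Im_divide_of_nat field_simps)
  then show "eventually (\<lambda>z. P ((z + of_int m) / of_nat p)) at_ii_inf"
    unfolding eventually_at_ii_inf by blast
qed

text \<open>Only nonzero \<open>q\<close> have the form \<open>ec z\<close>, so the values at 0 are
  not compared; multiplying both functions by \<open>q\<close> makes them agree there as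
  well.\<close>

lemma fps_unique_punctured:
  fixes F G :: "complex fps"
  assumes f: "f has_fps_expansion F" and g: "g has_fps_expansion G"
    and eq: "\<And>q. q \<noteq> 0 \<Longrightarrow> norm q < 1 \<Longrightarrow> f q = g q"
  shows "F = G"
proof -
  have F: "(\<lambda>q. q * f q) has_fps_expansion fps_X * F" and G: "(\<lambda>q. q * g q) has_fps_expansion fps_X * G"
    using f g by (auto intro!: fps_expansion_intros)
  have "eventually (\<lambda>q. q * f q = q * g q) (nhds 0)"
    using eventually_norm_less_1 by eventually_elim (metis eq mult_zero_left)
  then have "(\<lambda>q. q * f q) has_fps_expansion fps_X * G"
    using G has_fps_expansion_cong[of "\<lambda>q. q * f q" "\<lambda>q. q * g q" "fps_X * G" "fps_X * G"] by simp
  then have "fps_X * F = fps_X * G" using F fps_expansion_unique_complex by blast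
  then show ?thesis by simp
qed

lemma fps_expansion_div_power_tendsto_0:
  fixes F :: "complex fps"
  assumes f: "f has_fps_expansion F" and F: "\<And>i. i \<le> N \<Longrightarrow> fps_nth F i = 0"
  shows "((\<lambda>q. f q / q ^ N) \<longlongrightarrow> 0) (at 0)"
proof (cases "F = 0")
  case True
  then have "eventually (\<lambda>q. f q = 0) (nhds 0)" using f by (simp add: has_fps_expansion_0_iff)
  then have "eventually (\<lambda>q. f q = 0) (at 0)" by (auto simp: eventually_at_filter elim: eventually_mono)
  then have "eventually (\<lambda>q. f q / q ^ N = 0) (at 0)" by eventually_elim simp
  then show ?thesis by (rule tendsto_eventually)
next
  case False
  then have "N \<le> subdegree F" using F[of "subdegree F"] nth_subdegree_nonzero[OF False] by (meson nle_le)
  from has_fps_expansion_shift[OF f this F[OF order_refl, symmetric]]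
  have "(\<lambda>q. if q = 0 then 0 else f q / q ^ N) has_fps_expansion fps_shift N F" .
  from has_fps_expansion_imp_tendsto_0[OF this] F[of N]
  have "((\<lambda>q. if q = 0 then 0 else f q / q ^ N) \<longlongrightarrow> 0) (nhds 0)" by simp
  then have "((\<lambda>q. if q = 0 then 0 else f q / q ^ N) \<longlongrightarrow> 0) (at 0)"
    by (rule tendsto_mono[OF at_within_le_nhds])
  then show ?thesis
    by (rule Lim_transform_eventually) (auto simp: eventually_at_filter)
qed

lemma cfps_0 [simp]: "cfps 0 = 0"
  by (rule fps_ext) simp

lemma cfps_diff: "cfps (F - G) = cfps F - cfps G"
  by (rule fps_ext) (simp add: of_rat_diff)

lemma cfps_sum: "cfps (sum F I) = (\<Sum>i\<in>I. cfps (F i))"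
  by (induction I rule: infinite_finite_induct) (simp_all add: cfps_add)

lemma cfps_const: "cfps (fps_const c) = fps_const (of_rat c)"
  by (rule fps_ext) simp

lemma cfps_X: "cfps fps_X = fps_X"
  by (rule fps_ext) (simp add: fps_X_def)

lemma cfps_inj: "cfps F = cfps G \<Longrightarrow> F = G"
  by (simp add: fps_eq_iff)

lemma eta_series_nth_0: "p > 0 \<Longrightarrow> fps_nth (eta_series r s p) 0 = 1"
  by (simp add: eta_series_eq fps_powi_nth_0)

context prime_gt3
begin

lemma shifted_coeff_nonzeroE:
  assumes "shifted_coeff r s p N \<noteq> 0"
  obtains n where "N = 24 * int n + (r + s * int p)"
  using assms shifted_coeff_eq_0[of N r s p] by blast

text \<open>All exponents are congruent to \<open>e\<close> modulo 24. If
  \<open>0 \<le> e < 24\<close>, none of them is negative, so none lies below \<open>e\<close>; if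
  \<open>e < 0\<close>, none lies below \<open>e * l^2 = e - 24 * N0\<close>, where the last term of
  \<open>hecke_coeff\<close> starts.\<close>

lemma hecke_coeff_support:
  assumes e: "e = r + s * int p"
    and N0: "(N0 = 0 \<and> 0 \<le> e \<and> e < 24) \<or> (e < 0 \<and> 24 * int N0 = - e * ((int l)\<^sup>2 - 1))"
    and nz: "hecke_coeff r s p M \<noteq> 0"
  shows "M \<in> range (\<lambda>n. 24 * int n + e - 24 * int N0)"
proof -
  obtain a where a: "(int l)\<^sup>2 = 1 + 24 * a" using l2_mod_24 by blast
  have "(int l)\<^sup>2 > 0" using l_gt3 by simp
  then have a0: "a \<ge> 0" using a by linarith
  have N0e: "e \<ge> 0 \<or> int N0 = - (e * a)" using N0 a by auto
  have "\<exists>t. M = 24 * t + e \<and> t + int N0 \<ge> 0"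
  proof -
    consider "shifted_coeff r s p (int (l\<^sup>2) * M) \<noteq> 0" | "shifted_coeff r s p M \<noteq> 0" 
      | "int (l\<^sup>2) dvd M" "shifted_coeff r s p (M div int (l\<^sup>2)) \<noteq> 0"
      using nz
      by (cases "shifted_coeff r s p (int (l\<^sup>2) * M) = 0"; cases "shifted_coeff r s p M = 0")
         (auto simp: hecke_coeff_def split: if_splits)
    then show ?thesis
    proof cases
      case 1
      then obtain n where "int (l\<^sup>2) * M = 24 * int n + e" using e by (elim shifted_coeff_nonzeroE) auto
      then have n: "M + 24 * (a * M) = 24 * int n + e" using a by (simp add: algebra_simps)
      then have t: "M = 24 * (int n - a * M) + e" by simp
      have "int n - a * M + int N0 \<ge> 0"
      proof (cases "e \<ge> 0")
        case True
        then have e24: "e < 24" using N0 by auto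
        have "M \<ge> 0"
        proof (rule ccontr)
          assume "\<not> M \<ge> 0"
          then have "a * M \<le> 0" using a0 by (simp add: mult_nonneg_nonpos)
          then show False using n True \<open>\<not> M \<ge> 0\<close> by linarith
        qed
        then have "24 * (int n - a * M) + e \<ge> 0" by (subst t[symmetric])
        \<comment> \<open>Here \<open>e < 24\<close> enters: a nonnegative exponent congruent to
          \<open>e\<close> modulo 24 cannot be smaller than \<open>e\<close>.\<close>
        moreover have "24 * v + e \<ge> 0 \<Longrightarrow> v \<ge> 0" for v using e24 by presburger
        ultimately have "int n - a * M \<ge> 0" by blast
        then show ?thesis by simp
      next
        case False
        have "M \<ge> e"
        proof (rule ccontr)
          assume "\<not> M \<ge> e"
          then have "a * M \<le> 0" using a0 False by (simp add: mult_nonneg_nonpos)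
          then show False using n \<open>\<not> M \<ge> e\<close> by linarith
        qed
        then have "24 * (int n - a * M) + e \<ge> e" by (subst t[symmetric])
        then show ?thesis by simp
      qed
      then show ?thesis using t by blast
    next
      case 2
      then obtain n where "M = 24 * int n + e" using e by (elim shifted_coeff_nonzeroE) auto
      then show ?thesis by (intro exI[of _ "int n"]) auto
    next
      case 3
      then obtain n where n: "M div int (l\<^sup>2) = 24 * int n + e" using e by (elim shifted_coeff_nonzeroE) auto
      have "M = (1 + 24 * a) * (24 * int n + e)"
        using 3(1) unfolding n[symmetric] a[symmetric] by simp
      then have "M = 24 * (int n + 24 * (a * int n) + e * a) + e" by (simp add: algebra_simps)
      moreover have "int n + 24 * (a * int n) + e * a + int N0 \<ge> 0"
      proof -
        have "a * int n \<ge> 0" using a0 by simp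
        moreover have "e * a + int N0 \<ge> 0" using N0e a0 by auto
        ultimately show ?thesis by linarith
      qed
      ultimately show ?thesis by blast
    qed
  qed
  then obtain t where "M = 24 * t + e" "t + int N0 \<ge> 0" by blast
  then show ?thesis by (intro range_eqI[of _ _ "nat (t + int N0)"]) auto
qed

definition hecke_fps :: "int \<Rightarrow> int \<Rightarrow> nat \<Rightarrow> nat \<Rightarrow> rat fps" where
  "hecke_fps r s p N0 = Abs_fps (\<lambda>n. hecke_coeff r s p (24 * int n + (r + s * int p) - 24 * int N0))"

text \<open>In the variable \<open>q\<close> this is \<open>q^N0\<close> times
  \<open>hecke_quot r s p\<close>, extended to \<open>q = 0\<close>; the exponent \<open>N0\<close>
  clears the pole at infinity.\<close>

definition hecke_quot_q :: "int \<Rightarrow> int \<Rightarrow> nat \<Rightarrow> nat \<Rightarrow> complex \<Rightarrow> complex" where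
  "hecke_quot_q r s p N0 q = (\<Sum>n. of_rat (fps_nth (hecke_fps r s p N0) n) * q ^ n) / eta_quot_q r s p q"

context
  fixes r s :: int and p N0 :: nat
  assumes p: "p > 0" "\<not> int l dvd int p" and odd: "odd (r + s)"
    and N0: "(N0 = 0 \<and> 0 \<le> r + s * int p \<and> r + s * int p < 24) \<or>
      (r + s * int p < 0 \<and> 24 * int N0 = - (r + s * int p) * ((int l)\<^sup>2 - 1))"
begin

lemma hecke_fps_sums:
  assumes z: "z \<in> uhp"
  shows "(\<lambda>n. of_rat (fps_nth (hecke_fps r s p N0) n) * ec z ^ n) sums
    (ec z ^ N0 * eta_quot_q r s p (ec z) * hecke_quot r s p z)"
proof -
  define e where "e = r + s * int p"
  define h where "h = (\<lambda>n. 24 * int n + e - 24 * int N0)"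
  have inj: "inj h" by (auto intro!: injI simp: h_def)
  have "((\<lambda>M. of_rat (hecke_coeff r s p M) * ec (of_int M * z / 24)) has_sum eta_quot r s p z * hecke_quot r s p z) UNIV"
    by (rule hecke_quot_expansion[OF p odd z])
  then have "((\<lambda>M. of_rat (hecke_coeff r s p M) * ec (of_int M * z / 24)) has_sum eta_quot r s p z * hecke_quot r s p z) (range h)"
    by (rule has_sum_cong_neutral[THEN iffD1, rotated -1])
       (use hecke_coeff_support[OF e_def N0[folded e_def]] in \<open>auto simp: h_def\<close>)
  then have "((\<lambda>n. of_rat (hecke_coeff r s p (h n)) * ec (of_int (h n) * z / 24)) has_sum eta_quot r s p z * hecke_quot r s p z) UNIV"
    by (simp only: has_sum_reindex[OF inj] o_def)
  from has_sum_cmult_right[OF this, of "ec z ^ N0 * inverse (ec (of_int e * z / 24))"]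
  have "((\<lambda>n. ec z ^ N0 * inverse (ec (of_int e * z / 24)) * (of_rat (hecke_coeff r s p (h n)) * ec (of_int (h n) * z / 24))) has_sum
      ec z ^ N0 * inverse (ec (of_int e * z / 24)) * (eta_quot r s p z * hecke_quot r s p z)) UNIV" .
  moreover have "ec z ^ N0 * inverse (ec (of_int e * z / 24)) * (of_rat (hecke_coeff r s p (h n)) * ec (of_int (h n) * z / 24)) =
      of_rat (fps_nth (hecke_fps r s p N0) n) * ec z ^ n" for n
  proof -
    have "ec z ^ N0 * inverse (ec (of_int e * z / 24)) * ec (of_int (h n) * z / 24) = ec z ^ n"
      unfolding ec_power ec_minus[symmetric] ec_add[symmetric] by (simp add: h_def field_simps)
    then show ?thesis by (simp add: hecke_fps_def h_def e_def mult_ac)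
  qed
  moreover have "ec z ^ N0 * inverse (ec (of_int e * z / 24)) * (eta_quot r s p z * hecke_quot r s p z) =
     ec z ^ N0 * eta_quot_q r s p (ec z) * hecke_quot r s p z"
    unfolding eta_quot_eq_q[OF p(1) z] e_def[symmetric] by simp
  ultimately have "((\<lambda>n. of_rat (fps_nth (hecke_fps r s p N0) n) * ec z ^ n) has_sum
      ec z ^ N0 * eta_quot_q r s p (ec z) * hecke_quot r s p z) UNIV" by (simp only:)
  then show ?thesis by (rule has_sum_imp_sums)
qed

lemma hecke_quot_q_ec:
  assumes z: "z \<in> uhp"
  shows "hecke_quot_q r s p N0 (ec z) = ec z ^ N0 * hecke_quot r s p z"
  using hecke_fps_sums[OF z] eta_quot_q_nonzero[OF p(1), of "ec z" r s] z
  by (simp add: hecke_quot_q_def sums_iff norm_ec)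

lemma hecke_quot_q_expansion:
  "hecke_quot_q r s p N0 has_fps_expansion cfps (hecke_fps r s p N0 * inverse (eta_series r s p))"
proof -
  have "(\<lambda>q. \<Sum>n. of_rat (fps_nth (hecke_fps r s p N0) n) * q ^ n) has_fps_expansion cfps (hecke_fps r s p N0)"
  proof (rule has_fps_expansionI, rule eventually_mono[OF eventually_norm_less_1])
    fix q :: complex assume q: "norm q < 1"
    have "summable (\<lambda>n. of_rat (fps_nth (hecke_fps r s p N0) n) * q ^ n)"
    proof (cases "q = 0")
      case False
      then obtain z where "z \<in> uhp" "ec z = q" using ex_ec_eq q by blast
      then show ?thesis using hecke_fps_sums[of z] by (auto simp: sums_iff)
    qed simp
    then show "(\<lambda>n. fps_nth (cfps (hecke_fps r s p N0)) n * q ^ n) sums (\<Sum>n. of_rat (fps_nth (hecke_fps r s p N0) n) * q ^ n)"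
      by (simp add: summable_sums)
  qed
  then have "(\<lambda>q. (\<Sum>n. of_rat (fps_nth (hecke_fps r s p N0) n) * q ^ n) * inverse (eta_quot_q r s p q)) has_fps_expansion
      cfps (hecke_fps r s p N0) * inverse (cfps (eta_series r s p))"
    by (intro has_fps_expansion_mult has_fps_expansion_inverse eta_quot_q_expansion p)
       (simp_all add: eta_series_nth_0 p)
  then show ?thesis
    by (simp add: hecke_quot_q_def[abs_def] divide_inverse cfps_mult cfps_inverse eta_series_nth_0 p)
qed

end

end

definition phi_fps :: "nat \<Rightarrow> rat fps" where
  "phi_fps p = (euler_scaled p * inverse (euler_scaled 1)) ^ hauptmodul_exp p"

text \<open>The quotient of \<open>phi p\<close> by \<open>q\<close> as a function of
  \<open>q\<close>; its expansion has constant term 1, so that it can be inverted over the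
  \<open>p\<close>-integral numbers.\<close>

definition phi_unit :: "nat \<Rightarrow> complex \<Rightarrow> complex" where
  "phi_unit p q = (euler (q ^ p) * inverse (euler q)) ^ hauptmodul_exp p"

lemma phi_fps_nth_0: "fps_nth (phi_fps p) 0 = 1"
  by (simp add: phi_fps_def fps_power_zeroth)

lemma phi_unit_expansion:
  assumes "p > 0"
  shows "phi_unit p has_fps_expansion cfps (phi_fps p)"
proof -
  have "(\<lambda>q. (euler (q ^ p) * inverse (euler (q ^ 1))) ^ hauptmodul_exp p) has_fps_expansion
      (cfps (euler_scaled p) * inverse (cfps (euler_scaled 1))) ^ hauptmodul_exp p"
    using assms
    by (intro has_fps_expansion_power has_fps_expansion_mult has_fps_expansion_inverse euler_scaled_expansion) auto
  then show ?thesis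
    by (simp add: phi_unit_def[abs_def] phi_fps_def cfps_power cfps_mult cfps_inverse)
qed

context genus_0_prime
begin

lemma phi_eq_unit:
  assumes z: "z \<in> uhp"
  shows "phi p z = ec z * phi_unit p (ec z)"
proof -
  have pz: "of_nat p * z \<in> uhp" using z k_facts(4) by simp
  have "ec (of_nat p * z / 24) / ec (z / 24) = ec (of_nat (p - 1) * z / 24)"
    unfolding ec_diff[symmetric] using k_facts(4) by (simp add: of_nat_diff algebra_simps diff_divide_distrib)
  moreover have "ec (of_nat (p - 1) * z / 24) ^ k = ec z"
  proof -
    have "complex_of_nat k * of_nat (p - 1) = 24" using k_facts(1) by (metis of_nat_mult of_nat_numeral)
    then have "of_nat k * (of_nat (p - 1) * z / 24) = z" by (simp add: mult.assoc[symmetric])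
    then show ?thesis by (simp only: ec_power)
  qed
  moreover have "eta (of_nat p * z) / eta z = (ec (of_nat p * z / 24) / ec (z / 24)) * (euler (ec z ^ p) * inverse (euler (ec z)))"
    unfolding eta_eq_euler[OF z] eta_eq_euler[OF pz] ec_power
    by (simp only: divide_inverse inverse_mult_distrib mult_ac)
  ultimately show ?thesis
    unfolding phi_def phi_unit_def k_facts(2)[symmetric] by (simp add: power_mult_distrib)
qed

lemma phi_tendsto_0: "(phi p \<longlongrightarrow> 0) at_ii_inf"
proof -
  have "(\<lambda>q. q * phi_unit p q) has_fps_expansion fps_X * cfps (phi_fps p)"
    by (intro fps_expansion_intros phi_unit_expansion k_facts)
  from has_fps_expansion_imp_tendsto_0[OF this]
  have "((\<lambda>q. q * phi_unit p q) \<longlongrightarrow> 0) (nhds 0)" by simp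
  then have "((\<lambda>q. q * phi_unit p q) \<longlongrightarrow> 0) (at 0)" by (rule tendsto_mono[OF at_within_le_nhds])
  then have "((\<lambda>z. ec z * phi_unit p (ec z)) \<longlongrightarrow> 0) at_ii_inf"
    by (rule filterlim_compose[OF _ ec_tendsto_0])
  moreover have "eventually (\<lambda>z. ec z * phi_unit p (ec z) = phi p z) at_ii_inf"
    unfolding eventually_at_ii_inf using phi_eq_unit by (intro exI[of _ 1]) auto
  ultimately show ?thesis by (rule Lim_transform_eventually)
qed

end

section \<open>The Hecke image as a polynomial in the Hauptmodul\<close>

locale hecke_setting = prime_gt3 l + genus_0_prime p k for l p k :: nat +
  fixes r s :: int
  assumes l_ne_p: "l \<noteq> p" and odd_rs: "odd (r + s)"
    and order_inf: "0 \<le> r + s * int p" "r + s * int p < 24" and order_0: "s + r * int p < 0"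
begin

lemma l_p: "\<not> int l dvd int p" "\<not> p dvd l"
  using primes_dvd_imp_eq[OF prime_l k_facts(5)] primes_dvd_imp_eq[OF k_facts(5) prime_l] l_ne_p by auto

text \<open>The order of the pole of \<open>hecke_quot s r p\<close> at infinity, that is, of \<open>hecke_quot r s p\<close> at the cusp \<open>0\<close>.\<close>

definition pole_order :: nat where
  "pole_order = nat (- (s + r * int p) * ((int l)\<^sup>2 - 1) div 24)"

lemma pole_order: "24 * int pole_order = - (s + r * int p) * ((int l)\<^sup>2 - 1)"
proof -
  define X where "X = - (s + r * int p) * ((int l)\<^sup>2 - 1)"
  have "24 dvd X"
    unfolding X_def using dvd_24_square_minus_one[OF prime_l l_gt3] by (rule dvd_mult)
  moreover have "X \<ge> 0"
    unfolding X_def using order_0 l_pos by (intro mult_nonneg_nonneg) auto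
  ultimately show ?thesis
    unfolding pole_order_def X_def[symmetric] by (simp add: pos_imp_zdiv_nonneg_iff)
qed

lemma support_inf: "((0::nat) = 0 \<and> 0 \<le> r + s * int p \<and> r + s * int p < 24) \<or>
    (r + s * int p < 0 \<and> 24 * int 0 = - (r + s * int p) * ((int l)\<^sup>2 - 1))"
  using order_inf by simp

lemma support_0: "(pole_order = 0 \<and> 0 \<le> s + r * int p \<and> s + r * int p < 24) \<or>
    (s + r * int p < 0 \<and> 24 * int pole_order = - (s + r * int p) * ((int l)\<^sup>2 - 1))"
  using order_0 pole_order by simp

lemma odd_sr: "odd (s + r)" using odd_rs by (simp add: add.commute)

text \<open>The only denominators are powers of \<open>l\<close>, a prime different from
  \<open>p\<close>. The exponents are left free because both \<open>(r, s)\<close> and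
  \<open>(s, r)\<close> are needed.\<close>

lemma hecke_coeff_p_integral: "hecke_coeff r' s' p M \<in> p_integral p"
proof -
  note P = k_facts(5)
  have c: "shifted_coeff r' s' p N \<in> p_integral p" for N
    unfolding shifted_coeff_def by (intro p_integral_Ints[OF P] eta_coeff_Ints k_facts)
  have K: "hecke_const r' s' p \<in> p_integral p"
    unfolding hecke_const_def
    by (intro p_integral_mult[OF P] p_integral_of_int[OF P] p_integral_powi[OF P] l_p)
  show ?thesis
    unfolding hecke_coeff_def
    by (intro p_integral_add[OF P] p_integral_mult[OF P] p_integral_of_int[OF P] p_integral_powi[OF P] l_p c K)
       (simp add: c p_integral_0[OF P])
qed

lemma eta_series_p_integral: "eta_series r' s' p \<in> fps_p_integral p"
  unfolding eta_series_eq[OF k_facts(4)]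
  by (intro fps_p_integral_mult fps_p_integral_powi fps_p_integral_Z euler_scaled_Z k_facts) auto

lemma phi_fps_p_integral: "phi_fps p \<in> fps_p_integral p"
  unfolding phi_fps_def
  by (intro fps_p_integral_mult fps_p_integral_power fps_p_integral_inverse fps_p_integral_Z euler_scaled_Z k_facts) auto

text \<open>The coefficients \<open>b\<close> are chosen at the cusp 0, so that
  \<open>hecke_quot s r p\<close> minus the polynomial in the reciprocal of \<open>phi p\<close>
  tends to 0. The corresponding difference for \<open>hecke_quot r s p\<close> stays finite at
  infinity, and \<open>modular_family_eq_0\<close> makes it vanish.\<close>

lemma hecke_quot_polynomial:
  "\<exists>b. (\<forall>j\<le>pole_order. b j \<in> p_integral p) \<and>
    (\<forall>z\<in>uhp. hecke_quot r s p z = (\<Sum>j\<le>pole_order. of_rat (b j) * (of_nat p ^ (k div 2) * phi p z) ^ j))"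
proof -
  define N where "N = pole_order"
  define B where "B = hecke_fps s r p N * inverse (eta_series s r p)"
  define V where "V = inverse (phi_fps p)"
  have Bint: "B \<in> fps_p_integral p"
    unfolding B_def
    by (intro fps_p_integral_mult fps_p_integral_inverse eta_series_p_integral k_facts eta_series_nth_0)
       (auto simp: fps_p_integral_def[OF k_facts(5)] hecke_fps_def hecke_coeff_p_integral)
  have Vint: "V \<in> fps_p_integral p"
    unfolding V_def by (intro fps_p_integral_inverse phi_fps_p_integral k_facts phi_fps_nth_0)
  obtain b where b: "\<And>j. j \<le> N \<Longrightarrow> b j \<in> p_integral p"
    and Bb: "\<And>i. i \<le> N \<Longrightarrow> fps_nth B i = (\<Sum>j\<le>N. b j * fps_nth (fps_X ^ (N - j) * V ^ j) i)"
    using triangular_solve[OF k_facts(5) Bint Vint, of N] phi_fps_nth_0 by (auto simp: V_def)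
  \<comment> \<open>\<open>D\<close> is the expansion of \<open>q^N\<close> times the difference at
    the cusp 0. It vanishes through degree \<open>N\<close> inclusive, so that after division by
    \<open>q^N\<close> even the constant term is gone.\<close>
  define D where "D = B - (\<Sum>j\<le>N. fps_const (b j) * (fps_X ^ (N - j) * V ^ j))"
  define \<delta> where "\<delta> = (\<lambda>q. hecke_quot_q s r p N q - (\<Sum>j\<le>N. of_rat (b j) * (q ^ (N - j) * inverse (phi_unit p q) ^ j)))"
  have cV: "cfps V = inverse (cfps (phi_fps p))"
    unfolding V_def by (rule cfps_inverse) (simp add: phi_fps_nth_0)
  have \<delta>: "\<delta> has_fps_expansion cfps D"
    unfolding \<delta>_def D_def cfps_diff cfps_sum cfps_mult cfps_const cfps_power cfps_X cV B_def
    unfolding cfps_mult[symmetric] N_def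
    by (intro has_fps_expansion_diff has_fps_expansion_sum has_fps_expansion_mult has_fps_expansion_power
        has_fps_expansion_const has_fps_expansion_fps_X has_fps_expansion_inverse phi_unit_expansion
        hecke_quot_q_expansion k_facts l_p odd_sr support_0)
       (simp add: phi_fps_nth_0)
  have D0: "fps_nth (cfps D) i = 0" if "i \<le> N" for i
    using Bb[OF that] by (simp add: D_def fps_sum_nth)
  define Vs where "Vs = (\<lambda>z. hecke_quot s r p z - (\<Sum>j\<le>N. of_rat (b j) * inverse (phi p z) ^ j))"
  have \<delta>_ec: "\<delta> (ec z) / ec z ^ N = Vs z" if z: "z \<in> uhp" for z
  proof -
    have "ec z ^ (N - j) * inverse (phi_unit p (ec z)) ^ j = ec z ^ N * inverse (phi p z) ^ j" if "j \<le> N" for j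
    proof -
      have "ec z ^ N = ec z ^ (N - j) * ec z ^ j" using that by (simp flip: power_add)
      then show ?thesis unfolding phi_eq_unit[OF z] by (simp add: power_mult_distrib power_inverse)
    qed
    then have "(\<Sum>j\<le>N. of_rat (b j) * (ec z ^ (N - j) * inverse (phi_unit p (ec z)) ^ j)) =
        ec z ^ N * (\<Sum>j\<le>N. of_rat (b j) * inverse (phi p z) ^ j)"
      unfolding sum_distrib_left by (intro sum.cong) (auto simp: mult_ac)
    moreover have "hecke_quot_q s r p N (ec z) = ec z ^ N * hecke_quot s r p z"
      unfolding N_def by (intro hecke_quot_q_ec k_facts l_p odd_sr support_0 z)
    ultimately show ?thesis by (simp add: \<delta>_def Vs_def field_simps)
  qed
  have "((\<lambda>q. \<delta> q / q ^ N) \<longlongrightarrow> 0) (at 0)"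
    by (rule fps_expansion_div_power_tendsto_0[OF \<delta> D0])
  then have "((\<lambda>z. \<delta> (ec z) / ec z ^ N) \<longlongrightarrow> 0) at_ii_inf"
    by (rule filterlim_compose[OF _ ec_tendsto_0])
  moreover have "eventually (\<lambda>z. \<delta> (ec z) / ec z ^ N = Vs z) at_ii_inf"
    unfolding eventually_at_ii_inf using \<delta>_ec by (intro exI[of _ 1]) auto
  ultimately have Vs: "(Vs \<longlongrightarrow> 0) at_ii_inf" by (rule Lim_transform_eventually)

  \<comment> \<open>\<open>VV\<close> and its conjugates \<open>UU\<close> carry the same
    coefficients over from the reciprocals of \<open>phi p\<close> to the powers of
    \<open>p^(k/2) * phi p\<close>.\<close>
  define VV where "VV = (\<lambda>z. hecke_quot r s p z + (\<Sum>j\<le>N. of_rat (- b j) * (of_nat p ^ (k div 2) * phi p z) ^ j))"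
  define UU where "UU = (\<lambda>m z. hecke_quot s r p ((z + of_int m) / of_nat p) + (\<Sum>j\<le>N. of_rat (- b j) * phi_inv p m z ^ j))"
  have fam: "modular_family p VV UU"
    unfolding VV_def UU_def
    by (intro modular_family_add modular_family_sum modular_family_mult modular_family_const modular_family_power
        hecke_quot_modular_family phi_modular_family k_facts l_p)
  have UU: "(UU m \<longlongrightarrow> 0) at_ii_inf" for m
  proof -
    have "((\<lambda>z. Vs ((z + of_int m) / of_nat p)) \<longlongrightarrow> 0) at_ii_inf"
      by (rule filterlim_compose[OF Vs at_ii_inf_shift[OF k_facts(4)]])
    moreover have "eventually (\<lambda>z. Vs ((z + of_int m) / of_nat p) = UU m z) at_ii_inf"
      unfolding eventually_at_ii_inf
      by (intro exI[of _ 1]) (auto simp: Vs_def UU_def phi_inv_eq_inverse[OF k_facts(4)] of_rat_minus sum_negf)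
    ultimately show ?thesis by (rule Lim_transform_eventually)
  qed
  define L where "L = fps_nth (cfps (hecke_fps r s p 0 * inverse (eta_series r s p))) 0"
  have "(hecke_quot_q r s p 0 \<longlongrightarrow> L) (nhds 0)"
    unfolding L_def
    by (intro has_fps_expansion_imp_tendsto_0 hecke_quot_q_expansion k_facts l_p odd_rs support_inf)
  then have "(hecke_quot_q r s p 0 \<longlongrightarrow> L) (at 0)" by (rule tendsto_mono[OF at_within_le_nhds])
  then have "((\<lambda>z. hecke_quot_q r s p 0 (ec z)) \<longlongrightarrow> L) at_ii_inf"
    by (rule filterlim_compose[OF _ ec_tendsto_0])
  moreover have "eventually (\<lambda>z. hecke_quot_q r s p 0 (ec z) = hecke_quot r s p z) at_ii_inf"
    unfolding eventually_at_ii_inf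
  proof (intro exI[of _ 1] allI impI)
    fix z assume "1 \<le> Im z"
    then have "z \<in> uhp" by simp
    from hecke_quot_q_ec[OF k_facts(4) l_p(1) odd_rs support_inf this]
    show "hecke_quot_q r s p 0 (ec z) = hecke_quot r s p z" by simp
  qed
  ultimately have "(hecke_quot r s p \<longlongrightarrow> L) at_ii_inf" by (rule Lim_transform_eventually)
  then have "(VV \<longlongrightarrow> L + (\<Sum>j\<le>N. of_rat (- b j) * (of_nat p ^ (k div 2) * 0) ^ j)) at_ii_inf"
    unfolding VV_def by (intro tendsto_intros phi_tendsto_0)
  from modular_family_eq_0[OF k_facts(5) fam this UU]
  have "VV z = 0" if "z \<in> uhp" for z using that by blast
  then have "hecke_quot r s p z = (\<Sum>j\<le>N. of_rat (b j) * (of_nat p ^ (k div 2) * phi p z) ^ j)" if "z \<in> uhp" for z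
    using that by (simp add: VV_def of_rat_minus sum_negf)
  then show ?thesis using b unfolding N_def by blast
qed

text \<open>In the polynomial the terms with \<open>j \<ge> 1\<close> are divisible by
  \<open>p^(k/2)\<close>, and the term \<open>j = 0\<close> is a multiple of
  \<open>eta_series r s p\<close>. Its factor is the coefficient at \<open>n = 0\<close>, because
  \<open>phi p\<close> vanishes at infinity and the eta series starts with 1.\<close>

theorem hecke_congruence:
  "\<exists>C. (\<forall>n. C n \<in> p_integral p) \<and> (\<forall>n. hecke_coeff r s p (24 * int n + (r + s * int p)) =
     hecke_coeff r s p (r + s * int p) * fps_nth (eta_series r s p) n + of_nat p ^ (k div 2) * C n)"
proof -
  obtain b where b: "\<And>j. j \<le> pole_order \<Longrightarrow> b j \<in> p_integral p"
    and poly: "\<And>z. z \<in> uhp \<Longrightarrow> hecke_quot r s p z = (\<Sum>j\<le>pole_order. of_rat (b j) * (of_nat p ^ (k div 2) * phi p z) ^ j)"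
    using hecke_quot_polynomial by blast
  define P :: rat where "P = of_nat p ^ (k div 2)"
  define Y where "Y = fps_X * phi_fps p"
  define A where "A = eta_series r s p"
  have oP: "complex_of_nat p ^ (k div 2) = of_rat P" by (simp add: P_def of_rat_power)
  have "cfps (hecke_fps r s p 0 * inverse A) = cfps (\<Sum>j\<le>pole_order. fps_const (b j) * (fps_const P * Y) ^ j)"
  proof (rule fps_unique_punctured)
    show "hecke_quot_q r s p 0 has_fps_expansion cfps (hecke_fps r s p 0 * inverse A)"
      unfolding A_def by (intro hecke_quot_q_expansion k_facts l_p odd_rs support_inf)
    show "(\<lambda>q. \<Sum>j\<le>pole_order. of_rat (b j) * (of_rat P * (q * phi_unit p q)) ^ j) has_fps_expansion
        cfps (\<Sum>j\<le>pole_order. fps_const (b j) * (fps_const P * Y) ^ j)"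
      unfolding Y_def cfps_sum cfps_mult cfps_const cfps_power cfps_X
      by (intro has_fps_expansion_sum has_fps_expansion_mult has_fps_expansion_power
        has_fps_expansion_const has_fps_expansion_fps_X phi_unit_expansion k_facts)
    fix q :: complex assume "q \<noteq> 0" "norm q < 1"
    then obtain z where z: "z \<in> uhp" "ec z = q" using ex_ec_eq by blast
    show "hecke_quot_q r s p 0 q = (\<Sum>j\<le>pole_order. of_rat (b j) * (of_rat P * (q * phi_unit p q)) ^ j)"
      using hecke_quot_q_ec[OF k_facts(4) l_p(1) odd_rs support_inf z(1)] poly[OF z(1)] phi_eq_unit[OF z(1)]
      by (simp add: z(2) oP)
  qed
  then have "hecke_fps r s p 0 * inverse A = (\<Sum>j\<le>pole_order. fps_const (b j) * (fps_const P * Y) ^ j)"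
    by (rule cfps_inj)
  then have "hecke_fps r s p 0 * (inverse A * A) = (\<Sum>j\<le>pole_order. fps_const (b j) * (fps_const P * Y) ^ j) * A"
    by (simp only: mult.assoc[symmetric])
  moreover have "inverse A * A = 1"
    by (rule inverse_mult_eq_1) (simp add: A_def eta_series_nth_0 k_facts)
  ultimately have H: "hecke_fps r s p 0 = (\<Sum>j\<le>pole_order. fps_const (b j * P ^ j) * (Y ^ j * A))"
    by (simp add: sum_distrib_right power_mult_distrib mult.assoc fps_const_power flip: fps_const_mult)
  have Hn: "hecke_coeff r s p (24 * int n + (r + s * int p)) = (\<Sum>j\<le>pole_order. b j * P ^ j * fps_nth (Y ^ j * A) n)" for n
  proof -
    have "fps_nth (hecke_fps r s p 0) n = (\<Sum>j\<le>pole_order. b j * P ^ j * fps_nth (Y ^ j * A) n)"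
      unfolding H by (simp add: fps_sum_nth mult.assoc)
    then show ?thesis by (simp add: hecke_fps_def)
  qed
  have ins: "{..pole_order} = insert 0 {1..pole_order}" by auto
  define C where "C = (\<lambda>n. \<Sum>j\<in>{1..pole_order}. b j * P ^ (j - 1) * fps_nth (Y ^ j * A) n)"
  have split: "hecke_coeff r s p (24 * int n + (r + s * int p)) = b 0 * fps_nth A n + P * C n" for n
  proof -
    have "(\<Sum>j\<in>{1..pole_order}. b j * P ^ j * fps_nth (Y ^ j * A) n) = P * C n"
      unfolding C_def sum_distrib_left
    proof (rule sum.cong)
      fix j assume "j \<in> {1..pole_order}"
      then have "P ^ j = P * P ^ (j - 1)" by (cases j) auto
      then show "b j * P ^ j * fps_nth (Y ^ j * A) n = P * (b j * P ^ (j - 1) * fps_nth (Y ^ j * A) n)" by simp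
    qed simp
    then show ?thesis unfolding Hn ins by simp
  qed
  have "C 0 = 0"
    unfolding C_def by (rule sum.neutral) (auto simp: Y_def fps_mult_nth_0 fps_power_zeroth power_0_left)
  then have b0: "hecke_coeff r s p (r + s * int p) = b 0"
    using split[of 0] by (simp add: A_def eta_series_nth_0 k_facts)
  have Yint: "Y \<in> fps_p_integral p"
    unfolding Y_def using Z_fps_X_power[of 1]
    by (intro fps_p_integral_mult phi_fps_p_integral fps_p_integral_Z k_facts) simp
  have "C n \<in> p_integral p" for n
  proof -
    have "P \<in> p_integral p" unfolding P_def
      using p_integral_of_int[OF k_facts(5), of "int p"] by (intro p_integral_power k_facts) simp
    then show ?thesis
      unfolding C_def A_def
      by (intro p_integral_sum[OF k_facts(5)] p_integral_mult[OF k_facts(5)] p_integral_power[OF k_facts(5)]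
          fps_p_integralD[OF k_facts(5)] fps_p_integral_mult[OF k_facts(5)] fps_p_integral_power[OF k_facts(5)]
          Yint eta_series_p_integral b) auto
  qed
  then show ?thesis using split unfolding b0 P_def A_def by blast
qed

end

section \<open>Comparison with the constants of the statement\<close>

context prime_gt3
begin

text \<open>Quadratic reciprocity for 3 and \<open>l\<close>: the symbol of \<open>l\<close> modulo
  3 and the reciprocity sign depend only on \<open>l\<close> modulo 12, and the four classes prime
  to 12 are compared.\<close>

lemma chi12_eq_Legendre: "chi12 (int l) = Legendre 3 (int l)"
proof -
  have QR: "Legendre 3 (int l) * Legendre (int l) 3 = (- 1) ^ ((l - 1) div 2)"
    using Quadratic_Reciprocity[of 3 l] prime_l l_gt3 by simp
  have l3: "Legendre (int l) 3 = Legendre (int l mod 3) 3"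
    by (rule Legendre_cong) (simp add: Cong.cong_def)
  have L1: "Legendre 1 3 = 1"
    by (auto simp: Legendre_def Cong.cong_def QuadRes_def intro!: exI[of _ 1])
  have L2: "Legendre 2 3 = - 1"
  proof -
    have "y\<^sup>2 mod 3 \<noteq> 2" for y :: int
    proof -
      have "y mod 3 \<in> {0, 1, 2}" unfolding insert_iff empty_iff by presburger
      then have "(y mod 3)\<^sup>2 mod 3 \<noteq> 2" by auto
      then show ?thesis by (simp add: power_mod)
    qed
    then show ?thesis by (auto simp: Legendre_def Cong.cong_def QuadRes_def)
  qed
  have "int l mod 12 \<in> {1, 5, 7, 11}"
  proof -
    have "\<not> 2 dvd int l" "\<not> 3 dvd int l"
      using coprime_12_if_prime[OF prime_l l_gt3] coprime_common_divisor[of "int l" 12 2] coprime_common_divisor[of "int l" 12 3] by auto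
    then show ?thesis using int_mod_12_cases[of "int l"] unfolding insert_iff empty_iff by presburger
  qed
  then consider "int l mod 12 = 1" | "int l mod 12 = 5" | "int l mod 12 = 7" | "int l mod 12 = 11" by blast
  then show ?thesis
  proof cases
    case 1
    then have "int l mod 3 = 1" "even ((l - 1) div 2)" by presburger+
    then show ?thesis using QR l3 L1 1 by (simp add: chi12_def)
  next
    case 2
    then have "int l mod 3 = 2" "even ((l - 1) div 2)" by presburger+
    then show ?thesis using QR l3 L2 2 by (simp add: chi12_def)
  next
    case 3
    then have "int l mod 3 = 1" "odd ((l - 1) div 2)" by presburger+
    then show ?thesis using QR l3 L1 3 by (simp add: chi12_def)
  next
    case 4
    then have "int l mod 3 = 2" "odd ((l - 1) div 2)" by presburger+
    then show ?thesis using QR l3 L2 4 by (simp add: chi12_def)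
  qed
qed

lemma Legendre_power: "Legendre (a ^ n) (int l) = Legendre a (int l) ^ n"
  by (induction n) (simp_all add: Legendre_1 Legendre_mult[OF prime_l l_pos(2)])

text \<open>With \<open>e = r + s * p\<close>, the index \<open>M = 24 * n + e\<close> equals
  \<open>24 * (n - \<Delta>) + l^2 * e\<close>. Hence \<open>M\<close> and
  \<open>24 * (n - \<Delta>)\<close> have the same Legendre symbol, and the coefficient at
  \<open>M / l^2\<close> is the one at \<open>(n - \<Delta>) / l^2\<close> in the unshifted
  indexing.\<close>

lemma hecke_coeff_eq:
  assumes t: "r + s = 2 * t + 1" and s: "s > 0"
    and \<Delta>: "24 * \<Delta> = (r + s * int p) * ((int l)\<^sup>2 - 1)"
    and \<theta>: "\<theta> = (- 1) ^ nat \<bar>t\<bar> * 2 * int p ^ nat s"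
  shows "hecke_coeff r s p (24 * int n + (r + s * int p)) =
    of_nat l powi (1 - 2 * t) * eta_coeff r s p (of_nat n * (of_nat l)\<^sup>2 + of_int \<Delta>) +
    of_int (Legendre \<theta> (int l)) * of_nat l powi (- t) * of_int (Legendre (int n - \<Delta>) (int l)) * eta_coeff r s p (of_nat n) +
    eta_coeff r s p (of_int (int n - \<Delta>) / (of_nat l)\<^sup>2)"
proof -
  define e where "e = r + s * int p"
  define M where "M = 24 * int n + e"
  have \<Delta>': "24 * \<Delta> = e * (int l)\<^sup>2 - e" using \<Delta> by (simp add: e_def algebra_simps)
  have M: "M = 24 * (int n - \<Delta>) + (int l)\<^sup>2 * e" using \<Delta>' by (simp add: M_def algebra_simps)
  have "shifted_coeff r s p (int (l\<^sup>2) * M) = eta_coeff r s p (of_nat n * (of_nat l)\<^sup>2 + of_int \<Delta>)"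
  proof -
    have "int (l\<^sup>2) * M - e = 24 * (int n * (int l)\<^sup>2 + \<Delta>)" using \<Delta>' by (simp add: M_def algebra_simps)
    then have "of_int (int (l\<^sup>2) * M - e) = (of_int (24 * (int n * (int l)\<^sup>2 + \<Delta>)) :: rat)" by (simp only:)
    then have "of_int (int (l\<^sup>2) * M - e) / 24 = (of_nat n * (of_nat l)\<^sup>2 + of_int \<Delta> :: rat)" by simp
    then show ?thesis unfolding shifted_coeff_def e_def[symmetric] by (simp only:)
  qed
  moreover have "shifted_coeff r s p M = eta_coeff r s p (of_nat n)"
    by (simp add: shifted_coeff_def M_def e_def)
  moreover have "(if int (l\<^sup>2) dvd M then shifted_coeff r s p (M div int (l\<^sup>2)) else 0) =
      eta_coeff r s p (of_int (int n - \<Delta>) / (of_nat l)\<^sup>2)"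
  proof (cases "int (l\<^sup>2) dvd M")
    case True
    then obtain M' where M': "M = int (l\<^sup>2) * M'" by auto
    have l0: "(of_nat l :: rat) \<noteq> 0" "int (l\<^sup>2) \<noteq> 0" using l_gt3 by auto
    have "(int l)\<^sup>2 * (M' - e) = 24 * (int n - \<Delta>)" using M M' by (simp add: algebra_simps)
    then have "(of_int ((int l)\<^sup>2 * (M' - e)) :: rat) = of_int (24 * (int n - \<Delta>))" by (simp only:)
    then have "(of_int (M' - e) :: rat) / 24 = of_int (int n - \<Delta>) / (of_nat l)\<^sup>2" using l0 by (simp add: field_simps)
    moreover have "M div int (l\<^sup>2) = M'" using M' l0(2) by simp
    ultimately show ?thesis using True unfolding shifted_coeff_def e_def[symmetric] by (simp only: if_True)
  next
    case False
    have "(of_int (int n - \<Delta>) / (of_nat l)\<^sup>2 :: rat) \<notin> \<nat>"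
    proof
      assume "(of_int (int n - \<Delta>) / (of_nat l)\<^sup>2 :: rat) \<in> \<nat>"
      then obtain m where "(of_int (int n - \<Delta>) / (of_nat l)\<^sup>2 :: rat) = of_nat m" by (elim Nats_cases)
      then have "(of_int (int n - \<Delta>) :: rat) = of_int (int m * (int l)\<^sup>2)" using l_gt3 by (simp add: field_simps)
      then have "int n - \<Delta> = int m * (int l)\<^sup>2" by (simp only: of_int_eq_iff)
      then have "M = int (l\<^sup>2) * (24 * int m + e)" unfolding M by (simp add: algebra_simps)
      then show False using False by simp
    qed
    then show ?thesis using False by (simp add: eta_coeff_def)
  qed
  moreover have "hecke_const r s p * of_int (Legendre M (int l)) =
      of_int (Legendre \<theta> (int l)) * of_nat l powi (- t) * of_int (Legendre (int n - \<Delta>) (int l))"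
  proof -
    note LM = Legendre_mult[OF prime_l l_pos(2)]
    have "Legendre M (int l) = Legendre (24 * (int n - \<Delta>)) (int l)"
      by (rule Legendre_cong) (simp add: M cong_iff_dvd_diff)
    then have L1: "Legendre M (int l) = Legendre 24 (int l) * Legendre (int n - \<Delta>) (int l)" by (simp only: LM)
    have n2: "\<not> int l dvd 2" "\<not> int l dvd 3" using l_gt3 by (auto dest: zdvd_imp_le)
    \<comment> \<open>The origin of the factor 2 in \<theta>: up to squares 24 is 6, and
      \<open>chi12\<close> removes the 3.\<close>
    have "Legendre (2 * 2 * (2 * 3)) (int l) = Legendre 2 (int l) * Legendre 3 (int l)"
      by (simp only: LM Legendre_unit_square[OF n2(1)] mult_1)
    then have L24: "chi12 (int l) * Legendre 24 (int l) = Legendre 2 (int l)"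
      using Legendre_unit_square[OF n2(2)] by (simp add: chi12_eq_Legendre mult.left_commute)
    have tt: "(r + s - 1) div 2 = t" using t by simp
    have ns: "nat \<bar>s\<bar> = nat s" using s by simp
    have L\<theta>: "Legendre \<theta> (int l) = Legendre (- 1) (int l) ^ nat \<bar>t\<bar> * Legendre 2 (int l) * Legendre (int p) (int l) ^ nat s"
      unfolding \<theta> by (simp only: LM Legendre_power)
    have "hecke_const r s p * of_int (Legendre M (int l)) =
        of_int (Legendre (int p) (int l) ^ nat s * (chi12 (int l) * Legendre 24 (int l)) * Legendre (- 1) (int l) ^ nat \<bar>t\<bar>) *
        of_nat l powi (- t) * of_int (Legendre (int n - \<Delta>) (int l))"
      unfolding hecke_const_def tt ns L1 by (simp add: mult_ac)
    then show ?thesis unfolding L24 L\<theta> by (simp add: mult_ac)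
  qed
  moreover have "2 - (r + s) = 1 - 2 * t" using t by simp
  ultimately show ?thesis
    unfolding hecke_coeff_def e_def[symmetric] M_def[symmetric] by (simp only:)
qed

end

theorem theorem1p5:
  fixes p l k n :: nat and r s \<theta> \<Delta> :: int and \<epsilon> lam :: rat and c :: "rat \<Rightarrow> rat"
  assumes "p \<in> {2, 3, 5, 7, 13}"
    and "prime l" and "l \<noteq> p" and "l > 3"
    and "s > 0" and "r < 0" and "odd (r + s)"
    and "0 \<le> r + s * int p" and "r + s * int p < 24" and "s + r * int p < 0"
    and "c = eta_coeff r s p"
    and "\<epsilon> = of_int (r + s) / 2"
    and "\<theta> = (-1) ^ nat \<bar>\<lfloor>1/2 - \<epsilon>\<rfloor>\<bar> * 2 * int p ^ nat s"
    and "\<Delta> = (r + s * int p) * ((int l)\<^sup>2 - 1) div 24"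
    and "k = 24 div (p - 1)"
    and "lam = of_nat l powi \<lfloor>2 - 2 * \<epsilon>\<rfloor> * c (of_int \<Delta>)
             + of_int (Legendre \<theta> (int l)) * of_nat l powi \<lfloor>1/2 - \<epsilon>\<rfloor>
                 * of_int (Legendre (- \<Delta>) (int l))
             + c (of_int (- \<Delta>) / (of_nat l)\<^sup>2)"
  shows "p_integral_cong p (k div 2)
           (of_nat l powi \<lfloor>2 - 2 * \<epsilon>\<rfloor> * c (of_nat n * (of_nat l)\<^sup>2 + of_int \<Delta>)
             + of_int (Legendre \<theta> (int l)) * of_nat l powi \<lfloor>1/2 - \<epsilon>\<rfloor>
                 * of_int (Legendre (int n - \<Delta>) (int l)) * c (of_nat n)
             + c (of_int (int n - \<Delta>) / (of_nat l)\<^sup>2))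
           (lam * c (of_nat n))"
proof -
  interpret hecke_setting l p k r s
    using assms by unfold_locales auto
  obtain t where t: "r + s = 2 * t + 1" using assms(7) by (elim oddE)
  have "2 - 2 * \<epsilon> = of_int (1 - 2 * t)" "1/2 - \<epsilon> = of_int (- t)"
    unfolding assms(12) t by (simp_all add: field_simps)
  then have fl: "\<lfloor>2 - 2 * \<epsilon>\<rfloor> = 1 - 2 * t" "\<lfloor>1/2 - \<epsilon>\<rfloor> = - t" by (simp_all only: floor_of_int)
  have \<Delta>: "24 * \<Delta> = (r + s * int p) * ((int l)\<^sup>2 - 1)"
    unfolding assms(14) using dvd_24_square_minus_one[OF assms(2,4)] by simp
  have \<theta>: "\<theta> = (- 1) ^ nat \<bar>t\<bar> * 2 * int p ^ nat s" unfolding assms(13) fl by simp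
  note coeff = hecke_coeff_eq[OF t assms(5) \<Delta> \<theta>]
  have c: "c (of_nat m) = fps_nth (eta_series r s p) m" for m
    by (simp add: assms(11) eta_coeff_def)
  have c0: "eta_coeff r s p 0 = 1"
    using c[of 0] eta_series_nth_0[OF k_facts(4)] by (simp add: assms(11))
  \<comment> \<open>\<open>lam\<close> is the left side at \<open>n = 0\<close>, except that its
    middle term lacks the factor \<open>c(0)\<close>, which is 1.\<close>
  have lam: "lam = hecke_coeff r s p (r + s * int p)"
    using coeff[of 0] unfolding assms(16) fl assms(11) by (simp add: c0)
  obtain C where C: "\<And>n. C n \<in> p_integral p"
    and eq: "\<And>n. hecke_coeff r s p (24 * int n + (r + s * int p)) =
     hecke_coeff r s p (r + s * int p) * fps_nth (eta_series r s p) n + of_nat p ^ (k div 2) * C n"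
    using hecke_congruence by blast
  have "p_integral_cong p (k div 2) (hecke_coeff r s p (24 * int n + (r + s * int p))) (lam * c (of_nat n))"
    unfolding p_integral_cong_def
  proof (intro conjI bexI[of _ "C n"])
    have "c (of_nat n) \<in> p_integral p"
      unfolding assms(11) by (intro p_integral_Ints[OF k_facts(5)] eta_coeff_Ints k_facts)
    then show "lam * c (of_nat n) \<in> p_integral p"
      unfolding lam by (intro p_integral_mult[OF k_facts(5)] hecke_coeff_p_integral)
    show "hecke_coeff r s p (24 * int n + (r + s * int p)) - lam * c (of_nat n) = of_nat p ^ (k div 2) * C n"
      unfolding eq[of n] lam c by simp
  qed (use C hecke_coeff_p_integral in auto)
  then show ?thesis unfolding coeff fl assms(11) .
qed

end
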